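(* Let $N\trianglelefteq G$. (a) For all $(H,\Phi)\in\mathcal{X}(G)$, there exists $m_{(H,\Phi)}^{G,N}\in \mathbb{K}$ such that $$\mathrm{def}^G_{G/N}(e_{(H,\Phi)}^G) = m_{(H,\Phi)}^{G,N}\cdot e_{(HN/N,\Phi_N)}^{G/N}.$$ (b) For all $\Phi\in \mathrm{Hom}(G^*,\mathbb{K}^\times)$ one has $$m_{(G,\Phi)}^N:= m_{(G,\Phi)}^{G,N} = \frac{|(G/N)^*|}{|G|\cdot|G^*|} \sum_{\substack{ K\le G \\ KN=G \\ \Phi|_{K^\perp}=1}} |K|\cdot|K^\perp|\cdot\mu(K,G)\in \mathbb{Q}.$$
   Context: $A$ is a multiplicatively written abelian group; for a finite group $H$, $H^*:=\mathrm{Hom}(H,A)$ with pointwise multiplication; a homomorphism $f\colon H\to H'$ induces $f^*\colon H'^*\to H^*$, $\lambda\mapsto\lambda\circ f$. $G$ is a finite group such that $S^*$ is finite for all subquotients $S$ of $G$, and $\mathbb{K}$ is a field of characteristic $0$ which is a splitting field of $S^*$ for all subquotients $S$ of $G$. For a finite group $S$, $[U,\phi]_S$ denotes the $S$-conjugacy class of a pair $(U,\phi)$ with $U\le S$, $\phi\in U^*$, where ${}^g(U,\phi)=({}^gU,{}^g\phi)$, ${}^gU=gUg^{-1}$, $({}^g\phi)(x)=\phi(g^{-1}xg)$. $B^A_{\mathbb{K}}(S)$ is the $\mathbb{K}$-vector space with basis these classes and multiplication $[U,\phi]_S\cdot[V,\psi]_S=\sum_{g\in[U\backslash S/V]}[U\cap{}^gV,\phi|_{U\cap{}^gV}\cdot({}^g\psi)|_{U\cap{}^gV}]_S$.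 $\mathcal{X}(S)$ is the set of pairs $(H,\Phi)$ with $H\le S$, $\Phi\in\mathrm{Hom}(H^*,\mathbb{K}^\times)$, with $S$-action ${}^g(H,\Phi)=({}^gH,{}^g\Phi)$, ${}^g\Phi(\phi)=\Phi({}^{g^{-1}}\phi)$. $s^S_{(H,\Phi)}:=s^H_\Phi\circ\pi_H\circ\mathrm{res}^S_H\colon B^A_{\mathbb{K}}(S)\to\mathbb{K}$, where $\mathrm{res}^S_H([U,\phi]_S)=\sum_{g\in[H\backslash S/U]}[H\cap{}^gU,({}^g\phi)|_{H\cap{}^gU}]_H$, $\pi_H([U,\phi]_H)=\phi\in\mathbb{K}H^*$ if $U=H$ and $0$ otherwise, $s^H_\Phi\colon\mathbb{K}H^*\to\mathbb{K}$ the linear extension of $\Phi$. $e^S_{(H,\Phi)}\in B^A_{\mathbb{K}}(S)$ is the unique (primitive) idempotent with $s^S_{(K,\Psi)}(e^S_{(H,\Phi)})=1$ if $(K,\Psi)$ is $S$-conjugate to $(H,\Phi)$ and $0$ otherwise. Deflation $\mathrm{def}^G_{G/N}\colon B^A_{\mathbb{K}}(G)\to B^A_{\mathbb{K}}(G/N)$ is the linear map with $[U,\phi]_G\mapsto[UN/N,\tilde\phi]_{G/N}$, $\tilde\phi(uN)=\phi(u)$, if $U\cap N\le\ker\phi$, and $[U,\phi]_G\mapsto0$ otherwise. For $(H,\Phi)\in\mathcal{X}(G)$, $\Phi_N:=\Phi\circ\nu^*\circ\alpha^*\in\mathrm{Hom}((HN/N)^*,\mathbb{K}^\times)$, with $\nu\colon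 H\to H/(H\cap N)$ the canonical epimorphism and $\alpha\colon H/(H\cap N)\to HN/N$ the canonical isomorphism. For $K\le G$, $K^\perp:=\{\phi\in G^*\mid\phi|_K=1\}$. $\mu$ is the Möbius function of the poset of subgroups of $G$. *)

theory Defs
  imports
    "HOL-Algebra.Algebraic_Closure_Type"
    "HOL-Library.Poly_Mapping"
    "Jordan_Normal_Form.VS_Connect"
begin

section \<open>Homomorphism groups\<close>

text \<open>Homomorphisms are taken in \<^const>\<open>extensional\<close> form, so that each has exactly one
  representing function and \<^const>\<open>card\<close> counts correctly. A subgroup \<open>U\<close> of \<open>S\<close>, regarded as a
  group, is \<open>S\<lparr>carrier := U\<rparr>\<close>.\<close>

definition hom_group ::
    "('a, 'm) monoid_scheme \<Rightarrow> ('h, 'n) monoid_scheme \<Rightarrow> ('h \<Rightarrow> 'a) monoid" where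
  "hom_group A H =
     \<lparr> carrier = hom H A \<inter> extensional (carrier H),
       monoid.mult = (\<lambda>f g. \<lambda>x\<in>carrier H. f x \<otimes>\<^bsub>A\<^esub> g x),
       monoid.one = (\<lambda>x\<in>carrier H. \<one>\<^bsub>A\<^esub>) \<rparr>"

definition hom_pullback ::
    "('h, 'n) monoid_scheme \<Rightarrow> ('h \<Rightarrow> 'h2) \<Rightarrow> ('h2 \<Rightarrow> 'a) \<Rightarrow> ('h \<Rightarrow> 'a)" where
  "hom_pullback H f \<phi> = compose (carrier H) \<phi> f"

abbreviation mult_group :: "'k::field monoid" where
  "mult_group \<equiv> mult_of (ring_of_type_algebra :: 'k ring)"

text \<open>\<open>Hom(H\<^sup>*, \<bbbK>\<^sup>\<times>)\<close>\<close>

abbreviation dual_chars ::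
    "('a, 'm) monoid_scheme \<Rightarrow> ('h, 'n) monoid_scheme \<Rightarrow> (('h \<Rightarrow> 'a) \<Rightarrow> 'k::field) set" where
  "dual_chars A H \<equiv> carrier (hom_group mult_group (hom_group A H))"

section \<open>Splitting fields\<close>

definition representation ::
    "('f, 'n) monoid_scheme \<Rightarrow> nat \<Rightarrow> ('f \<Rightarrow> 'k::field mat) \<Rightarrow> bool" where
  "representation F n \<rho> \<longleftrightarrow> \<rho> \<in> hom F (units_of (ring_mat TYPE('k) n ()))"

definition irreducible_rep ::
    "('f, 'n) monoid_scheme \<Rightarrow> nat \<Rightarrow> ('f \<Rightarrow> 'k::field mat) \<Rightarrow> bool" where
  "irreducible_rep F n \<rho> \<longleftrightarrow>
     representation F n \<rho> \<and> n \<noteq> 0 \<and>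
     (\<forall>W. subspace class_ring W (module_vec TYPE('k) n) \<and>
          (\<forall>g\<in>carrier F. \<forall>w\<in>W. \<rho> g *\<^sub>v w \<in> W)
        \<longrightarrow> W = {0\<^sub>v n} \<or> W = carrier_vec n)"

text \<open>A representation stays irreducible over every extension field if and only if it does so over
  the algebraic closure; only the latter can be quantified over here, fields being types.\<close>

definition absolutely_irreducible_rep ::
    "('f, 'n) monoid_scheme \<Rightarrow> nat \<Rightarrow> ('f \<Rightarrow> 'k::field mat) \<Rightarrow> bool" where
  "absolutely_irreducible_rep F n \<rho> \<longleftrightarrow> irreducible_rep F n (\<lambda>g. map_mat to_ac (\<rho> g))"

definition splitting_field :: "'k::field itself \<Rightarrow> ('f, 'n) monoid_scheme \<Rightarrow> bool" where
  "splitting_field (_ :: 'k itself) F \<longleftrightarrow>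
     (\<forall>n (\<rho> :: 'f \<Rightarrow> 'k mat). irreducible_rep F n \<rho> \<longrightarrow> absolutely_irreducible_rep F n \<rho>)"

section \<open>Conjugation\<close>

definition conj_set :: "('g, 'm) monoid_scheme \<Rightarrow> 'g \<Rightarrow> 'g set \<Rightarrow> 'g set" where
  "conj_set S g U = (g <#\<^bsub>S\<^esub> U) #>\<^bsub>S\<^esub> (inv\<^bsub>S\<^esub> g)"

text \<open>The homomorphism \<open>\<^sup>g\<phi>\<close> for \<open>\<phi> \<in> U\<^sup>*\<close>.\<close>

definition conj_hom ::
    "('g, 'm) monoid_scheme \<Rightarrow> 'g \<Rightarrow> 'g set \<Rightarrow> ('g \<Rightarrow> 'a) \<Rightarrow> ('g \<Rightarrow> 'a)" where
  "conj_hom S g U \<phi> = (\<lambda>x\<in>conj_set S g U. \<phi> (inv\<^bsub>S\<^esub> g \<otimes>\<^bsub>S\<^esub> x \<otimes>\<^bsub>S\<^esub> g))"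

fun conj_pair ::
    "('g, 'm) monoid_scheme \<Rightarrow> 'g \<Rightarrow> 'g set \<times> ('g \<Rightarrow> 'a) \<Rightarrow> 'g set \<times> ('g \<Rightarrow> 'a)" where
  "conj_pair S g (U, \<phi>) = (conj_set S g U, conj_hom S g U \<phi>)"

definition pair_class ::
    "('g, 'm) monoid_scheme \<Rightarrow> 'g set \<times> ('g \<Rightarrow> 'a) \<Rightarrow> ('g set \<times> ('g \<Rightarrow> 'a)) set" where
  "pair_class S p = (\<lambda>g. conj_pair S g p) ` carrier S"

definition pair_classes ::
    "('a, 'n) monoid_scheme \<Rightarrow> ('g, 'm) monoid_scheme \<Rightarrow> ('g set \<times> ('g \<Rightarrow> 'a)) set set" where
  "pair_classes A S =
     {pair_class S (U, \<phi>) | U \<phi>. subgroup U S \<and> \<phi> \<in> carrier (hom_group A (S\<lparr>carrier := U\<rparr>))}"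

text \<open>The set \<open>\<X>(S)\<close>, and the action of \<open>S\<close> on it.\<close>

definition char_pairs ::
    "('a, 'n) monoid_scheme \<Rightarrow> ('g, 'm) monoid_scheme \<Rightarrow>
     ('g set \<times> (('g \<Rightarrow> 'a) \<Rightarrow> 'k::field)) set" where
  "char_pairs A S = {(H, \<Phi>). subgroup H S \<and> \<Phi> \<in> dual_chars A (S\<lparr>carrier := H\<rparr>)}"

fun conj_char_pair ::
    "('a, 'n) monoid_scheme \<Rightarrow> ('g, 'm) monoid_scheme \<Rightarrow> 'g \<Rightarrow>
     'g set \<times> (('g \<Rightarrow> 'a) \<Rightarrow> 'k::field) \<Rightarrow> 'g set \<times> (('g \<Rightarrow> 'a) \<Rightarrow> 'k)" where
  "conj_char_pair A S g (H, \<Phi>) =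
     (conj_set S g H,
      \<lambda>\<phi>\<in>carrier (hom_group A (S\<lparr>carrier := conj_set S g H\<rparr>)).
        \<Phi> (conj_hom S (inv\<^bsub>S\<^esub> g) (conj_set S g H) \<phi>))"

section \<open>The fibered Burnside algebra\<close>

text \<open>The \<open>\<bbbK>\<close>-vector space with basis \<open>X\<close> is the set of all \<open>x :: 'b \<Rightarrow>\<^sub>0 'k\<close> with
  \<open>Poly_Mapping.keys x \<subseteq> X\<close>; the basis element \<open>c\<close> is \<open>Poly_Mapping.single c 1\<close>. The
  multiplication that the theory of \<^typ>\<open>'b \<Rightarrow>\<^sub>0 'k\<close> provides is not used.\<close>

definition scale :: "'k::comm_ring_1 \<Rightarrow> ('b \<Rightarrow>\<^sub>0 'k) \<Rightarrow> ('b \<Rightarrow>\<^sub>0 'k)" where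
  "scale a x = Poly_Mapping.map ((*) a) x"

definition lin_ext ::
    "('b \<Rightarrow> ('c \<Rightarrow>\<^sub>0 'k)) \<Rightarrow> ('b \<Rightarrow>\<^sub>0 'k::comm_ring_1) \<Rightarrow> ('c \<Rightarrow>\<^sub>0 'k)" where
  "lin_ext f x = (\<Sum>c\<in>Poly_Mapping.keys x. scale (Poly_Mapping.lookup x c) (f c))"

definition fib_burnside ::
    "('a, 'n) monoid_scheme \<Rightarrow> ('g, 'm) monoid_scheme \<Rightarrow>
     (('g set \<times> ('g \<Rightarrow> 'a)) set \<Rightarrow>\<^sub>0 'k::field) set" where
  "fib_burnside A S = {x. Poly_Mapping.keys x \<subseteq> pair_classes A S}"

text \<open>The structure maps below are given on a class \<open>c = [U, \<phi>]\<^sub>S\<close> through an arbitrary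
  representative pair; sums over \<open>[H\<backslash>S/U]\<close> are sums over the double cosets, each
  with an arbitrary representative.\<close>

definition rep :: "'b set \<Rightarrow> 'b" where
  "rep c = (SOME p. p \<in> c)"

definition double_cosets :: "('g, 'm) monoid_scheme \<Rightarrow> 'g set \<Rightarrow> 'g set \<Rightarrow> 'g set set" where
  "double_cosets S H U = (\<lambda>g. (H #>\<^bsub>S\<^esub> g) <#>\<^bsub>S\<^esub> U) ` carrier S"

definition fib_mult_basis ::
    "('a, 'n) monoid_scheme \<Rightarrow> ('g, 'm) monoid_scheme \<Rightarrow>
     ('g set \<times> ('g \<Rightarrow> 'a)) set \<Rightarrow> ('g set \<times> ('g \<Rightarrow> 'a)) set \<Rightarrow>
     (('g set \<times> ('g \<Rightarrow> 'a)) set \<Rightarrow>\<^sub>0 'k::field)" where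
  "fib_mult_basis A S c d =
     (let (U, \<phi>) = rep c; (V, \<psi>) = rep d in
      \<Sum>D\<in>double_cosets S U V.
        let g = rep D; W = U \<inter> conj_set S g V in
        Poly_Mapping.single
          (pair_class S
            (W, restrict \<phi> W \<otimes>\<^bsub>hom_group A (S\<lparr>carrier := W\<rparr>)\<^esub> restrict (conj_hom S g V \<psi>) W)) 1)"

definition fib_mult ::
    "('a, 'n) monoid_scheme \<Rightarrow> ('g, 'm) monoid_scheme \<Rightarrow>
     (('g set \<times> ('g \<Rightarrow> 'a)) set \<Rightarrow>\<^sub>0 'k::field) \<Rightarrow>
     (('g set \<times> ('g \<Rightarrow> 'a)) set \<Rightarrow>\<^sub>0 'k) \<Rightarrow>
     (('g set \<times> ('g \<Rightarrow> 'a)) set \<Rightarrow>\<^sub>0 'k)" where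
  "fib_mult A S x y = lin_ext (\<lambda>c. lin_ext (\<lambda>d. fib_mult_basis A S c d) y) x"

definition fib_res ::
    "('g, 'm) monoid_scheme \<Rightarrow> 'g set \<Rightarrow>
     (('g set \<times> ('g \<Rightarrow> 'a)) set \<Rightarrow>\<^sub>0 'k::field) \<Rightarrow> (('g set \<times> ('g \<Rightarrow> 'a)) set \<Rightarrow>\<^sub>0 'k)" where
  "fib_res S H = lin_ext (\<lambda>c.
     let (U, \<phi>) = rep c in
     \<Sum>D\<in>double_cosets S H U.
       let g = rep D; W = H \<inter> conj_set S g U in
       Poly_Mapping.single (pair_class (S\<lparr>carrier := H\<rparr>) (W, restrict (conj_hom S g U \<phi>) W)) 1)"

text \<open>The projection \<open>\<pi>\<^sub>H\<close> onto the group algebra \<open>\<bbbK>H\<^sup>*\<close>.\<close>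

definition fib_proj ::
    "'g set \<Rightarrow> (('g set \<times> ('g \<Rightarrow> 'a)) set \<Rightarrow>\<^sub>0 'k::field) \<Rightarrow> (('g \<Rightarrow> 'a) \<Rightarrow>\<^sub>0 'k)" where
  "fib_proj H = lin_ext (\<lambda>c.
     let (U, \<phi>) = rep c in if U = H then Poly_Mapping.single \<phi> 1 else 0)"

definition char_ext :: "('b \<Rightarrow> 'k) \<Rightarrow> ('b \<Rightarrow>\<^sub>0 'k::field) \<Rightarrow> 'k" where
  "char_ext \<Phi> x = (\<Sum>\<phi>\<in>Poly_Mapping.keys x. Poly_Mapping.lookup x \<phi> * \<Phi> \<phi>)"

definition species ::
    "('g, 'm) monoid_scheme \<Rightarrow> 'g set \<times> (('g \<Rightarrow> 'a) \<Rightarrow> 'k::field) \<Rightarrow>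
     (('g set \<times> ('g \<Rightarrow> 'a)) set \<Rightarrow>\<^sub>0 'k) \<Rightarrow> 'k" where
  "species S = (\<lambda>(H, \<Phi>). char_ext \<Phi> \<circ> fib_proj H \<circ> fib_res S H)"

definition fib_idem ::
    "('a, 'n) monoid_scheme \<Rightarrow> ('g, 'm) monoid_scheme \<Rightarrow>
     'g set \<times> (('g \<Rightarrow> 'a) \<Rightarrow> 'k::field) \<Rightarrow> (('g set \<times> ('g \<Rightarrow> 'a)) set \<Rightarrow>\<^sub>0 'k)" where
  "fib_idem A S p =
     (THE e. e \<in> fib_burnside A S \<and> fib_mult A S e e = e \<and>
        (\<forall>q\<in>char_pairs A S.
           species S q e = (if \<exists>g\<in>carrier S. q = conj_char_pair A S g p then 1 else 0)))"

section \<open>Deflation\<close>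

text \<open>\<open>UN/N\<close> as a subgroup of \<^term>\<open>G Mod N\<close>.\<close>

definition quot_image :: "('g, 'm) monoid_scheme \<Rightarrow> 'g set \<Rightarrow> 'g set \<Rightarrow> 'g set set" where
  "quot_image G N U = rcosets\<^bsub>G\<lparr>carrier := U <#>\<^bsub>G\<^esub> N\<rparr>\<^esub> N"

definition fib_defl ::
    "('a, 'n) monoid_scheme \<Rightarrow> ('g, 'm) monoid_scheme \<Rightarrow> 'g set \<Rightarrow>
     (('g set \<times> ('g \<Rightarrow> 'a)) set \<Rightarrow>\<^sub>0 'k::field) \<Rightarrow>
     (('g set set \<times> ('g set \<Rightarrow> 'a)) set \<Rightarrow>\<^sub>0 'k)" where
  "fib_defl A G N = lin_ext (\<lambda>c.
     let (U, \<phi>) = rep c in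
     if U \<inter> N \<subseteq> kernel (G\<lparr>carrier := U\<rparr>) A \<phi>
     then Poly_Mapping.single
            (pair_class (G Mod N)
              (quot_image G N U,
               \<lambda>C\<in>quot_image G N U. THE a. \<exists>u\<in>U. C = N #>\<^bsub>G\<^esub> u \<and> a = \<phi> u)) 1
     else 0)"

text \<open>\<open>\<Phi>\<^sub>N = \<Phi> \<circ> \<nu>\<^sup>* \<circ> \<alpha>\<^sup>*\<close>, where \<open>\<nu> h = (H \<inter> N)h\<close> and \<open>\<alpha> C = NC\<close>.\<close>

definition char_quot ::
    "('a, 'n) monoid_scheme \<Rightarrow> ('g, 'm) monoid_scheme \<Rightarrow> 'g set \<Rightarrow> 'g set \<Rightarrow>
     (('g \<Rightarrow> 'a) \<Rightarrow> 'k::field) \<Rightarrow> (('g set \<Rightarrow> 'a) \<Rightarrow> 'k)" where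
  "char_quot A G N H \<Phi> =
     (let \<nu> = (\<lambda>h. (H \<inter> N) #>\<^bsub>G\<^esub> h); \<alpha> = (\<lambda>C. N <#>\<^bsub>G\<^esub> C) in
      (\<lambda>\<psi>\<in>carrier (hom_group A ((G Mod N)\<lparr>carrier := quot_image G N H\<rparr>)).
        \<Phi> (hom_pullback (G\<lparr>carrier := H\<rparr>) \<nu>
             (hom_pullback ((G\<lparr>carrier := H\<rparr>) Mod (H \<inter> N)) \<alpha> \<psi>))))"

section \<open>Annihilators and the Moebius function\<close>

definition annihilator ::
    "('a, 'n) monoid_scheme \<Rightarrow> ('g, 'm) monoid_scheme \<Rightarrow> 'g set \<Rightarrow> ('g \<Rightarrow> 'a) set" where
  "annihilator A G K = {\<phi> \<in> carrier (hom_group A G). \<forall>x\<in>K. \<phi> x = \<one>\<^bsub>A\<^esub>}"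

text \<open>The Moebius function of a family \<open>q\<close> of finite sets ordered by inclusion.\<close>

function moebius :: "'b set set \<Rightarrow> 'b set \<Rightarrow> 'b set \<Rightarrow> int" where
  "moebius q x y =
     (if x = y then 1
      else if x \<subset> y \<and> finite y then - (\<Sum>z\<in>{z \<in> q. x \<subseteq> z \<and> z \<subset> y}. moebius q x z)
      else 0)"
  by auto
termination
  by (relation "measure (\<lambda>(q, x, y). card y)") (auto intro: psubset_card_mono)

declare moebius.simps [simp del]

end

theory Submission
  imports Defs "HOL-Library.Function_Algebras" "Jordan_Normal_Form.Char_Poly"
begin

text \<open>The species of \<open>G/N\<close> separate the elements of its algebra (\<open>species_separate\<close>), so a deflated
idempotent is known once its species are. Two formulas make them computable. On a basis element, a
species is an average over conjugates: \<open>s\<^bsub>(H,\<Phi>)\<^esub>[U,\<phi>]\<close> is \<open>1/|U|\<close> times the sum, over all \<open>g\<close> in the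
group, of the values at \<open>(U,\<phi>)\<close> of the conjugates of \<open>(H,\<Phi>)\<close> by \<open>g\<close>, where the value of \<open>(H,\<Phi>)\<close> at \<open>(U,\<phi>)\<close>
is \<open>\<Phi>(\<phi>|\<^sub>H)\<close> if \<open>H \<subseteq> U\<close> and \<open>0\<close> otherwise (\<open>species_eq\<close>). And \<open>e\<^bsub>(H,\<Phi>)\<^esub>\<close> is the sum of the terms

  \<open>|L| \<mu>(L,H) \<Phi>(\<phi>)\<inverse> [L, \<phi>|\<^sub>L]\<close>  over all \<open>L \<subseteq> H\<close> and \<open>\<phi> \<in> H\<^sup>*\<close>,

divided by \<open>|H\<^sup>*|\<close> and by the order of the stabilizer of \<open>(H,\<Phi>)\<close>, because Moebius inversion on the
subgroups of \<open>H\<close> and orthogonality of the characters of \<open>H\<^sup>*\<close> give this element the right species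
(\<open>species_idem\<close>, \<open>fib_idem_eq\<close>).

Up to a constant, the species of \<open>G/N\<close> at \<open>q\<close> of the deflation of \<open>e\<^bsub>(H,\<Phi>)\<^esub>\<close> is therefore a sum over the
conjugates \<open>(E,\<Psi>)\<close> of \<open>q\<close>. The contribution of \<open>(E,\<Psi>)\<close> is the sum of the terms

  \<open>\<Phi>(\<phi>)\<inverse> |L \<inter> N| \<mu>(L,H) \<Psi>(\<phi>\<^sub>L|\<^sub>E)\<close>

over all \<open>\<phi> \<in> H\<^sup>*\<close> and all \<open>L \<subseteq> H\<close> such that \<open>\<phi>\<close> is trivial on \<open>L \<inter> N\<close> and \<open>E \<subseteq> LN/N\<close>; here \<open>\<phi>\<^sub>L\<close> is the
homomorphism on \<open>LN/N\<close> induced by \<open>\<phi>\<close>. Fix \<open>\<phi>\<close>, and let \<open>P\<close> be the preimage of \<open>E\<close> in \<open>G\<close>. The conditions on \<open>L\<close>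
and the term, apart from the Moebius factor, depend on \<open>L \<inter> P\<close> alone. By Weisner's theorem the sum over \<open>L\<close>
vanishes unless \<open>H \<subseteq> P\<close>, which leaves \<open>E = HN/N\<close> only (\<open>defl_inner_support\<close>). In that case, multiplying
\<open>\<phi>\<close> by the inflation of \<open>\<psi> \<in> (HN/N)\<^sup>*\<close> permutes the elements of \<open>H\<^sup>*\<close> and multiplies the corresponding
sums by \<open>\<Phi>\<^sub>N(\<psi>)\<inverse> \<Psi>(\<psi>)\<close>; so the whole vanishes unless \<open>\<Psi> = \<Phi>\<^sub>N\<close> (\<open>defl_inner_nonzero\<close>). Only the species at the
conjugates of \<open>(HN/N, \<Phi>\<^sub>N)\<close> survive, and this is part (a).

For part (b) the contribution is evaluated at \<open>H = G\<close>, \<open>E = G/N\<close>, \<open>\<Psi> = \<Phi>\<^sub>N\<close>. If \<open>LN = G\<close>, then the elements of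
\<open>G\<^sup>*\<close> that are trivial on \<open>L \<inter> N\<close> are, each in exactly one way, products of an element \<open>\<kappa>\<close> of the annihilator of \<open>L\<close>
and an inflation of an element of \<open>(G/N)\<^sup>*\<close> (\<open>triv_bij\<close>). The factors that involve \<open>\<Phi>\<close> and \<open>\<Psi>\<close> multiply to \<open>\<Phi>(\<kappa>)\<inverse>\<close>, and the
sum of \<open>\<Phi>(\<kappa>)\<inverse>\<close> over all \<open>\<kappa>\<close> is the order of the annihilator or zero (\<open>sum_annihilator\<close>).

The splitting hypothesis enters through one consequence: a nontrivial element of \<open>S\<^sup>*\<close> is not sent to
\<open>1\<close> by every homomorphism \<open>S\<^sup>* \<rightarrow> \<bbbK>\<^sup>\<times>\<close> (\<open>splitting_field_enough_chars\<close>). This makes the species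
separate elements.\<close>

section \<open>Characters over a splitting field\<close>

lemma module_vec_subspaceD:
  assumes "subspace class_ring W (module_vec TYPE('k::field) n)"
  shows "W \<subseteq> carrier_vec n" "0\<^sub>v n \<in> W" "\<And>v w. v \<in> W \<Longrightarrow> w \<in> W \<Longrightarrow> v + w \<in> W"
    "\<And>c v. v \<in> W \<Longrightarrow> c \<cdot>\<^sub>v v \<in> W"
  using assms unfolding subspace_def submodule_def by (auto simp: module_vec_simps)

lemma module_vec_subspaceI:
  assumes "W \<subseteq> carrier_vec n" "0\<^sub>v n \<in> W" "\<And>v w. v \<in> W \<Longrightarrow> w \<in> W \<Longrightarrow> v + w \<in> W"
    "\<And>c v. v \<in> W \<Longrightarrow> c \<cdot>\<^sub>v v \<in> W"
  shows "subspace class_ring W (module_vec TYPE('k::field) n)"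
  using assms vec_vs[where ?'a = 'k] vec_module[where ?'a = 'k]
  unfolding subspace_def submodule_def by (auto simp: module_vec_simps)

lemma mat_eq_if_mult_vec_eq:
  fixes Z Y :: "'k::comm_ring_1 mat"
  assumes "Z \<in> carrier_mat n n" "Y \<in> carrier_mat n n"
    and "\<And>v. v \<in> carrier_vec n \<Longrightarrow> Z *\<^sub>v v = Y *\<^sub>v v"
  shows "Z = Y"
proof (rule eq_matI)
  fix i j assume ij: "i < dim_row Y" "j < dim_col Y"
  then have "Z *\<^sub>v unit_vec n j = Y *\<^sub>v unit_vec n j" using assms by auto
  then have "(Z *\<^sub>v unit_vec n j) $ i = (Y *\<^sub>v unit_vec n j) $ i" by simp
  then show "Z $$ (i, j) = Y $$ (i, j)" using ij assms(1,2) by (auto simp: scalar_prod_right_unit)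
qed (use assms in auto)

text \<open>Over the algebraic closure every \<open>\<rho> g\<close> has an eigenvector; its eigenspace is invariant,
  since \<open>F\<close> is commutative, and so is everything.\<close>

lemma absolutely_irreducible_rep_scalar:
  fixes \<rho> :: "'f \<Rightarrow> 'k::field mat"
  assumes "comm_group F" and "absolutely_irreducible_rep F n \<rho>" and \<rho>: "representation F n \<rho>"
    and g: "g \<in> carrier F"
  shows "\<exists>c. \<rho> g = c \<cdot>\<^sub>m 1\<^sub>m n"
proof -
  interpret F: comm_group F by fact
  define \<sigma> where "\<sigma> = (\<lambda>g. map_mat to_ac (\<rho> g))"
  have irr: "irreducible_rep F n \<sigma>"
    using assms(2) by (simp add: absolutely_irreducible_rep_def \<sigma>_def)
  then have n: "n \<noteq> 0" and rep: "representation F n \<sigma>" by (auto simp: irreducible_rep_def)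
  have car: "\<sigma> h \<in> carrier_mat n n" if "h \<in> carrier F" for h
    using rep that by (auto simp: representation_def hom_def units_of_def Units_def ring_mat_simps)
  have comm: "\<sigma> h * \<sigma> g = \<sigma> g * \<sigma> h" if "h \<in> carrier F" for h
    using rep that g F.m_comm[of g h]
    by (auto simp: representation_def hom_def units_of_def ring_mat_simps) (metis)
  have "degree (char_poly (\<sigma> g)) > 0" using degree_monic_char_poly[OF car[OF g]] n by simp
  then obtain c where "poly (char_poly (\<sigma> g)) c = 0" using alg_closed_imp_poly_has_root by blast
  then have "eigenvalue (\<sigma> g) c" using eigenvalue_root_char_poly[OF car[OF g]] by simp
  then obtain v where v: "v \<in> carrier_vec n" "v \<noteq> 0\<^sub>v n" "\<sigma> g *\<^sub>v v = c \<cdot>\<^sub>v v"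
    using car[OF g] by (auto simp: eigenvalue_def eigenvector_def)
  define W where "W = {w \<in> carrier_vec n. \<sigma> g *\<^sub>v w = c \<cdot>\<^sub>v w}"
  have "subspace class_ring W (module_vec TYPE('k alg_closure) n)"
    by (rule module_vec_subspaceI)
       (use car[OF g] in \<open>auto simp: W_def mult_add_distrib_mat_vec smult_add_distrib_vec
          mult_mat_vec smult_smult_assoc mult.commute\<close>)
  moreover have "\<forall>h\<in>carrier F. \<forall>w\<in>W. \<sigma> h *\<^sub>v w \<in> W"
  proof (intro ballI)
    fix h w assume h: "h \<in> carrier F" and w: "w \<in> W"
    then have wc: "w \<in> carrier_vec n" by (simp add: W_def)
    have "\<sigma> g *\<^sub>v (\<sigma> h *\<^sub>v w) = \<sigma> h *\<^sub>v (\<sigma> g *\<^sub>v w)"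
      using assoc_mult_mat_vec[OF car[OF g] car[OF h] wc] assoc_mult_mat_vec[OF car[OF h] car[OF g] wc]
        comm[OF h] by simp
    then show "\<sigma> h *\<^sub>v w \<in> W" using w wc car[OF h] by (auto simp: W_def mult_mat_vec)
  qed
  ultimately have "W = {0\<^sub>v n} \<or> W = carrier_vec n" using irr by (auto simp: irreducible_rep_def)
  then have "W = carrier_vec n" using v by (auto simp: W_def)
  then have W: "\<sigma> g *\<^sub>v w = c \<cdot>\<^sub>v w" if "w \<in> carrier_vec n" for w
    using that by (auto simp: W_def)
  have "(c \<cdot>\<^sub>m 1\<^sub>m n) *\<^sub>v w = c \<cdot>\<^sub>v w" if "w \<in> carrier_vec n" for w
    using that by (intro eq_vecI) auto
  then have "\<sigma> g *\<^sub>v w = (c \<cdot>\<^sub>m 1\<^sub>m n) *\<^sub>v w" if "w \<in> carrier_vec n" for w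
    using that W by simp
  then have sg: "\<sigma> g = c \<cdot>\<^sub>m 1\<^sub>m n" by (intro mat_eq_if_mult_vec_eq[OF car[OF g]]) auto
  have rg: "\<rho> g \<in> carrier_mat n n"
    using \<rho> g by (auto simp: representation_def hom_def units_of_def Units_def ring_mat_simps)
  have entry: "to_ac (\<rho> g $$ (i, j)) = (if i = j then c else 0)" if "i < n" "j < n" for i j
    using arg_cong[OF sg, of "\<lambda>Z. Z $$ (i, j)"] that rg by (auto simp: \<sigma>_def)
  have "\<rho> g = (\<rho> g $$ (0, 0)) \<cdot>\<^sub>m 1\<^sub>m n"
  proof (rule eq_matI)
    fix i j assume "i < dim_row (\<rho> g $$ (0, 0) \<cdot>\<^sub>m 1\<^sub>m n)" "j < dim_col (\<rho> g $$ (0, 0) \<cdot>\<^sub>m 1\<^sub>m n)"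
    then have ij: "i < n" "j < n" by auto
    have "to_ac (\<rho> g $$ (i, j)) = to_ac ((\<rho> g $$ (0, 0) \<cdot>\<^sub>m 1\<^sub>m n) $$ (i, j))"
      using entry[OF ij] entry[of 0 0] n ij by auto
    then show "\<rho> g $$ (i, j) = (\<rho> g $$ (0, 0) \<cdot>\<^sub>m 1\<^sub>m n) $$ (i, j)" by simp
  qed (use rg in auto)
  then show ?thesis by blast
qed

text \<open>A basis of an invariant subspace of least positive dimension turns the action into matrices,
  \<open>T\<close> being the passage from coordinates to vectors. An invariant set of coordinate vectors corresponds to an
  invariant subspace of \<open>W0\<close>; if it is nonzero, then it has full dimension by minimality.\<close>

lemma exists_irreducible_subrep:
  fixes s :: "'k::field \<Rightarrow> 'v::ab_group_add \<Rightarrow> 'v" and act :: "'f \<Rightarrow> 'v \<Rightarrow> 'v"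
  assumes "group F" and vs: "vector_space s"
    and lin: "\<And>g. g \<in> carrier F \<Longrightarrow> Vector_Spaces.linear s s (act g)"
    and act_mult: "\<And>g h v. g \<in> carrier F \<Longrightarrow> h \<in> carrier F \<Longrightarrow> v \<in> W0 \<Longrightarrow>
          act (g \<otimes>\<^bsub>F\<^esub> h) v = act g (act h v)"
    and act_one: "\<And>v. v \<in> W0 \<Longrightarrow> act \<one>\<^bsub>F\<^esub> v = v"
    and fin: "finite D" and W0: "W0 \<subseteq> Modules.module.span s D" and sub: "Modules.module.subspace s W0"
    and inv: "\<And>g v. g \<in> carrier F \<Longrightarrow> v \<in> W0 \<Longrightarrow> act g v \<in> W0"
    and nz: "\<exists>v\<in>W0. v \<noteq> 0"
  shows "\<exists>n \<rho> (T :: 'k vec \<Rightarrow> 'v). irreducible_rep F n \<rho> \<and>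
           (\<forall>v\<in>carrier_vec n. T v \<in> W0 \<and> (T v = 0 \<longrightarrow> v = 0\<^sub>v n)) \<and>
           (\<forall>g\<in>carrier F. \<forall>v\<in>carrier_vec n. act g (T v) = T (\<rho> g *\<^sub>v v))"
proof -
  interpret F: group F by fact
  interpret V: vector_space s by fact
  define P where "P B \<longleftrightarrow> finite B \<and> \<not> V.dependent B \<and> V.span B \<subseteq> W0 \<and> (\<exists>v\<in>V.span B. v \<noteq> 0) \<and>
      (\<forall>g\<in>carrier F. \<forall>v\<in>V.span B. act g v \<in> V.span B)" for B
  obtain B0 where B0: "B0 \<subseteq> W0" "\<not> V.dependent B0" "W0 \<subseteq> V.span B0"
    using V.maximal_independent_subset by blast
  then have sp: "V.span B0 = W0" using sub V.span_minimal by blast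
  have "P B0" using B0 sp V.independent_span_bound[OF fin B0(2)] W0 inv nz by (auto simp: P_def)
  then obtain B where PB: "P B" and min: "\<And>C. P C \<Longrightarrow> card B \<le> card C"
    using ex_has_least_nat[of P B0 card] by blast
  from PB have fB: "finite B" and iB: "\<not> V.dependent B" and BW: "V.span B \<subseteq> W0"
    and invB: "\<And>g v. g \<in> carrier F \<Longrightarrow> v \<in> V.span B \<Longrightarrow> act g v \<in> V.span B"
    by (auto simp: P_def)
  define k where "k = card B"
  obtain b where b: "bij_betw b {..<k} B" using ex_bij_betw_nat_finite[OF fB] by (auto simp: k_def atLeast0LessThan)
  have bB: "b i \<in> B" if "i < k" for i using b that by (auto simp: bij_betw_def)
  have k0: "k \<noteq> 0"
  proof
    assume "k = 0" then have "B = {}" using fB by (simp add: k_def)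
    then show False using PB by (auto simp: P_def)
  qed
  define T where "T v = (\<Sum>i<k. s (v $ i) (b i))" for v :: "'k vec"
  have T_span: "T v \<in> V.span B" for v
    unfolding T_def by (intro V.span_sum V.span_scale V.span_base) (use bB in auto)
  then have T_W0: "T v \<in> W0" for v using BW by blast
  have T_add: "T (v + w) = T v + T w" if "v \<in> carrier_vec k" "w \<in> carrier_vec k" for v w
    using that by (simp add: T_def V.scale_left_distrib sum.distrib)
  have T_smult: "T (c \<cdot>\<^sub>v v) = s c (T v)" if "v \<in> carrier_vec k" for c v
    using that by (simp add: T_def V.scale_sum_right)
  have T0: "T (0\<^sub>v k) = 0" by (simp add: T_def)
  have T_inj0: "v = 0\<^sub>v k" if v: "v \<in> carrier_vec k" and Tv: "T v = 0" for v
  proof (rule eq_vecI)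
    fix i assume "i < dim_vec (0\<^sub>v k)"
    then have i: "i < k" by simp
    define u where "u x = v $ (the_inv_into {..<k} b x)" for x
    have ub: "u (b j) = v $ j" if "j < k" for j
      using that b by (simp add: u_def the_inv_into_f_f bij_betw_def)
    have "(\<Sum>x\<in>B. s (u x) x) = (\<Sum>j<k. s (u (b j)) (b j))"
      using sum.reindex_bij_betw[OF b, of "\<lambda>x. s (u x) x"] by simp
    also have "\<dots> = 0" using Tv ub by (simp add: T_def)
    finally have "u (b i) = 0" using V.independentD[OF iB fB order_refl] bB[OF i] by blast
    then show "v $ i = 0\<^sub>v k $ i" using ub i by simp
  qed (use v in auto)
  have T_inj: "v = w" if "v \<in> carrier_vec k" "w \<in> carrier_vec k" "T v = T w" for v w
  proof -
    have "T (v + (- 1) \<cdot>\<^sub>v w) = 0" using that by (simp add: T_add T_smult V.scale_minus_left)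
    then have *: "v + (- 1) \<cdot>\<^sub>v w = 0\<^sub>v k" using T_inj0 that by simp
    show "v = w"
    proof (rule eq_vecI)
      fix i assume "i < dim_vec w"
      then show "v $ i = w $ i" using arg_cong[OF *, of "\<lambda>z. vec_index z i"] that by simp
    qed (use that in auto)
  qed
  define co where "co w = vec k (\<lambda>i. V.representation B w (b i))" for w
  have T_co: "T (co w) = w" if "w \<in> V.span B" for w
  proof -
    have "T (co w) = (\<Sum>x\<in>B. s (V.representation B w x) x)"
      using sum.reindex_bij_betw[OF b, of "\<lambda>x. s (V.representation B w x) x"] by (simp add: T_def co_def)
    then show ?thesis using V.sum_representation_eq[OF iB that fB order_refl] by simp
  qed
  have co_car: "co w \<in> carrier_vec k" for w by (simp add: co_def)
  define \<rho> where "\<rho> g = mat k k (\<lambda>(i, j). co (act g (b j)) $ i)" for g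
  have \<rho>_car: "\<rho> g \<in> carrier_mat k k" for g by (simp add: \<rho>_def)
  have T_equiv: "act g (T v) = T (\<rho> g *\<^sub>v v)" if g: "g \<in> carrier F" and v: "v \<in> carrier_vec k" for g v
  proof -
    interpret L: Vector_Spaces.linear s s "act g" by (rule lin[OF g])
    have "T (\<rho> g *\<^sub>v v) = (\<Sum>i<k. s (\<Sum>j<k. co (act g (b j)) $ i * v $ j) (b i))"
      using v by (simp add: T_def \<rho>_def scalar_prod_def atLeast0LessThan)
    also have "\<dots> = (\<Sum>i<k. \<Sum>j<k. s (v $ j) (s (co (act g (b j)) $ i) (b i)))"
      by (simp add: V.scale_sum_left mult.commute)
    also have "\<dots> = (\<Sum>j<k. s (v $ j) (T (co (act g (b j)))))"
      by (subst sum.swap) (simp add: T_def V.scale_sum_right)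
    also have "\<dots> = (\<Sum>j<k. s (v $ j) (act g (b j)))"
      by (intro sum.cong refl) (simp add: T_co invB[OF g] V.span_base bB)
    also have "\<dots> = act g (T v)" by (simp add: T_def L.sum L.scale)
    finally show ?thesis by simp
  qed
  have \<rho>_mult: "\<rho> (g \<otimes>\<^bsub>F\<^esub> h) = \<rho> g * \<rho> h" if g: "g \<in> carrier F" and h: "h \<in> carrier F" for g h
  proof (rule mat_eq_if_mult_vec_eq[OF \<rho>_car])
    fix v :: "'k vec" assume v: "v \<in> carrier_vec k"
    have hv: "\<rho> h *\<^sub>v v \<in> carrier_vec k" using \<rho>_car[of h] v by simp
    have "T (\<rho> (g \<otimes>\<^bsub>F\<^esub> h) *\<^sub>v v) = T (\<rho> g *\<^sub>v (\<rho> h *\<^sub>v v))"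
      using T_equiv[OF F.m_closed[OF g h] v] T_equiv[OF g hv] T_equiv[OF h v]
        act_mult[OF g h T_W0] by simp
    then have "\<rho> (g \<otimes>\<^bsub>F\<^esub> h) *\<^sub>v v = \<rho> g *\<^sub>v (\<rho> h *\<^sub>v v)"
      using T_inj[of "\<rho> (g \<otimes>\<^bsub>F\<^esub> h) *\<^sub>v v" "\<rho> g *\<^sub>v (\<rho> h *\<^sub>v v)"] \<rho>_car[of g] \<rho>_car[of "g \<otimes>\<^bsub>F\<^esub> h"]
        hv v by (metis mult_mat_vec_carrier)
    then show "\<rho> (g \<otimes>\<^bsub>F\<^esub> h) *\<^sub>v v = \<rho> g * \<rho> h *\<^sub>v v"
      using assoc_mult_mat_vec[OF \<rho>_car \<rho>_car v] by simp
  qed (use \<rho>_car in \<open>auto intro: mult_carrier_mat\<close>)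
  have \<rho>_one: "\<rho> \<one>\<^bsub>F\<^esub> = 1\<^sub>m k"
  proof (rule mat_eq_if_mult_vec_eq[OF \<rho>_car])
    fix v :: "'k vec" assume v: "v \<in> carrier_vec k"
    have "T (\<rho> \<one>\<^bsub>F\<^esub> *\<^sub>v v) = T v" using T_equiv[OF F.one_closed v] act_one[OF T_W0] by simp
    then show "\<rho> \<one>\<^bsub>F\<^esub> *\<^sub>v v = 1\<^sub>m k *\<^sub>v v"
      using T_inj v \<rho>_car by (metis mult_mat_vec_carrier one_mult_mat_vec)
  qed simp
  have rep: "representation F k \<rho>"
    unfolding representation_def hom_def units_of_def Units_def
  proof (auto simp: ring_mat_simps \<rho>_mult \<rho>_car)
    fix g assume g: "g \<in> carrier F"
    then have "\<rho> (inv\<^bsub>F\<^esub> g) * \<rho> g = 1\<^sub>m k" "\<rho> g * \<rho> (inv\<^bsub>F\<^esub> g) = 1\<^sub>m k"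
      using \<rho>_mult[of "inv\<^bsub>F\<^esub> g" g] \<rho>_mult[of g "inv\<^bsub>F\<^esub> g"] \<rho>_one by auto
    then show "\<exists>Z\<in>carrier_mat k k. Z * \<rho> g = 1\<^sub>m k \<and> \<rho> g * Z = 1\<^sub>m k" using \<rho>_car by blast
  qed
  have "U = {0\<^sub>v k} \<or> U = carrier_vec k"
    if U: "subspace class_ring U (module_vec TYPE('k) k)"
      and Uinv: "\<forall>g\<in>carrier F. \<forall>w\<in>U. \<rho> g *\<^sub>v w \<in> U" for U
  proof (cases "U = {0\<^sub>v k}")
    case False
    note UD = module_vec_subspaceD[OF U]
    obtain u where u: "u \<in> U" "u \<noteq> 0\<^sub>v k" using False UD(2) by blast
    have TU: "V.subspace (T ` U)"
    proof (rule V.subspaceI)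
      show "0 \<in> T ` U" using T0 UD(2) by (metis imageI)
      show "x + y \<in> T ` U" if "x \<in> T ` U" "y \<in> T ` U" for x y
        using that UD by (auto simp: image_iff) (metis T_add subsetD)
      show "s c x \<in> T ` U" if "x \<in> T ` U" for c x
        using that UD by (auto simp: image_iff) (metis T_smult subsetD)
    qed
    obtain C where C: "C \<subseteq> T ` U" "\<not> V.dependent C" "T ` U \<subseteq> V.span C"
      using V.maximal_independent_subset by blast
    then have spC: "V.span C = T ` U" using TU V.span_minimal by blast
    have CB: "C \<subseteq> V.span B" using C(1) T_span by blast
    have TUB: "T ` U \<subseteq> V.span B" using T_span by blast
    have "P C" unfolding P_def spC
    proof (intro conjI)
      show "finite C" using V.independent_span_bound[OF fB C(2) CB] by simp
      show "\<exists>v\<in>T ` U. v \<noteq> 0" using u T_inj0 UD(1) by blast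
      show "\<forall>g\<in>carrier F. \<forall>v\<in>T ` U. act g v \<in> T ` U"
        using Uinv T_equiv UD(1) by (auto simp: image_iff) (metis subsetD)
    qed (use C TUB BW in auto)
    then have Ck: "k \<le> card C" and fC: "finite C" using min by (auto simp: k_def P_def)
    (* A basis vector outside the span of C would extend C to an independent set of more than k vectors. *)
  have "B \<subseteq> V.span C"
    proof
      fix x assume x: "x \<in> B"
      show "x \<in> V.span C"
      proof (rule ccontr)
        assume nx: "x \<notin> V.span C"
        then have "\<not> V.dependent (insert x C)" using C(2) V.independent_insertI by blast
        then have "card (insert x C) \<le> card B"
          using V.independent_span_bound[OF fB, of "insert x C"] CB x V.span_base by blast
        moreover have "x \<notin> C" using nx V.span_base by blast
        ultimately show False using Ck fC by (simp add: k_def)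
      qed
    qed
    then have "V.span B \<subseteq> T ` U" using TU spC V.span_minimal by metis
    then have "v \<in> U" if "v \<in> carrier_vec k" for v
      using T_span[of v] that UD(1) T_inj by (metis (no_types, lifting) imageE subsetD)
    then show ?thesis using UD(1) by blast
  qed simp
  then have "irreducible_rep F k \<rho>" using rep k0 by (auto simp: irreducible_rep_def)
  then show ?thesis using T_inj0 T_span BW T_equiv by (intro exI[of _ k] exI[of _ \<rho>] exI[of _ T]) blast
qed

lemma ring_of_type_algebra_simps [simp]:
  "carrier (ring_of_type_algebra :: 'k::field ring) = UNIV"
  "x \<otimes>\<^bsub>ring_of_type_algebra\<^esub> y = x * (y :: 'k)"
  "\<one>\<^bsub>ring_of_type_algebra\<^esub> = (1 :: 'k)"
  "\<zero>\<^bsub>ring_of_type_algebra\<^esub> = (0 :: 'k)"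
  by (simp_all add: ring_of_type_algebra_def)

lemma comm_group_mult_group: "comm_group (mult_group :: 'k::field monoid)"
proof (rule comm_groupI)
  fix x :: 'k assume "x \<in> carrier mult_group"
  then show "\<exists>y\<in>carrier mult_group. y \<otimes>\<^bsub>mult_group\<^esub> x = \<one>\<^bsub>mult_group\<^esub>"
    by (intro bexI[of _ "inverse x"]) auto
qed (auto simp: mult.assoc mult.commute)

definition enough_chars :: "'k::field itself \<Rightarrow> ('f, 'n) monoid_scheme \<Rightarrow> bool" where
  "enough_chars (_ :: 'k itself) F \<longleftrightarrow>
     (\<forall>x\<in>carrier F. x \<noteq> \<one>\<^bsub>F\<^esub> \<longrightarrow> (\<exists>\<Phi>\<in>carrier (hom_group (mult_group :: 'k monoid) F). \<Phi> x \<noteq> 1))"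

text \<open>Characters are pulled back along \<open>f\<close>, so an injective \<open>f\<close> transfers the property. It is used to
  pass from \<open>(H/1)\<^sup>*\<close>, which the hypotheses speak of, to \<open>H\<^sup>*\<close>.\<close>

lemma enough_chars_inj:
  assumes "enough_chars TYPE('k::field) F" and f: "f \<in> hom E F" "inj_on f (carrier E)"
    and "group E" "group F"
  shows "enough_chars TYPE('k) E"
  unfolding enough_chars_def
proof (intro ballI impI)
  fix x assume x: "x \<in> carrier E" "x \<noteq> \<one>\<^bsub>E\<^esub>"
  interpret E: group E by fact
  interpret F: group F by fact
  have fc: "f y \<in> carrier F" if "y \<in> carrier E" for y using f that by (auto simp: hom_def)
  have "f \<one>\<^bsub>E\<^esub> = \<one>\<^bsub>F\<^esub>" using hom_one[OF f(1)] assms by blast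
  then have "f x \<noteq> \<one>\<^bsub>F\<^esub>" using f(2) x by (metis E.one_closed inj_onD)
  then obtain \<Phi> where \<Phi>: "\<Phi> \<in> carrier (hom_group (mult_group :: 'k monoid) F)" "\<Phi> (f x) \<noteq> 1"
    using assms(1) fc[OF x(1)] unfolding enough_chars_def by blast
  then show "\<exists>\<Phi>\<in>carrier (hom_group (mult_group :: 'k monoid) E). \<Phi> x \<noteq> 1"
    using f fc x by (intro bexI[of _ "restrict (\<Phi> \<circ> f) (carrier E)"]) (auto simp: hom_group_def hom_def)
qed

text \<open>The vectors \<open>x v - v\<close> of the regular representation form an invariant subspace on which \<open>x\<close>
  fixes no nonzero vector, as \<open>x\<close> has finite order and the characteristic is zero. An irreducible
  subrepresentation of it is scalar, hence given by a character, and this is nontrivial at \<open>x\<close>.\<close>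

theorem splitting_field_enough_chars:
  fixes F :: "('f, 'n) monoid_scheme"
  assumes "comm_group F" and fin: "finite (carrier F)"
    and split: "splitting_field TYPE('k::field_char_0) F"
  shows "enough_chars TYPE('k) F"
  unfolding enough_chars_def
proof (intro ballI impI)
  fix x assume x: "x \<in> carrier F" "x \<noteq> \<one>\<^bsub>F\<^esub>"
  interpret F: comm_group F by fact
  define s :: "'k \<Rightarrow> ('f \<Rightarrow> 'k) \<Rightarrow> 'f \<Rightarrow> 'k" where "s a v = (\<lambda>y. a * v y)" for a v
  interpret V: vector_space s
    by unfold_locales (auto simp: s_def algebra_simps fun_eq_iff)
  define act :: "'f \<Rightarrow> ('f \<Rightarrow> 'k) \<Rightarrow> 'f \<Rightarrow> 'k"
    where "act g v = (\<lambda>y. if y \<in> carrier F then v (y \<otimes>\<^bsub>F\<^esub> g) else 0)" for g v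
  define V0 :: "('f \<Rightarrow> 'k) set" where "V0 = {v. \<forall>y. y \<notin> carrier F \<longrightarrow> v y = 0}"
  define W0 where "W0 = (\<lambda>v. act x v - v) ` V0"
  define D :: "('f \<Rightarrow> 'k) set" where "D = (\<lambda>a y. if y = a then 1 else 0) ` carrier F"
  have V0_sub: "V.subspace V0" by (rule V.subspaceI) (auto simp: V0_def s_def)
  have act_lin: "Vector_Spaces.linear s s (act g)" for g
    by (unfold_locales) (auto simp: act_def s_def fun_eq_iff)
  have act_mult: "act (g \<otimes>\<^bsub>F\<^esub> h) v = act g (act h v)" if "g \<in> carrier F" "h \<in> carrier F" for g h v
    using that by (auto simp: act_def fun_eq_iff F.m_assoc)
  have act_one: "act \<one>\<^bsub>F\<^esub> v = v" if "v \<in> V0" for v using that by (auto simp: act_def fun_eq_iff V0_def)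
  have act_diff: "act g (v - w) = act g v - act g w" for g v w by (auto simp: act_def)
  have actV: "act g v \<in> V0" for g v by (auto simp: V0_def act_def)
  have WV: "W0 \<subseteq> V0"
  proof -
    have "act x v - v \<in> V0" if "v \<in> V0" for v using V0_sub actV that V.subspace_diff by blast
    then show ?thesis by (auto simp: W0_def)
  qed
  have W0_sub: "V.subspace W0"
  proof (rule V.subspaceI)
    show "0 \<in> W0" unfolding W0_def
      by (rule image_eqI[of _ _ 0]) (auto simp: act_def V0_def fun_eq_iff)
    show "v + w \<in> W0" if vw: "v \<in> W0" "w \<in> W0" for v w
    proof -
      obtain v' w' where *: "v = act x v' - v'" "w = act x w' - w'" "v' \<in> V0" "w' \<in> V0"
        using vw by (auto simp: W0_def)
      then show ?thesis unfolding W0_def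
        by (intro image_eqI[of _ _ "v' + w'"]) (auto simp: act_def V0_def fun_eq_iff)
    qed
    show "s c v \<in> W0" if v: "v \<in> W0" for c v
    proof -
      obtain v' where *: "v = act x v' - v'" "v' \<in> V0" using v by (auto simp: W0_def)
      then show ?thesis unfolding W0_def *(1)
        by (intro image_eqI[of _ _ "s c v'"]) (auto simp: act_def V0_def s_def fun_eq_iff right_diff_distrib)
    qed
  qed
  have W0_inv: "act g w \<in> W0" if g: "g \<in> carrier F" and w: "w \<in> W0" for g w
  proof -
    obtain v where v: "w = act x v - v" "v \<in> V0" using w by (auto simp: W0_def)
    have "act g w = act x (act g v) - act g v"
      using act_mult[OF g x(1), of v] act_mult[OF x(1) g, of v] F.m_comm[OF g x(1)] v
      by (simp add: act_diff)
    then show ?thesis using actV by (auto simp: W0_def)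
  qed
  have V0_span: "v \<in> V.span D" if "v \<in> V0" for v
  proof -
    have "v = (\<Sum>a\<in>carrier F. s (v a) (\<lambda>y. if y = a then 1 else 0))"
    proof (rule ext)
      fix y
      have "(\<Sum>a\<in>carrier F. s (v a) (\<lambda>y. if y = a then 1 else 0)) y
          = (\<Sum>a\<in>carrier F. s (v a) (\<lambda>y. if y = a then 1 else 0) y)"
        using sum_comp_morphism[of "\<lambda>w. w y" "\<lambda>a. s (v a) (\<lambda>y. if y = a then 1 else 0)" "carrier F"]
        by (simp add: o_def)
      also have "\<dots> = (\<Sum>a\<in>carrier F. if a = y then v a else 0)"
        by (intro sum.cong) (auto simp: s_def)
      also have "\<dots> = v y" using that fin by (auto simp: V0_def)
      finally show "v y = (\<Sum>a\<in>carrier F. s (v a) (\<lambda>y. if y = a then 1 else 0)) y" by simp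
    qed
    also have "\<dots> \<in> V.span D"
      by (intro V.span_sum V.span_scale V.span_base) (auto simp: D_def)
    finally show ?thesis .
  qed
  have nz: "\<exists>w\<in>W0. w \<noteq> 0"
  proof -
    define v :: "'f \<Rightarrow> 'k" where "v = (\<lambda>y. if y = \<one>\<^bsub>F\<^esub> then 1 else 0)"
    have "v \<in> V0" by (auto simp: v_def V0_def)
    moreover have "(act x v - v) \<one>\<^bsub>F\<^esub> \<noteq> 0" using x by (simp add: act_def v_def)
    then have "act x v - v \<noteq> 0" by auto
    ultimately show ?thesis by (auto simp: W0_def)
  qed
  have nofix: "w = 0" if w: "w \<in> W0" and fx: "act x w = w" for w
  proof -
    obtain v where v: "w = act x v - v" "v \<in> V0" using w by (auto simp: W0_def)
    interpret L: Vector_Spaces.linear s s "act x" by (rule act_lin)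
    (* With w fixed by x, iterating x v = v + w gives x^i v = v + i w; at the order of F this forces
       w = 0 in characteristic zero. *)
    have pow: "act (x [^]\<^bsub>F\<^esub> (i::nat)) v = v + s (of_nat i) w" for i
    proof (induction i)
      case 0 show ?case using act_one[OF v(2)] by (simp add: s_def fun_eq_iff)
    next
      case (Suc i)
      have "act (x [^]\<^bsub>F\<^esub> Suc i) v = act x (act (x [^]\<^bsub>F\<^esub> i) v)"
        using x act_mult[of x "x [^]\<^bsub>F\<^esub> i" v] by (simp add: F.m_comm)
      also have "\<dots> = act x v + s (of_nat i) (act x w)"
        unfolding Suc by (simp add: L.add L.scale)
      also have "\<dots> = v + s (of_nat (Suc i)) w"
        unfolding fx using v(1) by (simp add: s_def fun_eq_iff algebra_simps)
      finally show ?case .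
    qed
    have "x [^]\<^bsub>F\<^esub> Coset.order F = \<one>\<^bsub>F\<^esub>" using x F.pow_order_eq_1 by blast
    then have "s (of_nat (Coset.order F)) w = 0" using pow[of "Coset.order F"] act_one[OF v(2)] by simp
    moreover have "Coset.order F \<noteq> 0" using fin by (auto simp: Coset.order_def)
    ultimately show "w = 0" by (auto simp: s_def fun_eq_iff)
  qed
  have "\<exists>n \<rho> (T :: 'k vec \<Rightarrow> _). irreducible_rep F n \<rho> \<and>
           (\<forall>v\<in>carrier_vec n. T v \<in> W0 \<and> (T v = 0 \<longrightarrow> v = 0\<^sub>v n)) \<and>
           (\<forall>g\<in>carrier F. \<forall>v\<in>carrier_vec n. act g (T v) = T (\<rho> g *\<^sub>v v))"
  proof (rule exists_irreducible_subrep[OF F.is_group V.vector_space_axioms act_lin])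
    show "finite D" using fin by (simp add: D_def)
    show "W0 \<subseteq> V.span D" using V0_span WV by blast
    show "act \<one>\<^bsub>F\<^esub> v = v" if "v \<in> W0" for v using act_one WV that by blast
  qed (use act_mult W0_sub W0_inv nz in auto)
  then obtain n \<rho> T where irr: "irreducible_rep F n (\<rho> :: 'f \<Rightarrow> 'k mat)"
    and T: "\<And>v. v \<in> carrier_vec n \<Longrightarrow> T v \<in> W0 \<and> (T v = 0 \<longrightarrow> v = 0\<^sub>v n)"
    and eqv: "\<And>g v. g \<in> carrier F \<Longrightarrow> v \<in> carrier_vec n \<Longrightarrow> act g (T v) = T (\<rho> g *\<^sub>v v)"
    by blast
  have n: "n \<noteq> 0" and rep: "representation F n \<rho>" using irr by (auto simp: irreducible_rep_def)
  have "\<exists>c. \<rho> g = c \<cdot>\<^sub>m 1\<^sub>m n" if "g \<in> carrier F" for g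
    using absolutely_irreducible_rep_scalar[OF F.comm_group_axioms _ rep that] split irr
    by (auto simp: splitting_field_def)
  then obtain \<chi> where \<chi>: "\<And>g. g \<in> carrier F \<Longrightarrow> \<rho> g = \<chi> g \<cdot>\<^sub>m 1\<^sub>m n" by metis
  have \<chi>_eq: "\<chi> g = \<rho> g $$ (0, 0)" if "g \<in> carrier F" for g using \<chi>[OF that] n by simp
  have mult: "\<chi> (g \<otimes>\<^bsub>F\<^esub> h) = \<chi> g * \<chi> h" if g: "g \<in> carrier F" and h: "h \<in> carrier F" for g h
  proof -
    have "\<rho> (g \<otimes>\<^bsub>F\<^esub> h) = \<rho> g * \<rho> h"
      using rep g h by (auto simp: representation_def hom_def units_of_def ring_mat_simps)
    also have "\<dots> = (\<chi> g * \<chi> h) \<cdot>\<^sub>m 1\<^sub>m n"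
      unfolding \<chi>[OF g] \<chi>[OF h] by (intro eq_matI) auto
    finally show ?thesis using n \<chi>_eq[of "g \<otimes>\<^bsub>F\<^esub> h"] g h by simp
  qed
  have "\<rho> \<one>\<^bsub>F\<^esub> \<noteq> 0\<^sub>m n n"
  proof -
    have "\<rho> \<one>\<^bsub>F\<^esub> \<in> Units (ring_mat TYPE('k) n ())"
      using rep by (auto simp: representation_def hom_def units_of_def)
    then obtain Y where Y: "Y \<in> carrier_mat n n" "Y * \<rho> \<one>\<^bsub>F\<^esub> = 1\<^sub>m n"
      by (auto simp: Units_def ring_mat_simps)
    show ?thesis
    proof
      assume "\<rho> \<one>\<^bsub>F\<^esub> = 0\<^sub>m n n"
      then have "(1\<^sub>m n :: 'k mat) = 0\<^sub>m n n" using Y by simp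
      from arg_cong[OF this, of "\<lambda>M. M $$ (0, 0)"] show False using n by simp
    qed
  qed
  then have c1: "\<chi> \<one>\<^bsub>F\<^esub> \<noteq> 0" using \<chi>[OF F.one_closed] by auto
  then have nz: "\<chi> g \<noteq> 0" if "g \<in> carrier F" for g
    using mult[of g "inv\<^bsub>F\<^esub> g"] that by auto
  have "\<chi> x \<noteq> 1"
  proof
    assume "\<chi> x = 1"
    then have "\<rho> x = 1\<^sub>m n" using \<chi>[OF x(1)] by auto
    then have "act x (T (unit_vec n 0)) = T (unit_vec n 0)"
      using eqv[OF x(1), of "unit_vec n 0"] by simp
    then have "T (unit_vec n 0) = 0" using nofix T[of "unit_vec n 0"] by simp
    then have "(unit_vec n 0 :: 'k vec) = 0\<^sub>v n" using T[of "unit_vec n 0"] by simp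
    from arg_cong[OF this, of "\<lambda>v. vec_index v 0"] show False using n by simp
  qed
  then show "\<exists>\<Phi>\<in>carrier (hom_group (mult_group :: 'k monoid) F). \<Phi> x \<noteq> 1"
    using x nz mult by (intro bexI[of _ "restrict \<chi> (carrier F)"]) (auto simp: hom_group_def hom_def)
qed

section \<open>Orthogonality of characters\<close>

lemma hom_group_simps [simp]:
  "f \<otimes>\<^bsub>hom_group A F\<^esub> g = (\<lambda>x\<in>carrier F. f x \<otimes>\<^bsub>A\<^esub> g x)"
  "\<one>\<^bsub>hom_group A F\<^esub> = (\<lambda>x\<in>carrier F. \<one>\<^bsub>A\<^esub>)"
  by (simp_all add: hom_group_def)

lemma carrier_hom_group: "carrier (hom_group A F) = hom F A \<inter> extensional (carrier F)"
  by (simp add: hom_group_def)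

lemma hom_group_memI:
  assumes "\<And>x. x \<in> carrier F \<Longrightarrow> \<phi> x \<in> carrier A" "\<And>x. x \<notin> carrier F \<Longrightarrow> \<phi> x = undefined"
    and "\<And>x y. x \<in> carrier F \<Longrightarrow> y \<in> carrier F \<Longrightarrow> \<phi> (x \<otimes>\<^bsub>F\<^esub> y) = \<phi> x \<otimes>\<^bsub>A\<^esub> \<phi> y"
  shows "\<phi> \<in> carrier (hom_group A F)"
  using assms by (auto simp: carrier_hom_group hom_def extensional_def)

lemma hom_group_memD:
  assumes "\<phi> \<in> carrier (hom_group A F)"
  shows "\<And>x. x \<in> carrier F \<Longrightarrow> \<phi> x \<in> carrier A" "\<And>x. x \<notin> carrier F \<Longrightarrow> \<phi> x = undefined"
    and "\<And>x y. x \<in> carrier F \<Longrightarrow> y \<in> carrier F \<Longrightarrow> \<phi> (x \<otimes>\<^bsub>F\<^esub> y) = \<phi> x \<otimes>\<^bsub>A\<^esub> \<phi> y"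
  using assms by (auto simp: carrier_hom_group hom_def extensional_def)

lemma hom_group_eqI:
  assumes "\<phi> \<in> carrier (hom_group A F)" "\<psi> \<in> carrier (hom_group A F)"
    and "\<And>x. x \<in> carrier F \<Longrightarrow> \<phi> x = \<psi> x"
  shows "\<phi> = \<psi>"
  using assms by (intro extensionalityI[of _ "carrier F"]) (auto simp: carrier_hom_group)

lemma comm_group_hom_group:
  assumes "comm_group A" "group F"
  shows "comm_group (hom_group A F)"
proof -
  interpret A: comm_group A by fact
  interpret F: group F by fact
  have cl: "\<phi> \<otimes>\<^bsub>hom_group A F\<^esub> \<psi> \<in> carrier (hom_group A F)"
    if "\<phi> \<in> carrier (hom_group A F)" "\<psi> \<in> carrier (hom_group A F)" for \<phi> \<psi>
    using hom_group_memD[OF that(1)] hom_group_memD[OF that(2)]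
    by (intro hom_group_memI) (simp_all add: A.m_ac)
  have one: "\<one>\<^bsub>hom_group A F\<^esub> \<in> carrier (hom_group A F)"
    by (intro hom_group_memI) simp_all
  show ?thesis
  proof (rule comm_groupI)
    fix \<phi> assume \<phi>: "\<phi> \<in> carrier (hom_group A F)"
    note D = hom_group_memD[OF \<phi>]
    have inv: "(\<lambda>x\<in>carrier F. inv\<^bsub>A\<^esub> \<phi> x) \<in> carrier (hom_group A F)"
      by (intro hom_group_memI) (simp_all add: D A.inv_mult)
    show "\<one>\<^bsub>hom_group A F\<^esub> \<otimes>\<^bsub>hom_group A F\<^esub> \<phi> = \<phi>"
      by (rule hom_group_eqI[OF cl[OF one \<phi>] \<phi>]) (simp add: D)
    show "\<exists>\<psi>\<in>carrier (hom_group A F). \<psi> \<otimes>\<^bsub>hom_group A F\<^esub> \<phi> = \<one>\<^bsub>hom_group A F\<^esub>"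
      by (rule bexI[OF _ inv], rule hom_group_eqI[OF cl[OF inv \<phi>] one]) (simp add: D)
    fix \<psi> assume \<psi>: "\<psi> \<in> carrier (hom_group A F)"
    show "\<phi> \<otimes>\<^bsub>hom_group A F\<^esub> \<psi> = \<psi> \<otimes>\<^bsub>hom_group A F\<^esub> \<phi>"
      by (rule hom_group_eqI[OF cl[OF \<phi> \<psi>] cl[OF \<psi> \<phi>]])
         (simp add: D hom_group_memD[OF \<psi>] A.m_comm)
    fix \<theta> assume \<theta>: "\<theta> \<in> carrier (hom_group A F)"
    show "\<phi> \<otimes>\<^bsub>hom_group A F\<^esub> \<psi> \<otimes>\<^bsub>hom_group A F\<^esub> \<theta> = \<phi> \<otimes>\<^bsub>hom_group A F\<^esub> (\<psi> \<otimes>\<^bsub>hom_group A F\<^esub> \<theta>)"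
      by (rule hom_group_eqI[OF cl[OF cl[OF \<phi> \<psi>] \<theta>] cl[OF \<phi> cl[OF \<psi> \<theta>]]])
         (simp add: D hom_group_memD[OF \<psi>] hom_group_memD[OF \<theta>] A.m_assoc)
  qed (use cl one in auto)
qed

lemma char_iff:
  "\<Phi> \<in> carrier (hom_group (mult_group :: 'k::field monoid) F) \<longleftrightarrow>
     \<Phi> \<in> extensional (carrier F) \<and> (\<forall>x\<in>carrier F. \<Phi> x \<noteq> 0) \<and>
     (\<forall>x\<in>carrier F. \<forall>y\<in>carrier F. \<Phi> (x \<otimes>\<^bsub>F\<^esub> y) = \<Phi> x * \<Phi> y)"
  by (auto simp: carrier_hom_group hom_def)

lemma sum_group_translate:
  assumes "group F" "y \<in> carrier F"
  shows "(\<Sum>x\<in>carrier F. f (x \<otimes>\<^bsub>F\<^esub> y)) = (\<Sum>x\<in>carrier F. f x)"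
proof -
  interpret F: group F by fact
  have "bij_betw (\<lambda>x. x \<otimes>\<^bsub>F\<^esub> y) (carrier F) (carrier F)"
    by (rule bij_betwI[of _ _ _ "\<lambda>x. x \<otimes>\<^bsub>F\<^esub> inv\<^bsub>F\<^esub> y"]) (use assms(2) in \<open>auto simp: F.m_assoc\<close>)
  then show ?thesis by (rule sum.reindex_bij_betw)
qed

text \<open>Translation by \<open>y\<close> permutes the summands and multiplies the sum by \<open>\<chi> y\<close>.\<close>

lemma sum_nontrivial_char_eq_0:
  fixes \<chi> :: "'f \<Rightarrow> 'k::field"
  assumes "group F"
    and mult: "\<And>x y. x \<in> carrier F \<Longrightarrow> y \<in> carrier F \<Longrightarrow> \<chi> (x \<otimes>\<^bsub>F\<^esub> y) = \<chi> x * \<chi> y"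
    and y: "y \<in> carrier F" "\<chi> y \<noteq> 1"
  shows "(\<Sum>x\<in>carrier F. \<chi> x) = 0"
proof -
  interpret F: group F by fact
  have bij: "bij_betw (\<lambda>x. y \<otimes>\<^bsub>F\<^esub> x) (carrier F) (carrier F)"
    by (rule bij_betwI[of _ _ _ "\<lambda>x. inv\<^bsub>F\<^esub> y \<otimes>\<^bsub>F\<^esub> x"])
       (use y(1) in \<open>auto simp: F.m_assoc[symmetric]\<close>)
  have "(\<Sum>x\<in>carrier F. \<chi> x) = (\<Sum>x\<in>carrier F. \<chi> (y \<otimes>\<^bsub>F\<^esub> x))"
    by (rule sum.reindex_bij_betw[OF bij, symmetric])
  also have "\<dots> = \<chi> y * (\<Sum>x\<in>carrier F. \<chi> x)"
    using y(1) mult by (simp add: sum_distrib_left)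
  finally have "(\<chi> y - 1) * (\<Sum>x\<in>carrier F. \<chi> x) = 0" by (simp add: left_diff_distrib)
  then show ?thesis using y(2) by simp
qed

lemma char_row_orthogonality:
  fixes \<Phi> \<Psi> :: "'f \<Rightarrow> 'k::field"
  assumes "group F"
    and \<Phi>: "\<Phi> \<in> carrier (hom_group mult_group F)" and \<Psi>: "\<Psi> \<in> carrier (hom_group mult_group F)"
  shows "(\<Sum>x\<in>carrier F. inverse (\<Phi> x) * \<Psi> x) = (if \<Phi> = \<Psi> then of_nat (card (carrier F)) else 0)"
proof (cases "\<Phi> = \<Psi>")
  case True
  then show ?thesis using \<Phi> by (simp add: char_iff)
next
  case False
  then obtain y where "y \<in> carrier F" "\<Phi> y \<noteq> \<Psi> y"
    using extensionalityI[of \<Phi> "carrier F" \<Psi>] \<Phi> \<Psi> by (auto simp: char_iff)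
  then have "(\<Sum>x\<in>carrier F. inverse (\<Phi> x) * \<Psi> x) = 0"
    using \<Phi> \<Psi> by (intro sum_nontrivial_char_eq_0[OF assms(1), of _ y]) (auto simp: char_iff field_simps)
  then show ?thesis using False by simp
qed

lemma char_column_orthogonality:
  assumes "enough_chars TYPE('k::field) F" "group F" and x: "x \<in> carrier F"
  shows "(\<Sum>\<Phi>\<in>carrier (hom_group (mult_group :: 'k monoid) F). \<Phi> x) =
           (if x = \<one>\<^bsub>F\<^esub> then of_nat (card (carrier (hom_group (mult_group :: 'k monoid) F))) else 0)"
proof (cases "x = \<one>\<^bsub>F\<^esub>")
  case True
  interpret F: group F by fact
  have "\<Phi> \<one>\<^bsub>F\<^esub> = 1" if \<Phi>: "\<Phi> \<in> carrier (hom_group (mult_group :: 'k monoid) F)" for \<Phi>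
  proof -
    have "\<Phi> (\<one>\<^bsub>F\<^esub> \<otimes>\<^bsub>F\<^esub> \<one>\<^bsub>F\<^esub>) = \<Phi> \<one>\<^bsub>F\<^esub> * \<Phi> \<one>\<^bsub>F\<^esub>" "\<Phi> \<one>\<^bsub>F\<^esub> \<noteq> 0"
      using \<Phi> unfolding char_iff by blast+
    then show ?thesis by simp
  qed
  then have "(\<Sum>\<Phi>\<in>carrier (hom_group (mult_group :: 'k monoid) F). \<Phi> x) =
      (\<Sum>\<Phi>\<in>carrier (hom_group (mult_group :: 'k monoid) F). 1)"
    unfolding True by (rule sum.cong[OF refl])
  then show ?thesis using True by simp
next
  case False
  then obtain \<Psi> where "\<Psi> \<in> carrier (hom_group (mult_group :: 'k monoid) F)" "\<Psi> x \<noteq> 1"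
    using assms unfolding enough_chars_def by blast
  then show ?thesis
    using False sum_nontrivial_char_eq_0[of "hom_group (mult_group :: 'k monoid) F" "\<lambda>\<Phi>. \<Phi> x" \<Psi>] x
      comm_group.axioms(2)[OF comm_group_hom_group[OF comm_group_mult_group assms(2)]]
    by simp
qed

text \<open>The values of a character are roots of unity of order dividing \<open>|F|\<close>, of which a field has
  finitely many.\<close>

lemma finite_chars:
  assumes "group F" "finite (carrier F)"
  shows "finite (carrier (hom_group (mult_group :: 'k::field monoid) F))"
proof -
  interpret F: group F by fact
  define n where "n = Coset.order F"
  have n: "n > 0" using assms(2) F.one_closed by (auto simp: n_def Coset.order_def card_gt_0_iff)
  define R :: "'k set" where "R = {t. poly (monom 1 n - 1) t = 0}"
  have "coeff (monom 1 n - 1 :: 'k poly) n \<noteq> 0" using n by (simp add: coeff_monom)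
  then have "monom 1 n - 1 \<noteq> (0 :: 'k poly)" by (metis coeff_0)
  then have R: "finite R" unfolding R_def by (rule poly_roots_finite)
  have "\<Phi> x \<in> R" if \<Phi>: "\<Phi> \<in> carrier (hom_group (mult_group :: 'k monoid) F)" and x: "x \<in> carrier F" for \<Phi> x
  proof -
    have m: "\<Phi> (a \<otimes>\<^bsub>F\<^esub> b) = \<Phi> a * \<Phi> b" "\<Phi> a \<noteq> 0" if "a \<in> carrier F" "b \<in> carrier F" for a b
      using \<Phi> that by (auto simp: char_iff)
    have one: "\<Phi> \<one>\<^bsub>F\<^esub> = 1" using m[of "\<one>\<^bsub>F\<^esub>" "\<one>\<^bsub>F\<^esub>"] by simp
    have "\<Phi> (x [^]\<^bsub>F\<^esub> (i::nat)) = \<Phi> x ^ i" for i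
      by (induction i) (use one m x in auto)
    from this[of n] show ?thesis using x one by (simp add: n_def R_def poly_monom F.pow_order_eq_1)
  qed
  then have "carrier (hom_group (mult_group :: 'k monoid) F) \<subseteq> carrier F \<rightarrow>\<^sub>E R"
    by (auto simp: PiE_def char_iff)
  then show ?thesis using finite_PiE[OF assms(2), of "\<lambda>_. R"] R finite_subset by blast
qed

section \<open>Linear extension\<close>

lemma lookup_scale [simp]: "Poly_Mapping.lookup (scale a x) c = a * Poly_Mapping.lookup x c"
  by (simp add: scale_def Poly_Mapping.map.rep_eq when_def)

lemma keys_scale: "Poly_Mapping.keys (scale a x) \<subseteq> Poly_Mapping.keys x"
  by (auto simp: in_keys_iff)

lemma char_ext_superset:
  assumes "finite S" "Poly_Mapping.keys x \<subseteq> S"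
  shows "char_ext f x = (\<Sum>c\<in>S. Poly_Mapping.lookup x c * f c)"
  unfolding char_ext_def by (rule sum.mono_neutral_left) (use assms in \<open>auto simp: in_keys_iff\<close>)

lemma char_ext_cong: "(\<And>c. c \<in> Poly_Mapping.keys x \<Longrightarrow> f c = g c) \<Longrightarrow> char_ext f x = char_ext g x"
  unfolding char_ext_def by (rule sum.cong) auto

lemma char_ext_0 [simp]: "char_ext f 0 = 0"
  by (simp add: char_ext_def)

lemma char_ext_add: "char_ext f (x + y) = char_ext f x + char_ext f y"
proof -
  let ?S = "Poly_Mapping.keys x \<union> Poly_Mapping.keys y"
  have *: "char_ext f z = (\<Sum>c\<in>?S. Poly_Mapping.lookup z c * f c)" if "Poly_Mapping.keys z \<subseteq> ?S" for z
    using that by (intro char_ext_superset) auto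
  show ?thesis
    using *[of "x + y"] *[of x] *[of y] Poly_Mapping.keys_add[of x y]
    by (simp add: lookup_add distrib_right sum.distrib)
qed

lemma char_ext_diff: "char_ext f (x - y) = char_ext f x - char_ext f y"
  using char_ext_add[of f "x - y" y] by simp

lemma char_ext_sum: "char_ext f (\<Sum>i\<in>I. x i) = (\<Sum>i\<in>I. char_ext f (x i))"
  by (induction I rule: infinite_finite_induct) (auto simp: char_ext_add)

lemma char_ext_scale [simp]: "char_ext f (scale a x) = a * char_ext f x"
  using char_ext_superset[OF _ keys_scale, of x f a]
  by (simp add: char_ext_def sum_distrib_left mult.assoc)

lemma char_ext_single [simp]: "char_ext f (Poly_Mapping.single c a) = a * f c"
  by (cases "a = 0") (auto simp: char_ext_def)

text \<open>Species are linear functionals and the structure maps are linear, so each composite is the linear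
  extension of its values on the basis.\<close>

lemma char_ext_lin_ext: "char_ext f (lin_ext h x) = char_ext (\<lambda>c. char_ext f (h c)) x"
  by (simp add: lin_ext_def char_ext_sum) (simp add: char_ext_def)

lemma keys_sum_subset: "(\<And>i. i \<in> I \<Longrightarrow> Poly_Mapping.keys (x i) \<subseteq> S) \<Longrightarrow> Poly_Mapping.keys (\<Sum>i\<in>I. x i) \<subseteq> S"
proof (induction I rule: infinite_finite_induct)
  case (insert i I)
  then show ?case using Poly_Mapping.keys_add[of "x i" "\<Sum>i\<in>I. x i"] by auto
qed auto

lemma keys_lin_ext_subset:
  "(\<And>c. c \<in> Poly_Mapping.keys x \<Longrightarrow> Poly_Mapping.keys (h c) \<subseteq> S) \<Longrightarrow> Poly_Mapping.keys (lin_ext h x) \<subseteq> S"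
  unfolding lin_ext_def by (intro keys_sum_subset) (meson keys_scale subset_trans)

section \<open>Conjugation\<close>

locale fibered_group = A: comm_group A + group G
  for A :: "('a, 'n) monoid_scheme" and G :: "('g, 'm) monoid_scheme" (structure) +
  assumes finite_carrier [simp]: "finite (carrier G)"
begin

abbreviation dgroup :: "'g set \<Rightarrow> ('g \<Rightarrow> 'a) monoid" where
  "dgroup U \<equiv> hom_group A (G\<lparr>carrier := U\<rparr>)"

abbreviation dual :: "'g set \<Rightarrow> ('g \<Rightarrow> 'a) set" where
  "dual U \<equiv> carrier (dgroup U)"

abbreviation act ::
    "'g \<Rightarrow> 'g set \<times> (('g \<Rightarrow> 'a) \<Rightarrow> 'k::field) \<Rightarrow> 'g set \<times> (('g \<Rightarrow> 'a) \<Rightarrow> 'k)" where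
  "act \<equiv> conj_char_pair A G"

abbreviation chars :: "'g set \<Rightarrow> (('g \<Rightarrow> 'a) \<Rightarrow> 'k::field) set" where
  "chars U \<equiv> dual_chars A (G\<lparr>carrier := U\<rparr>)"

definition pairs :: "('g set \<times> ('g \<Rightarrow> 'a)) set" where
  "pairs = {(U, \<phi>). subgroup U G \<and> \<phi> \<in> dual U}"

text \<open>A conjugate \<open>\<^sup>gU\<close> is the preimage of \<open>U\<close> under this map, and \<open>\<^sup>g\<phi>\<close> is its composite with \<open>\<phi>\<close>;
  so it is the inverse conjugation that is convenient.\<close>

definition cj :: "'g \<Rightarrow> 'g \<Rightarrow> 'g" where
  "cj g x = inv g \<otimes> x \<otimes> g"

lemma dualI:
  assumes "\<And>x. x \<in> U \<Longrightarrow> \<phi> x \<in> carrier A" "\<And>x. x \<notin> U \<Longrightarrow> \<phi> x = undefined"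
    and "\<And>x y. x \<in> U \<Longrightarrow> y \<in> U \<Longrightarrow> \<phi> (x \<otimes> y) = \<phi> x \<otimes>\<^bsub>A\<^esub> \<phi> y"
  shows "\<phi> \<in> dual U"
  using assms by (intro hom_group_memI) auto

lemma dualD:
  assumes "\<phi> \<in> dual U"
  shows "\<And>x. x \<in> U \<Longrightarrow> \<phi> x \<in> carrier A" "\<And>x. x \<notin> U \<Longrightarrow> \<phi> x = undefined"
    and "\<And>x y. x \<in> U \<Longrightarrow> y \<in> U \<Longrightarrow> \<phi> (x \<otimes> y) = \<phi> x \<otimes>\<^bsub>A\<^esub> \<phi> y"
  using hom_group_memD[OF assms] by auto

lemma dual_eqI:
  assumes "\<phi> \<in> dual U" "\<psi> \<in> dual U" "\<And>x. x \<in> U \<Longrightarrow> \<phi> x = \<psi> x"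
  shows "\<phi> = \<psi>"
  using hom_group_eqI[OF assms(1,2)] assms(3) by simp

lemma dual_one: "subgroup U G \<Longrightarrow> \<phi> \<in> dual U \<Longrightarrow> \<phi> \<one> = \<one>\<^bsub>A\<^esub>"
proof -
  assume U: "subgroup U G" and \<phi>: "\<phi> \<in> dual U"
  have "\<phi> \<one> \<otimes>\<^bsub>A\<^esub> \<phi> \<one> = \<phi> \<one>" using dualD(3)[OF \<phi>, of \<one> \<one>] subgroup.one_closed[OF U] by simp
  then show ?thesis using A.r_cancel_one' dualD(1)[OF \<phi> subgroup.one_closed[OF U]] by metis
qed

lemma dual_restrict:
  assumes "\<phi> \<in> dual U" "subgroup W G" "W \<subseteq> U"
  shows "restrict \<phi> W \<in> dual W"
proof (rule dualI)
  show "restrict \<phi> W (x \<otimes> y) = restrict \<phi> W x \<otimes>\<^bsub>A\<^esub> restrict \<phi> W y" if "x \<in> W" "y \<in> W" for x y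
    using that assms(2,3) dualD(3)[OF assms(1), of x y] subgroup.m_closed[OF assms(2)] by auto
qed (use assms(3) dualD[OF assms(1)] in auto)

lemma group_sub: "subgroup U G \<Longrightarrow> group (G\<lparr>carrier := U\<rparr>)"
  by (rule subgroup_imp_group)

lemma comm_group_dual: "subgroup U G \<Longrightarrow> comm_group (dgroup U)"
  by (rule comm_group_hom_group[OF A.comm_group_axioms group_sub])

lemma dual_mult_closed:
  assumes "subgroup U G" "\<phi> \<in> dual U" "\<psi> \<in> dual U"
  shows "\<phi> \<otimes>\<^bsub>dgroup U\<^esub> \<psi> \<in> dual U"
proof -
  interpret M: comm_group "dgroup U" by (rule comm_group_dual[OF assms(1)])
  show ?thesis by (rule M.m_closed[OF assms(2,3)])
qed

lemma subgroup_finite: "subgroup U G \<Longrightarrow> finite U"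
  using finite_subset[OF subgroup.subset finite_carrier] .

lemma subgroup_card_pos: "subgroup U G \<Longrightarrow> card U > 0"
  using subgroup_finite[of U] subgroup.one_closed[of U G] by (auto simp: card_gt_0_iff)

lemma cj_closed [simp]: "g \<in> carrier G \<Longrightarrow> x \<in> carrier G \<Longrightarrow> cj g x \<in> carrier G"
  by (simp add: cj_def)

lemma cj_one [simp]: "x \<in> carrier G \<Longrightarrow> cj \<one> x = x"
  by (simp add: cj_def)

lemma cj_mult: "g \<in> carrier G \<Longrightarrow> h \<in> carrier G \<Longrightarrow> x \<in> carrier G \<Longrightarrow> cj (g \<otimes> h) x = cj h (cj g x)"
  by (simp add: cj_def inv_mult_group m_assoc)

lemma cj_inv_cj [simp]: "g \<in> carrier G \<Longrightarrow> x \<in> carrier G \<Longrightarrow> cj (inv g) (cj g x) = x"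
  using cj_mult[of g "inv g" x] by simp

lemma cj_cj_inv [simp]: "g \<in> carrier G \<Longrightarrow> x \<in> carrier G \<Longrightarrow> cj g (cj (inv g) x) = x"
  using cj_mult[of "inv g" g x] by simp

lemma cj_hom: "g \<in> carrier G \<Longrightarrow> x \<in> carrier G \<Longrightarrow> y \<in> carrier G \<Longrightarrow> cj g (x \<otimes> y) = cj g x \<otimes> cj g y"
  by (simp add: cj_def m_assoc inv_solve_left) (simp add: m_assoc[symmetric])

lemma cj_subgroup: "subgroup U G \<Longrightarrow> g \<in> U \<Longrightarrow> x \<in> U \<Longrightarrow> cj g x \<in> U"
  by (simp add: cj_def subgroup.m_closed subgroup.m_inv_closed)

lemma cj_subgroup_iff:
  assumes "subgroup U G" "g \<in> U" "x \<in> carrier G" shows "cj g x \<in> U \<longleftrightarrow> x \<in> U"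
  using cj_subgroup[OF assms(1,2), of x] cj_subgroup[OF assms(1) subgroup.m_inv_closed[OF assms(1,2)], of "cj g x"]
    assms subgroup.subset[OF assms(1)] by auto

lemma mem_conj_set:
  assumes "U \<subseteq> carrier G" "g \<in> carrier G"
  shows "x \<in> conj_set G g U \<longleftrightarrow> x \<in> carrier G \<and> cj g x \<in> U"
proof
  assume "x \<in> conj_set G g U"
  then obtain u where u: "u \<in> U" "x = g \<otimes> u \<otimes> inv g"
    by (auto simp: conj_set_def l_coset_def r_coset_def)
  then have "cj (inv g) u = x" using assms by (simp add: cj_def)
  then show "x \<in> carrier G \<and> cj g x \<in> U" using u assms by (metis cj_cj_inv cj_closed inv_closed subsetD)
next
  assume x: "x \<in> carrier G \<and> cj g x \<in> U"
  then have "x = g \<otimes> cj g x \<otimes> inv g" using cj_inv_cj[OF assms(2), of x] assms by (simp add: cj_def[of "inv g"])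
  then show "x \<in> conj_set G g U" using x by (auto simp: conj_set_def l_coset_def r_coset_def)
qed

lemma conj_set_subset: "U \<subseteq> carrier G \<Longrightarrow> g \<in> carrier G \<Longrightarrow> conj_set G g U \<subseteq> carrier G"
  using mem_conj_set by blast

lemma conj_set_image: "U \<subseteq> carrier G \<Longrightarrow> g \<in> carrier G \<Longrightarrow> conj_set G g U = cj (inv g) ` U"
  by (auto simp: mem_conj_set subset_iff image_iff) (metis cj_inv_cj)

lemma inj_on_cj: "g \<in> carrier G \<Longrightarrow> inj_on (cj g) (carrier G)"
  by (rule inj_on_inverseI[of _ "cj (inv g)"]) simp

lemma card_conj_set: "U \<subseteq> carrier G \<Longrightarrow> g \<in> carrier G \<Longrightarrow> card (conj_set G g U) = card U"
  using card_image[OF inj_on_subset[OF inj_on_cj], of "inv g" U] by (simp add: conj_set_image)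

lemma subgroup_conj_set:
  assumes "subgroup U G" "g \<in> carrier G" shows "subgroup (conj_set G g U) G"
proof -
  note m = mem_conj_set[OF subgroup.subset[OF assms(1)] assms(2)]
  show ?thesis
  proof (rule subgroupI)
    show "conj_set G g U \<noteq> {}"
      using m[of \<one>] assms subgroup.one_closed by (auto simp: cj_def)
    show "inv a \<in> conj_set G g U" if "a \<in> conj_set G g U" for a
    proof -
      have "cj g (inv a) = inv (cj g a)" using that m assms by (simp add: cj_def inv_mult_group m_assoc)
      then show ?thesis using that m assms(1) by (auto intro: subgroup.m_inv_closed)
    qed
    show "a \<otimes> b \<in> conj_set G g U" if "a \<in> conj_set G g U" "b \<in> conj_set G g U" for a b
      using that m assms by (auto simp: cj_hom intro: subgroup.m_closed)
  qed (use m in auto)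
qed

lemma conj_set_mult:
  "U \<subseteq> carrier G \<Longrightarrow> g \<in> carrier G \<Longrightarrow> h \<in> carrier G \<Longrightarrow>
     conj_set G (g \<otimes> h) U = conj_set G g (conj_set G h U)"
  by (rule Set.set_eqI) (auto simp: mem_conj_set conj_set_subset cj_mult)

lemma conj_set_one: "U \<subseteq> carrier G \<Longrightarrow> conj_set G \<one> U = U"
  by (rule Set.set_eqI) (auto simp: mem_conj_set)

lemma conj_set_inv:
  assumes "U \<subseteq> carrier G" "g \<in> carrier G"
  shows "conj_set G (inv g) (conj_set G g U) = U" "conj_set G g (conj_set G (inv g) U) = U"
  using conj_set_mult[OF assms(1), of "inv g" g] conj_set_mult[OF assms(1), of g "inv g"] assms
  by (simp_all add: conj_set_one)

lemma conj_set_mono: "V \<subseteq> U \<Longrightarrow> U \<subseteq> carrier G \<Longrightarrow> g \<in> carrier G \<Longrightarrow> conj_set G g V \<subseteq> conj_set G g U"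
  by (auto simp: mem_conj_set subset_iff)

lemma conj_set_subset_iff:
  "V \<subseteq> carrier G \<Longrightarrow> U \<subseteq> carrier G \<Longrightarrow> g \<in> carrier G \<Longrightarrow> conj_set G g V \<subseteq> conj_set G g U \<longleftrightarrow> V \<subseteq> U"
  using conj_set_mono[of V U g] conj_set_mono[of "conj_set G g V" "conj_set G g U" "inv g"]
  by (auto simp: conj_set_inv conj_set_subset)

lemma conj_set_self: "subgroup U G \<Longrightarrow> g \<in> U \<Longrightarrow> conj_set G g U = U"
  by (rule Set.set_eqI) (use subgroup.subset[of U G] in \<open>auto simp: mem_conj_set subset_iff cj_subgroup_iff\<close>)

lemma conj_hom_apply:
  "U \<subseteq> carrier G \<Longrightarrow> g \<in> carrier G \<Longrightarrow>
     conj_hom G g U \<phi> x = (if x \<in> carrier G \<and> cj g x \<in> U then \<phi> (cj g x) else undefined)"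
  by (simp add: conj_hom_def mem_conj_set cj_def)

lemma conj_hom_dual:
  assumes "U \<subseteq> carrier G" "g \<in> carrier G" "\<phi> \<in> dual U"
  shows "conj_hom G g U \<phi> \<in> dual (conj_set G g U)"
proof -
  note D = dualD[OF assms(3)]
  show ?thesis
  proof (rule dualI)
    fix x y assume x: "x \<in> conj_set G g U" and y: "y \<in> conj_set G g U"
    have *: "x \<in> carrier G" "cj g x \<in> U" "y \<in> carrier G" "cj g y \<in> U"
      using x y mem_conj_set[OF assms(1,2)] by auto
    show "conj_hom G g U \<phi> (x \<otimes> y) = conj_hom G g U \<phi> x \<otimes>\<^bsub>A\<^esub> conj_hom G g U \<phi> y"
    proof (cases "cj g (x \<otimes> y) \<in> U")
      case True
      then show ?thesis using * D(3)[of "cj g x" "cj g y"] assms by (simp add: conj_hom_apply cj_hom)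
    next
      case False
      then show ?thesis using * D(3)[of "cj g x" "cj g y"] D(2)[of "cj g x \<otimes> cj g y"] assms
        by (simp add: conj_hom_apply cj_hom)
    qed
  qed (use assms D in \<open>auto simp: mem_conj_set conj_hom_apply\<close>)
qed

lemma conj_hom_mult:
  "U \<subseteq> carrier G \<Longrightarrow> g \<in> carrier G \<Longrightarrow> h \<in> carrier G \<Longrightarrow>
     conj_hom G (g \<otimes> h) U \<phi> = conj_hom G g (conj_set G h U) (conj_hom G h U \<phi>)"
  by (rule ext) (auto simp: conj_hom_apply conj_set_subset mem_conj_set cj_mult)

lemma conj_hom_one: "U \<subseteq> carrier G \<Longrightarrow> \<phi> \<in> dual U \<Longrightarrow> conj_hom G \<one> U \<phi> = \<phi>"
  by (rule ext) (auto simp: conj_hom_apply subset_iff dest: dualD(2))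

lemma conj_hom_inv:
  assumes "U \<subseteq> carrier G" "g \<in> carrier G" "\<phi> \<in> dual U"
  shows "conj_hom G (inv g) (conj_set G g U) (conj_hom G g U \<phi>) = \<phi>"
  using conj_hom_mult[OF assms(1), of "inv g" g \<phi>] assms by (simp add: conj_hom_one)

lemma conj_hom_restrict:
  assumes "W \<subseteq> U" "U \<subseteq> carrier G" "g \<in> carrier G"
  shows "restrict (conj_hom G g U \<phi>) (conj_set G g W) = conj_hom G g W (restrict \<phi> W)"
  using assms by (intro ext) (auto simp: conj_hom_apply mem_conj_set subset_iff)

lemma conj_hom_dual_mult:
  assumes "U \<subseteq> carrier G" "g \<in> carrier G" "\<phi> \<in> dual U" "\<psi> \<in> dual U"
  shows "conj_hom G g U (\<phi> \<otimes>\<^bsub>dgroup U\<^esub> \<psi>) =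
    conj_hom G g U \<phi> \<otimes>\<^bsub>dgroup (conj_set G g U)\<^esub> conj_hom G g U \<psi>"
  using assms by (intro ext) (auto simp: conj_hom_apply mem_conj_set)

text \<open>Since \<open>A\<close> is commutative, homomorphisms into \<open>A\<close> are class functions.\<close>

lemma dual_cj_self:
  assumes "subgroup U G" "\<phi> \<in> dual U" "g \<in> U" "x \<in> U"
  shows "\<phi> (cj g x) = \<phi> x"
proof -
  note D = dualD[OF assms(2)]
  have g: "inv g \<in> U" using assms by (simp add: subgroup.m_inv_closed)
  have "\<phi> (inv g) \<otimes>\<^bsub>A\<^esub> \<phi> x \<otimes>\<^bsub>A\<^esub> \<phi> g = \<phi> (inv g) \<otimes>\<^bsub>A\<^esub> \<phi> g \<otimes>\<^bsub>A\<^esub> \<phi> x"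
    using D(1)[OF g] D(1)[OF assms(3)] D(1)[OF assms(4)] by (simp add: A.m_ac)
  also have "\<phi> (inv g) \<otimes>\<^bsub>A\<^esub> \<phi> g \<otimes>\<^bsub>A\<^esub> \<phi> x = \<phi> (inv g \<otimes> g \<otimes> x)"
    using D(3) g assms by (simp add: subgroup.m_closed)
  also have "\<dots> = \<phi> x" using assms subgroup.subset[OF assms(1)] by (simp add: subset_iff)
  finally show ?thesis using D(3) g assms by (simp add: cj_def subgroup.m_closed)
qed

lemma conj_hom_self:
  assumes "subgroup U G" "\<phi> \<in> dual U" "g \<in> U"
  shows "conj_hom G g U \<phi> = \<phi>"
proof (rule dual_eqI)
  have g: "g \<in> carrier G" "U \<subseteq> carrier G" using assms subgroup.subset by auto
  show "conj_hom G g U \<phi> \<in> dual U"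
    using conj_hom_dual[OF g(2,1) assms(2)] conj_set_self[OF assms(1,3)] by simp
  show "conj_hom G g U \<phi> x = \<phi> x" if "x \<in> U" for x
    using that g assms by (auto simp: conj_hom_apply dual_cj_self cj_subgroup)
qed (rule assms)

lemma conj_pair_in_pairs: "u \<in> pairs \<Longrightarrow> g \<in> carrier G \<Longrightarrow> conj_pair G g u \<in> pairs"
  by (auto simp: pairs_def subgroup_conj_set intro!: conj_hom_dual subgroup.subset)

lemma conj_pair_mult:
  "u \<in> pairs \<Longrightarrow> g \<in> carrier G \<Longrightarrow> h \<in> carrier G \<Longrightarrow>
     conj_pair G (g \<otimes> h) u = conj_pair G g (conj_pair G h u)"
  by (auto simp: pairs_def conj_set_mult conj_hom_mult subgroup.subset)

lemma conj_pair_one: "u \<in> pairs \<Longrightarrow> conj_pair G \<one> u = u"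
  by (auto simp: pairs_def conj_set_one conj_hom_one subgroup.subset)

lemma conj_pair_inv: "u \<in> pairs \<Longrightarrow> g \<in> carrier G \<Longrightarrow> conj_pair G (inv g) (conj_pair G g u) = u"
  using conj_pair_mult[of u "inv g" g] by (simp add: conj_pair_one)

lemma conj_pair_self: "u \<in> pairs \<Longrightarrow> g \<in> fst u \<Longrightarrow> conj_pair G g u = u"
  by (auto simp: pairs_def conj_set_self conj_hom_self)

lemma char_pairs_iff: "(H, \<Phi>) \<in> char_pairs A G \<longleftrightarrow> subgroup H G \<and> \<Phi> \<in> chars H"
  by (simp add: char_pairs_def)

lemma charsD:
  assumes "\<Phi> \<in> (chars H :: (('g \<Rightarrow> 'a) \<Rightarrow> 'k::field) set)"
  shows "\<And>\<phi>. \<phi> \<notin> dual H \<Longrightarrow> \<Phi> \<phi> = undefined" "\<And>\<phi>. \<phi> \<in> dual H \<Longrightarrow> \<Phi> \<phi> \<noteq> 0"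
    and "\<And>\<phi> \<psi>. \<phi> \<in> dual H \<Longrightarrow> \<psi> \<in> dual H \<Longrightarrow> \<Phi> (\<phi> \<otimes>\<^bsub>dgroup H\<^esub> \<psi>) = \<Phi> \<phi> * \<Phi> \<psi>"
  using assms unfolding char_iff by (auto simp: extensional_def)

lemma charsI:
  assumes "\<And>\<phi>. \<phi> \<notin> dual H \<Longrightarrow> \<Phi> \<phi> = undefined" "\<And>\<phi>. \<phi> \<in> dual H \<Longrightarrow> \<Phi> \<phi> \<noteq> 0"
    and "\<And>\<phi> \<psi>. \<phi> \<in> dual H \<Longrightarrow> \<psi> \<in> dual H \<Longrightarrow> \<Phi> (\<phi> \<otimes>\<^bsub>dgroup H\<^esub> \<psi>) = \<Phi> \<phi> * \<Phi> \<psi>"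
  shows "\<Phi> \<in> (chars H :: (('g \<Rightarrow> 'a) \<Rightarrow> 'k::field) set)"
  unfolding char_iff using assms by (auto simp: extensional_def)

lemma conj_char_pair_in_char_pairs:
  assumes "p \<in> char_pairs A G" "g \<in> carrier G"
  shows "act g p \<in> char_pairs A G"
proof -
  obtain H \<Phi> where p: "p = (H, \<Phi>)" by (cases p)
  have H: "subgroup H G" "H \<subseteq> carrier G" and \<Phi>: "\<Phi> \<in> chars H"
    using assms by (auto simp: p char_pairs_iff subgroup.subset)
  have sub: "conj_set G g H \<subseteq> carrier G" "subgroup (conj_set G g H) G"
    using H assms by (simp_all add: conj_set_subset subgroup_conj_set)
  have backH: "conj_hom G (inv g) (conj_set G g H) \<phi> \<in> dual H" if "\<phi> \<in> dual (conj_set G g H)" for \<phi>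
    using conj_hom_dual[OF sub(1) _ that, of "inv g"] assms H by (simp add: conj_set_inv)
  note D = charsD[OF \<Phi>]
  show ?thesis unfolding p conj_char_pair.simps char_pairs_iff
  proof (intro conjI charsI)
    fix \<phi> \<psi> assume *: "\<phi> \<in> dual (conj_set G g H)" "\<psi> \<in> dual (conj_set G g H)"
    then have "\<phi> \<otimes>\<^bsub>dgroup (conj_set G g H)\<^esub> \<psi> \<in> dual (conj_set G g H)"
      using dual_mult_closed sub by blast
    then show "(\<lambda>\<phi>\<in>dual (conj_set G g H). \<Phi> (conj_hom G (inv g) (conj_set G g H) \<phi>))
        (\<phi> \<otimes>\<^bsub>dgroup (conj_set G g H)\<^esub> \<psi>) =
      (\<lambda>\<phi>\<in>dual (conj_set G g H). \<Phi> (conj_hom G (inv g) (conj_set G g H) \<phi>)) \<phi> *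
      (\<lambda>\<phi>\<in>dual (conj_set G g H). \<Phi> (conj_hom G (inv g) (conj_set G g H) \<phi>)) \<psi>"
      using * D(3)[OF backH backH] conj_hom_dual_mult[OF sub(1) _ *, of "inv g"] assms H
      by (simp add: conj_set_inv del: hom_group_simps)
  qed (use sub backH D in auto)
qed

lemma conj_char_pair_mult:
  assumes "p \<in> char_pairs A G" "g \<in> carrier G" "h \<in> carrier G"
  shows "act (g \<otimes> h) p = act g (act h p)"
proof -
  obtain H \<Phi> where p: "p = (H, \<Phi>)" by (cases p)
  have H: "H \<subseteq> carrier G" using assms by (auto simp: p char_pairs_iff subgroup.subset)
  define K where "K = conj_set G h H"
  define L where "L = conj_set G g K"
  have K: "K \<subseteq> carrier G" and L: "L \<subseteq> carrier G"
    using H assms by (auto simp: K_def L_def conj_set_subset)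
  have gh: "conj_set G (g \<otimes> h) H = L" using H assms by (simp add: K_def L_def conj_set_mult)
  have gL: "conj_set G (inv g) L = K" using K assms by (simp add: L_def conj_set_inv)
  have comp: "\<Phi> (conj_hom G (inv (g \<otimes> h)) L \<phi>) = \<Phi> (conj_hom G (inv h) K (conj_hom G (inv g) L \<phi>))" for \<phi>
    using conj_hom_mult[OF L, of "inv h" "inv g" \<phi>] assms gL by (simp add: inv_mult_group)
  moreover have "conj_hom G (inv g) L \<phi> \<in> dual K" if "\<phi> \<in> dual L" for \<phi>
    using conj_hom_dual[OF L _ that, of "inv g"] assms gL by simp
  ultimately show ?thesis
    unfolding p conj_char_pair.simps gh by (auto simp: K_def[symmetric] L_def[symmetric] fun_eq_iff)
qed

lemma conj_char_pair_one: "p \<in> char_pairs A G \<Longrightarrow> act \<one> p = p"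
  by (cases p) (auto simp: char_pairs_iff conj_set_one conj_hom_one subgroup.subset fun_eq_iff dest: charsD(1))

lemma conj_char_pair_inv:
  assumes "p \<in> char_pairs A G" "g \<in> carrier G"
  shows "act (inv g) (act g p) = p"
    "act g (act (inv g) p) = p"
  using conj_char_pair_mult[OF assms(1), of "inv g" g] conj_char_pair_mult[OF assms(1), of g "inv g"]
    assms by (simp_all add: conj_char_pair_one[OF assms(1)])

lemma conj_char_pair_self:
  assumes "(H, \<Phi>) \<in> char_pairs A G" "g \<in> H"
  shows "act g (H, \<Phi>) = (H, \<Phi>)"
proof -
  have H: "subgroup H G" and \<Phi>: "\<Phi> \<in> chars H" using assms by (auto simp: char_pairs_iff)
  have "inv g \<in> H" using H assms by (simp add: subgroup.m_inv_closed)
  then show ?thesis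
    using H assms charsD(1)[OF \<Phi>] by (auto simp: conj_set_self conj_hom_self fun_eq_iff)
qed

lemma pairs_subgroup: "u \<in> pairs \<Longrightarrow> subgroup (fst u) G"
  by (auto simp: pairs_def)

lemma char_pairs_subgroup: "p \<in> char_pairs A G \<Longrightarrow> subgroup (fst p) G"
  by (auto simp: char_pairs_def)

definition val :: "'g set \<times> (('g \<Rightarrow> 'a) \<Rightarrow> 'k::field) \<Rightarrow> 'g set \<times> ('g \<Rightarrow> 'a) \<Rightarrow> 'k" where
  "val p u = (if fst p \<subseteq> fst u then snd p (restrict (snd u) (fst p)) else 0)"

lemma val_conj:
  assumes p: "p \<in> char_pairs A G" and u: "u \<in> pairs" and g: "g \<in> carrier G"
  shows "val (act g p) (conj_pair G g u) = val p u"
proof -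
  obtain H \<Phi> where pH: "p = (H, \<Phi>)" by (cases p)
  obtain U \<phi> where uU: "u = (U, \<phi>)" by (cases u)
  have HG: "subgroup H G" and H: "H \<subseteq> carrier G" using p by (auto simp: pH char_pairs_iff subgroup.subset)
  have U: "U \<subseteq> carrier G" and \<phi>: "\<phi> \<in> dual U" using u by (auto simp: uU pairs_def subgroup.subset)
  show ?thesis
  proof (cases "H \<subseteq> U")
    case True
    have r: "restrict \<phi> H \<in> dual H" using dual_restrict[OF \<phi> HG True] .
    then have "conj_hom G g H (restrict \<phi> H) \<in> dual (conj_set G g H)" using conj_hom_dual H g by blast
    then show ?thesis
      using True H U g r conj_hom_inv[OF H g r]
      by (simp add: val_def pH uU conj_set_subset_iff conj_hom_restrict)
  next
    case False
    then show ?thesis using H U g by (simp add: val_def pH uU conj_set_subset_iff)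
  qed
qed

lemma val_conj_right:
  assumes "p \<in> char_pairs A G" "u \<in> pairs" "g \<in> carrier G"
  shows "val p (conj_pair G g u) = val (act (inv g) p) u"
  using val_conj[OF conj_char_pair_in_char_pairs[OF assms(1), of "inv g"] assms(2,3)] assms
  by (simp add: conj_char_pair_inv)

lemma bij_left: "h \<in> carrier G \<Longrightarrow> bij_betw (\<lambda>g. h \<otimes> g) (carrier G) (carrier G)"
  by (rule bij_betwI[of _ _ _ "\<lambda>x. inv h \<otimes> x"]) (auto simp: m_assoc[symmetric])

lemma bij_right: "h \<in> carrier G \<Longrightarrow> bij_betw (\<lambda>g. g \<otimes> h) (carrier G) (carrier G)"
  by (rule bij_betwI[of _ _ _ "\<lambda>x. x \<otimes> inv h"]) (auto simp: m_assoc)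

lemma bij_inv: "bij_betw (\<lambda>g. inv g) (carrier G) (carrier G)"
  by (rule bij_betwI[of _ _ _ "\<lambda>x. inv x"]) auto

text \<open>The value of the species at \<open>p\<close> on the class of \<open>u\<close>, see \<open>species_eq\<close>. Unlike the sum over double cosets,
  it involves no representatives; and since the conjugation has been moved to \<open>p\<close>, everything below
  reduces to statements about \<open>val\<close> for a single \<open>p\<close>.\<close>

definition mark :: "'g set \<times> (('g \<Rightarrow> 'a) \<Rightarrow> 'k::field) \<Rightarrow> 'g set \<times> ('g \<Rightarrow> 'a) \<Rightarrow> 'k" where
  "mark p u = (\<Sum>g\<in>carrier G. val (act g p) u) / of_nat (card (fst u))"

lemma sum_val_conj:
  assumes "p \<in> char_pairs A G" "u \<in> pairs"
  shows "(\<Sum>g\<in>carrier G. val p (conj_pair G g u)) = (\<Sum>g\<in>carrier G. val (act g p) u)"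
  using sum.reindex_bij_betw[OF bij_inv, of "\<lambda>g. val (act g p) u"] assms
  by (simp add: val_conj_right)

lemma mark_conj:
  assumes p: "p \<in> char_pairs A G" and u: "u \<in> pairs" and h: "h \<in> carrier G"
  shows "mark p (conj_pair G h u) = mark p u"
proof -
  have "(\<Sum>g\<in>carrier G. val (act g p) (conj_pair G h u)) =
      (\<Sum>g\<in>carrier G. val (act (inv h \<otimes> g) p) u)"
    using p u h
    by (intro sum.cong refl) (simp add: val_conj_right conj_char_pair_in_char_pairs conj_char_pair_mult)
  also have "\<dots> = (\<Sum>g\<in>carrier G. val (act g p) u)"
    using sum.reindex_bij_betw[OF bij_left[of "inv h"], of "\<lambda>g. val (act g p) u"] h by simp
  moreover have "card (fst (conj_pair G h u)) = card (fst u)"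
    using u h by (cases u) (auto simp: pairs_def card_conj_set subgroup.subset)
  ultimately show ?thesis by (simp add: mark_def)
qed

lemma mark_conj_char_pair:
  assumes p: "p \<in> char_pairs A G" and h: "h \<in> carrier G"
  shows "mark (act h p) u = mark p u"
proof -
  have "(\<Sum>g\<in>carrier G. val (act g (act h p)) u) =
      (\<Sum>g\<in>carrier G. val (act (g \<otimes> h) p) u)"
    by (intro sum.cong refl) (simp add: conj_char_pair_mult[OF p _ h])
  also have "\<dots> = (\<Sum>g\<in>carrier G. val (act g p) u)"
    by (rule sum.reindex_bij_betw[OF bij_right[OF h]])
  finally show ?thesis by (simp add: mark_def)
qed

lemma pair_class_conj:
  assumes "u \<in> pairs" "g \<in> carrier G"
  shows "pair_class G (conj_pair G g u) = pair_class G u"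
proof -
  have "pair_class G (conj_pair G g u) = (\<lambda>h. conj_pair G (h \<otimes> g) u) ` carrier G"
    unfolding pair_class_def using assms by (intro image_cong refl) (simp add: conj_pair_mult)
  also have "\<dots> = (\<lambda>h. conj_pair G h u) ` (\<lambda>h. h \<otimes> g) ` carrier G" by (simp add: image_image)
  finally show ?thesis using bij_right[OF assms(2)] by (simp add: bij_betw_def pair_class_def)
qed

lemma rep_pair_class:
  assumes "u \<in> pairs"
  obtains g where "g \<in> carrier G" "rep (pair_class G u) = conj_pair G g u"
proof -
  have "conj_pair G \<one> u \<in> pair_class G u" by (auto simp: pair_class_def)
  then have "rep (pair_class G u) \<in> pair_class G u" unfolding rep_def by (rule someI)
  then show ?thesis using that by (auto simp: pair_class_def)
qed

lemma pair_classes_eq: "pair_classes A G = pair_class G ` pairs"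
  by (auto simp: pair_classes_def pairs_def)

lemma rep_in_pairs:
  assumes "c \<in> pair_classes A G"
  shows "rep c \<in> pairs" "pair_class G (rep c) = c"
proof -
  obtain u where u: "u \<in> pairs" "c = pair_class G u" using assms by (auto simp: pair_classes_eq)
  then obtain g where "g \<in> carrier G" "rep c = conj_pair G g u" using rep_pair_class by metis
  then show "rep c \<in> pairs" "pair_class G (rep c) = c"
    using u pair_class_conj conj_pair_in_pairs by auto
qed

lemma mark_rep_pair_class:
  assumes "p \<in> char_pairs A G" "u \<in> pairs"
  shows "mark p (rep (pair_class G u)) = mark p u"
  using rep_pair_class[OF assms(2)] mark_conj[OF assms] by metis

section \<open>Species\<close>

abbreviation dcos :: "'g set \<Rightarrow> 'g set \<Rightarrow> 'g \<Rightarrow> 'g set" where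
  "dcos H U g \<equiv> (H #> g) <#> U"

lemma mem_dcos: "x \<in> dcos H U g \<longleftrightarrow> (\<exists>h\<in>H. \<exists>u\<in>U. x = h \<otimes> g \<otimes> u)"
  by (auto simp: set_mult_def r_coset_def)

lemma inv_left_cancel: "x \<in> carrier G \<Longrightarrow> y \<in> carrier G \<Longrightarrow> inv x \<otimes> (x \<otimes> y) = y"
  by (simp add: m_assoc[symmetric])

lemma inv_right_cancel: "x \<in> carrier G \<Longrightarrow> y \<in> carrier G \<Longrightarrow> x \<otimes> (inv x \<otimes> y) = y"
  by (simp add: m_assoc[symmetric])

lemmas group_word_simps = m_assoc inv_mult_group inv_left_cancel inv_right_cancel

lemma dcosI: "h \<in> H \<Longrightarrow> u \<in> U \<Longrightarrow> x = h \<otimes> g \<otimes> u \<Longrightarrow> x \<in> dcos H U g"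
  by (auto simp: mem_dcos)

lemma dcos_eq:
  assumes H: "subgroup H G" and U: "subgroup U G" and g: "g \<in> carrier G" and h: "h \<in> H" and u: "u \<in> U"
  shows "dcos H U (h \<otimes> g \<otimes> u) = dcos H U g"
proof
  note m = subgroup.mem_carrier[OF H] subgroup.mem_carrier[OF U]
  show "dcos H U (h \<otimes> g \<otimes> u) \<subseteq> dcos H U g"
  proof
    fix x assume "x \<in> dcos H U (h \<otimes> g \<otimes> u)"
    then obtain h' u' where *: "h' \<in> H" "u' \<in> U" "x = h' \<otimes> (h \<otimes> g \<otimes> u) \<otimes> u'" unfolding mem_dcos by blast
    show "x \<in> dcos H U g"
    proof (rule dcosI)
      show "h' \<otimes> h \<in> H" "u \<otimes> u' \<in> U" using * h u by (simp_all add: subgroup.m_closed[OF H] subgroup.m_closed[OF U])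
      show "x = h' \<otimes> h \<otimes> g \<otimes> (u \<otimes> u')" using * h u g m by (simp add: m_assoc)
    qed
  qed
  show "dcos H U g \<subseteq> dcos H U (h \<otimes> g \<otimes> u)"
  proof
    fix x assume "x \<in> dcos H U g"
    then obtain h' u' where *: "h' \<in> H" "u' \<in> U" "x = h' \<otimes> g \<otimes> u'" unfolding mem_dcos by blast
    show "x \<in> dcos H U (h \<otimes> g \<otimes> u)"
    proof (rule dcosI)
      show "h' \<otimes> inv h \<in> H" "inv u \<otimes> u' \<in> U"
        using * h u by (simp_all add: subgroup.m_closed[OF H] subgroup.m_closed[OF U]
            subgroup.m_inv_closed[OF H] subgroup.m_inv_closed[OF U])
      show "x = h' \<otimes> inv h \<otimes> (h \<otimes> g \<otimes> u) \<otimes> (inv u \<otimes> u')"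
        using * h u g m by (simp add: group_word_simps)
    qed
  qed
qed

lemma dcos_self: "subgroup H G \<Longrightarrow> subgroup U G \<Longrightarrow> g \<in> carrier G \<Longrightarrow> g \<in> dcos H U g"
  unfolding mem_dcos by (rule bexI[of _ \<one>], rule bexI[of _ \<one>]) (auto simp: subgroup.one_closed)

lemma rep_dcos_carrier:
  assumes H: "subgroup H G" and U: "subgroup U G" and D: "D \<in> double_cosets G H U"
  shows "rep D \<in> carrier G"
proof -
  obtain g0 where g0: "g0 \<in> carrier G" "D = dcos H U g0" using D by (auto simp: double_cosets_def)
  then have "rep D \<in> D" unfolding rep_def using dcos_self[OF H U g0(1)] by (auto intro: someI)
  then show ?thesis
    using g0 subgroup.mem_carrier[OF H] subgroup.mem_carrier[OF U] by (auto simp: mem_dcos)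
qed

text \<open>In a solution of \<open>h g u = x\<close> the factor \<open>h\<close> determines \<open>u\<close>, and the possible \<open>h\<close> form a coset
  of \<open>H \<inter> \<^sup>xU\<close>.\<close>

lemma dcos_fibre_card:
  assumes H: "subgroup H G" and U: "subgroup U G" and h: "h1 \<in> H" and u: "u1 \<in> U" and g: "g \<in> carrier G"
  defines "x \<equiv> h1 \<otimes> g \<otimes> u1"
  shows "card {(h, u). h \<in> H \<and> u \<in> U \<and> h \<otimes> g \<otimes> u = x} = card (H \<inter> conj_set G x U)"
proof -
  have c: "a \<in> carrier G" if "a \<in> H \<or> a \<in> U" for a
    using that subgroup.mem_carrier[OF H] subgroup.mem_carrier[OF U] by auto
  have h1: "h1 \<in> carrier G" and u1: "u1 \<in> carrier G" using h u c by auto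
  have x: "x \<in> carrier G" using h1 u1 g by (simp add: x_def)
  note m = mem_conj_set[OF subgroup.subset[OF U] x]
  have "bij_betw (\<lambda>(h, u). h \<otimes> inv h1) {(h, u). h \<in> H \<and> u \<in> U \<and> h \<otimes> g \<otimes> u = x} (H \<inter> conj_set G x U)"
  proof (rule bij_betwI[of _ _ _ "\<lambda>w. (w \<otimes> h1, u1 \<otimes> cj x (inv w))"])
    show "(\<lambda>(h, u). h \<otimes> inv h1) \<in> {(h, u). h \<in> H \<and> u \<in> U \<and> h \<otimes> g \<otimes> u = x} \<rightarrow> H \<inter> conj_set G x U"
    proof (rule funcsetI)
      fix y assume "y \<in> {(h, u). h \<in> H \<and> u \<in> U \<and> h \<otimes> g \<otimes> u = x}"
      then obtain h' u' where y: "y = (h', u')" and *: "h' \<in> H" "u' \<in> U" "h' \<otimes> g \<otimes> u' = x" by blast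
      then have hu: "h' \<in> carrier G" "u' \<in> carrier G" using c by auto
      have "h' \<otimes> inv h1 \<otimes> x = x \<otimes> (inv u' \<otimes> u1)"
      proof -
        have "h' \<otimes> inv h1 \<otimes> x = h' \<otimes> g \<otimes> u1" using hu h1 u1 g by (simp add: x_def group_word_simps)
        also have "\<dots> = h' \<otimes> g \<otimes> u' \<otimes> (inv u' \<otimes> u1)" using hu u1 g by (simp add: group_word_simps)
        finally show ?thesis by (simp only: *(3))
      qed
      then have "cj x (h' \<otimes> inv h1) = inv u' \<otimes> u1"
        using hu x h1 u1 by (simp add: cj_def m_assoc inv_left_cancel)
      then show "(\<lambda>(h, u). h \<otimes> inv h1) y \<in> H \<inter> conj_set G x U"
        using y * hu h u h1 by (simp add: m subgroup.m_closed[OF H] subgroup.m_inv_closed[OF H]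
            subgroup.m_closed[OF U] subgroup.m_inv_closed[OF U])
    qed
    show "(\<lambda>w. (w \<otimes> h1, u1 \<otimes> cj x (inv w))) \<in> H \<inter> conj_set G x U \<rightarrow> {(h, u). h \<in> H \<and> u \<in> U \<and> h \<otimes> g \<otimes> u = x}"
    proof (rule funcsetI)
      fix w assume w: "w \<in> H \<inter> conj_set G x U"
      have wc: "w \<in> carrier G" "cj x w \<in> U" using w m by auto
      have "cj x (inv w) = inv (cj x w)" using wc x by (simp add: cj_def inv_mult_group m_assoc)
      then have "cj x (inv w) \<in> U" using wc U by (simp add: subgroup.m_inv_closed)
      moreover have "w \<otimes> h1 \<otimes> g \<otimes> (u1 \<otimes> cj x (inv w)) = w \<otimes> x \<otimes> cj x (inv w)"
        using wc h1 u1 g x by (simp add: x_def m_assoc)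
      moreover have "\<dots> = x"
        using wc x by (simp add: cj_def group_word_simps)
      ultimately show "(w \<otimes> h1, u1 \<otimes> cj x (inv w)) \<in> {(h, u). h \<in> H \<and> u \<in> U \<and> h \<otimes> g \<otimes> u = x}"
        using w h u by (simp add: subgroup.m_closed[OF H] subgroup.m_closed[OF U])
    qed
    show "(\<lambda>w. (w \<otimes> h1, u1 \<otimes> cj x (inv w))) ((\<lambda>(h, u). h \<otimes> inv h1) y) = y"
      if "y \<in> {(h, u). h \<in> H \<and> u \<in> U \<and> h \<otimes> g \<otimes> u = x}" for y
    proof -
      obtain h' u' where y: "y = (h', u')" "h' \<in> H" "u' \<in> U" "h' \<otimes> g \<otimes> u' = x" using \<open>y \<in> _\<close> by blast
      then have hu: "h' \<in> carrier G" "u' \<in> carrier G" using c by auto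
      have "u1 \<otimes> cj x (inv (h' \<otimes> inv h1)) = u1 \<otimes> inv x \<otimes> h1 \<otimes> inv h' \<otimes> x"
        using hu h1 u1 x by (simp add: cj_def group_word_simps)
      also have "\<dots> = u1 \<otimes> inv (h1 \<otimes> g \<otimes> u1) \<otimes> h1 \<otimes> inv h' \<otimes> (h' \<otimes> g \<otimes> u')"
        by (simp only: y(4) x_def)
      also have "\<dots> = u'" using hu h1 u1 g by (simp add: group_word_simps)
      finally show ?thesis using hu h1 y(1) by (simp add: m_assoc)
    qed
    show "(\<lambda>(h, u). h \<otimes> inv h1) ((\<lambda>w. (w \<otimes> h1, u1 \<otimes> cj x (inv w))) w) = w" if "w \<in> H \<inter> conj_set G x U" for w
      using that m h1 by (simp add: m_assoc)
  qed
  then show ?thesis by (rule bij_betw_same_card)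
qed

lemma sum_dcos_card:
  assumes H: "subgroup H G" and U: "subgroup U G" and g: "g \<in> carrier G"
  shows "(\<Sum>x | x \<in> carrier G \<and> dcos H U x = dcos H U g. card (H \<inter> conj_set G x U)) = card H * card U"
proof -
  have c: "a \<in> carrier G" if "a \<in> H \<or> a \<in> U" for a
    using that subgroup.mem_carrier[OF H] subgroup.mem_carrier[OF U] by auto
  let ?D = "{x. x \<in> carrier G \<and> dcos H U x = dcos H U g}"
  let ?f = "\<lambda>(h, u). h \<otimes> g \<otimes> u"
  have img: "?f ` (H \<times> U) \<subseteq> ?D" using c g dcos_eq[OF H U g] by auto
  have "card H * card U = (\<Sum>y\<in>H \<times> U. 1)" by (simp add: card_cartesian_product)
  also have "\<dots> = (\<Sum>x\<in>?D. \<Sum>y\<in>{y\<in>H \<times> U. ?f y = x}. 1)"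
    by (rule sum.group[symmetric]) (use img subgroup_finite H U in auto)
  also have "\<dots> = (\<Sum>x\<in>?D. card (H \<inter> conj_set G x U))"
  proof (rule sum.cong[OF refl])
    fix x assume x: "x \<in> ?D"
    then have "x \<in> dcos H U g" using dcos_self[OF H U, of x] by auto
    then obtain h1 u1 where *: "h1 \<in> H" "u1 \<in> U" "x = h1 \<otimes> g \<otimes> u1" using mem_dcos by blast
    have "{y \<in> H \<times> U. ?f y = x} = {(h, u). h \<in> H \<and> u \<in> U \<and> h \<otimes> g \<otimes> u = x}" by auto
    then show "(\<Sum>y\<in>{y \<in> H \<times> U. ?f y = x}. 1) = card (H \<inter> conj_set G x U)"
      using dcos_fibre_card[OF H U *(1,2) g] *(3) by simp
  qed
  finally show ?thesis by simp
qed

text \<open>A sum over double cosets becomes a sum over the group: \<open>H g U\<close> has \<open>|H| |U| / |H \<inter> \<^sup>gU|\<close>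
  elements, so the weights \<open>|H \<inter> \<^sup>gU|\<close> add up to \<open>|H| |U|\<close> on it.\<close>

lemma sum_double_cosets:
  fixes F :: "'g \<Rightarrow> 'k::field_char_0"
  assumes H: "subgroup H G" and U: "subgroup U G"
    and F: "\<And>h g u. h \<in> H \<Longrightarrow> g \<in> carrier G \<Longrightarrow> u \<in> U \<Longrightarrow> F (h \<otimes> g \<otimes> u) = F g"
  shows "(\<Sum>D\<in>double_cosets G H U. F (rep D)) =
    (\<Sum>g\<in>carrier G. F g * of_nat (card (H \<inter> conj_set G g U))) / (of_nat (card H) * of_nat (card U))"
proof -
  have "(\<Sum>g\<in>carrier G. F g * of_nat (card (H \<inter> conj_set G g U))) =
      (\<Sum>D\<in>double_cosets G H U. \<Sum>g\<in>{g \<in> carrier G. dcos H U g = D}. F g * of_nat (card (H \<inter> conj_set G g U)))"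
    by (rule sum.group[symmetric]) (auto simp: double_cosets_def)
  also have "\<dots> = (\<Sum>D\<in>double_cosets G H U. F (rep D) * (of_nat (card H) * of_nat (card U)))"
  proof (rule sum.cong[OF refl])
    fix D assume "D \<in> double_cosets G H U"
    then obtain g0 where g0: "g0 \<in> carrier G" "D = dcos H U g0" by (auto simp: double_cosets_def)
    then have "rep D \<in> D" unfolding rep_def using dcos_self[OF H U g0(1)] by (auto intro: someI)
    have Fc: "F g = F g0" if "g \<in> D" for g
    proof -
      obtain h u where "h \<in> H" "u \<in> U" "g = h \<otimes> g0 \<otimes> u" using \<open>g \<in> D\<close> g0 mem_dcos by blast
      then show ?thesis using F g0 by simp
    qed
    have "(\<Sum>g\<in>{g \<in> carrier G. dcos H U g = D}. F g * of_nat (card (H \<inter> conj_set G g U))) =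
        (\<Sum>g\<in>{g \<in> carrier G. dcos H U g = D}. F (rep D) * of_nat (card (H \<inter> conj_set G g U)))"
    proof (rule sum.cong[OF refl])
      fix g assume "g \<in> {g \<in> carrier G. dcos H U g = D}"
      then have "g \<in> D" using dcos_self[OF H U, of g] by auto
      then show "F g * of_nat (card (H \<inter> conj_set G g U)) = F (rep D) * of_nat (card (H \<inter> conj_set G g U))"
        using Fc \<open>rep D \<in> D\<close> by metis
    qed
    also have "\<dots> = F (rep D) * of_nat (\<Sum>g | g \<in> carrier G \<and> dcos H U g = D. card (H \<inter> conj_set G g U))"
      by (simp add: sum_distrib_left)
    finally show "(\<Sum>g\<in>{g \<in> carrier G. dcos H U g = D}. F g * of_nat (card (H \<inter> conj_set G g U))) =
        F (rep D) * (of_nat (card H) * of_nat (card U))"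
      unfolding g0(2) sum_dcos_card[OF H U g0(1)] by simp
  qed
  finally show ?thesis
    using subgroup_card_pos[OF H] subgroup_card_pos[OF U] by (simp add: sum_distrib_right[symmetric])
qed

lemma fibered_group_sub: "subgroup H G \<Longrightarrow> fibered_group A (G\<lparr>carrier := H\<rparr>)"
  using A.comm_group_axioms group_sub[of H] subgroup_finite[of H]
  by (simp add: fibered_group_def fibered_group_axioms_def)

text \<open>The class of \<open>(H, \<psi>)\<close> under the action of \<open>H\<close> is a singleton, while the class of a pair with
  proper first component consists of such pairs; so the chosen representative does not matter.\<close>

lemma fib_proj_class:
  assumes H: "subgroup H G" and W: "subgroup W G" "W \<subseteq> H" and \<psi>: "\<psi> \<in> dual W"
  shows "(let (U, \<phi>) = rep (pair_class (G\<lparr>carrier := H\<rparr>) (W, \<psi>)) in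
           if U = H then Poly_Mapping.single \<phi> (1 :: 'k::field) else 0) =
         (if W = H then Poly_Mapping.single \<psi> 1 else 0)"
proof -
  interpret K: fibered_group A "G\<lparr>carrier := H\<rparr>" by (rule fibered_group_sub[OF H])
  have P: "(W, \<psi>) \<in> K.pairs" using subgroup_incl[OF W(1) H W(2)] \<psi> by (simp add: K.pairs_def)
  obtain h where h: "h \<in> carrier (G\<lparr>carrier := H\<rparr>)"
    "rep (pair_class (G\<lparr>carrier := H\<rparr>) (W, \<psi>)) = conj_pair (G\<lparr>carrier := H\<rparr>) h (W, \<psi>)"
    by (rule K.rep_pair_class[OF P])
  show ?thesis
  proof (cases "W = H")
    case True
    then have "conj_pair (G\<lparr>carrier := H\<rparr>) h (W, \<psi>) = (W, \<psi>)"
      using h(1) by (intro K.conj_pair_self[OF P]) simp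
    then show ?thesis using True h(2) by simp
  next
    case False
    then have lt: "card W < card H" using W(2) subgroup_finite[OF H] by (intro psubset_card_mono) auto
    have "card (conj_set (G\<lparr>carrier := H\<rparr>) h W) = card W"
      by (rule K.card_conj_set) (use W(2) h(1) in simp_all)
    then have "conj_set (G\<lparr>carrier := H\<rparr>) h W \<noteq> H" using lt by (metis less_irrefl)
    then show ?thesis unfolding h(2) using False by simp
  qed
qed

lemma val_translate:
  assumes p: "p \<in> char_pairs A G" and u: "u \<in> pairs" and "h \<in> fst p" "g \<in> carrier G" "v \<in> fst u"
  shows "val p (conj_pair G (h \<otimes> g \<otimes> v) u) = val p (conj_pair G g u)"
proof -
  have sub: "fst p \<subseteq> carrier G" "fst u \<subseteq> carrier G" "subgroup (fst p) G"
    using char_pairs_subgroup[OF p] pairs_subgroup[OF u] by (simp_all add: subgroup.subset)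
  have hv: "h \<in> carrier G" "v \<in> carrier G" using assms sub by auto
  have inv: "inv h \<in> fst p" using sub assms by (simp add: subgroup.m_inv_closed)
  have "conj_pair G (h \<otimes> g \<otimes> v) u = conj_pair G h (conj_pair G g (conj_pair G v u))"
    using hv assms by (simp add: conj_pair_mult conj_pair_in_pairs)
  also have "conj_pair G v u = u" using conj_pair_self[OF u] assms by simp
  finally show ?thesis
    using val_conj_right[OF p conj_pair_in_pairs[OF u \<open>g \<in> carrier G\<close>] hv(1)]
      conj_char_pair_self[of "fst p" "snd p" "inv h"] p inv by simp
qed

text \<open>A double coset contributes only if \<open>H \<subseteq> \<^sup>gU\<close>, and then the weight \<open>|H \<inter> \<^sup>gU|\<close> equals \<open>|H|\<close>.\<close>

lemma species_basis:
  fixes p :: "'g set \<times> (('g \<Rightarrow> 'a) \<Rightarrow> 'k::field_char_0)"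
  assumes p: "p \<in> char_pairs A G" and u: "u \<in> pairs"
  shows "(\<Sum>D\<in>double_cosets G (fst p) (fst u). val p (conj_pair G (rep D) u)) = mark p u"
proof -
  have sub: "subgroup (fst p) G" "subgroup (fst u) G" using char_pairs_subgroup[OF p] pairs_subgroup[OF u] by simp_all
  have *: "val p (conj_pair G g u) * of_nat (card (fst p \<inter> conj_set G g (fst u))) =
      val p (conj_pair G g u) * of_nat (card (fst p))" for g
    by (cases u) (auto simp: val_def Int_absorb2)
  have "(\<Sum>D\<in>double_cosets G (fst p) (fst u). val p (conj_pair G (rep D) u)) =
      (\<Sum>g\<in>carrier G. val p (conj_pair G g u) * of_nat (card (fst p \<inter> conj_set G g (fst u)))) /
      (of_nat (card (fst p)) * of_nat (card (fst u)))"
    by (rule sum_double_cosets[OF sub]) (rule val_translate[OF p u])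
  then show ?thesis
    unfolding *
    using subgroup_card_pos[OF sub(1)] subgroup_card_pos[OF sub(2)]
    by (simp add: sum_distrib_right[symmetric] sum_val_conj[OF p u] mark_def)
qed

lemma species_eq:
  fixes p :: "'g set \<times> (('g \<Rightarrow> 'a) \<Rightarrow> 'k::field_char_0)"
  assumes p: "p \<in> char_pairs A G" and x: "x \<in> fib_burnside A G"
  shows "species G p x = char_ext (\<lambda>c. mark p (rep c)) x"
proof -
  obtain H \<Phi> where pH: "p = (H, \<Phi>)" by (cases p)
  have H: "subgroup H G" using p by (auto simp: pH char_pairs_iff)
  define P :: "('g set \<times> ('g \<Rightarrow> 'a)) set \<Rightarrow> (('g \<Rightarrow> 'a) \<Rightarrow>\<^sub>0 'k)"
    where "P d = (let (U, \<phi>) = rep d in if U = H then Poly_Mapping.single \<phi> 1 else 0)" for d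
  have "species G p x = char_ext (\<lambda>c. char_ext (\<lambda>d. char_ext \<Phi> (P d)) (let (U, \<phi>) = rep c in
     \<Sum>D\<in>double_cosets G H U.
       let g = rep D; W = H \<inter> conj_set G g U in
       Poly_Mapping.single (pair_class (G\<lparr>carrier := H\<rparr>) (W, restrict (conj_hom G g U \<phi>) W)) 1)) x"
    by (simp add: species_def pH fib_proj_def fib_res_def char_ext_lin_ext P_def)
  also have "\<dots> = char_ext (\<lambda>c. mark p (rep c)) x"
  proof (rule char_ext_cong)
    fix c assume "c \<in> Poly_Mapping.keys x"
    then have c: "rep c \<in> pairs" using x rep_in_pairs(1) by (auto simp: fib_burnside_def)
    obtain U \<phi> where U\<phi>: "rep c = (U, \<phi>)" by (cases "rep c")
    have U: "subgroup U G" "U \<subseteq> carrier G" and \<phi>: "\<phi> \<in> dual U"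
      using c by (auto simp: U\<phi> pairs_def subgroup.subset)
    have "char_ext (\<lambda>d. char_ext \<Phi> (P d)) (\<Sum>D\<in>double_cosets G H U.
       let g = rep D; W = H \<inter> conj_set G g U in
       Poly_Mapping.single (pair_class (G\<lparr>carrier := H\<rparr>) (W, restrict (conj_hom G g U \<phi>) W)) 1)
      = (\<Sum>D\<in>double_cosets G H U. val p (conj_pair G (rep D) (U, \<phi>)))"
      unfolding char_ext_sum
    proof (rule sum.cong[OF refl])
      fix D assume "D \<in> double_cosets G H U"
      then have g: "rep D \<in> carrier G" by (rule rep_dcos_carrier[OF H U(1)])
      define W where "W = H \<inter> conj_set G (rep D) U"
      have W: "subgroup W G" "W \<subseteq> H" "W \<subseteq> conj_set G (rep D) U"
        using subgroups_Inter_pair[OF H subgroup_conj_set[OF U(1) g]] by (auto simp: W_def)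
      have "restrict (conj_hom G (rep D) U \<phi>) W \<in> dual W"
        by (rule dual_restrict[OF conj_hom_dual[OF U(2) g \<phi>] W(1,3)])
      from fib_proj_class[OF H W(1,2) this]
      have "P (pair_class (G\<lparr>carrier := H\<rparr>) (W, restrict (conj_hom G (rep D) U \<phi>) W)) =
          (if W = H then Poly_Mapping.single (restrict (conj_hom G (rep D) U \<phi>) W) 1 else 0)"
        unfolding P_def .
      then have "char_ext \<Phi> (P (pair_class (G\<lparr>carrier := H\<rparr>) (W, restrict (conj_hom G (rep D) U \<phi>) W))) =
          val p (conj_pair G (rep D) (U, \<phi>))"
        by (auto simp: val_def pH W_def)
      then show "char_ext (\<lambda>d. char_ext \<Phi> (P d)) (let g = rep D; W = H \<inter> conj_set G g U in
         Poly_Mapping.single (pair_class (G\<lparr>carrier := H\<rparr>) (W, restrict (conj_hom G g U \<phi>) W)) 1) =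
         val p (conj_pair G (rep D) (U, \<phi>))"
        by (simp add: W_def Let_def)
    qed
    also have "\<dots> = mark p (rep c)"
      using species_basis[OF p c] by (simp add: pH U\<phi>)
    finally show "char_ext (\<lambda>d. char_ext \<Phi> (P d)) (let (U, \<phi>) = rep c in
     \<Sum>D\<in>double_cosets G H U.
       let g = rep D; W = H \<inter> conj_set G g U in
       Poly_Mapping.single (pair_class (G\<lparr>carrier := H\<rparr>) (W, restrict (conj_hom G g U \<phi>) W)) 1) = mark p (rep c)"
      by (simp add: U\<phi>)
  qed
  finally show ?thesis .
qed

lemma species_conj_char_pair:
  fixes p :: "'g set \<times> (('g \<Rightarrow> 'a) \<Rightarrow> 'k::field_char_0)"
  assumes p: "p \<in> char_pairs A G" and h: "h \<in> carrier G" and x: "x \<in> fib_burnside A G"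
  shows "species G (act h p) x = species G p x"
  using species_eq[OF p x] species_eq[OF conj_char_pair_in_char_pairs[OF p h] x]
  by (simp add: mark_conj_char_pair[OF p h])

section \<open>Multiplicativity of species\<close>

definition prod_pair ::
  "'g set \<times> ('g \<Rightarrow> 'a) \<Rightarrow> 'g set \<times> ('g \<Rightarrow> 'a) \<Rightarrow> 'g set \<times> ('g \<Rightarrow> 'a)" where
  "prod_pair u v = (let W = fst u \<inter> fst v in
     (W, restrict (snd u) W \<otimes>\<^bsub>dgroup W\<^esub> restrict (snd v) W))"

lemma prod_pair_in_pairs:
  assumes "u \<in> pairs" "v \<in> pairs" shows "prod_pair u v \<in> pairs"
proof -
  obtain U \<phi> V \<psi> where uv: "u = (U, \<phi>)" "v = (V, \<psi>)" by (cases u; cases v; blast)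
  have W: "subgroup (U \<inter> V) G" using assms subgroups_Inter_pair by (auto simp: uv pairs_def)
  have "restrict \<phi> (U \<inter> V) \<in> dual (U \<inter> V)" "restrict \<psi> (U \<inter> V) \<in> dual (U \<inter> V)"
    using assms W dual_restrict[of _ _ "U \<inter> V"] by (auto simp: uv pairs_def)
  then show ?thesis using W dual_mult_closed[OF W] by (simp add: prod_pair_def uv pairs_def Let_def del: hom_group_simps)
qed

lemma conj_prod_pair:
  assumes "u \<in> pairs" "v \<in> pairs" "g \<in> carrier G"
  shows "conj_pair G g (prod_pair u v) = prod_pair (conj_pair G g u) (conj_pair G g v)"
proof -
  obtain U \<phi> V \<psi> where uv: "u = (U, \<phi>)" "v = (V, \<psi>)" by (cases u; cases v; blast)
  have W: "subgroup (U \<inter> V) G" "U \<inter> V \<subseteq> carrier G" "U \<subseteq> carrier G" "V \<subseteq> carrier G"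
    using assms subgroups_Inter_pair by (auto simp: uv pairs_def subgroup.subset)
  have r: "restrict \<phi> (U \<inter> V) \<in> dual (U \<inter> V)" "restrict \<psi> (U \<inter> V) \<in> dual (U \<inter> V)"
    using assms W dual_restrict[of _ _ "U \<inter> V"] by (auto simp: uv pairs_def)
  have i: "conj_set G g (U \<inter> V) = conj_set G g U \<inter> conj_set G g V"
    using W assms by (auto simp: mem_conj_set)
  show ?thesis
    unfolding prod_pair_def uv Let_def fst_conv snd_conv conj_pair.simps
      conj_hom_dual_mult[OF W(2) assms(3) r] i[symmetric]
      conj_hom_restrict[OF Int_lower1 W(3) assms(3)] conj_hom_restrict[OF Int_lower2 W(4) assms(3)] ..
qed

lemma val_prod_pair:
  assumes p: "p \<in> char_pairs A G" and u: "u \<in> pairs" and v: "v \<in> pairs"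
  shows "val p (prod_pair u v) = val p u * val p v"
proof (cases "fst p \<subseteq> fst u \<and> fst p \<subseteq> fst v")
  case True
  obtain H \<Phi> U \<phi> V \<psi> where uv: "p = (H, \<Phi>)" "u = (U, \<phi>)" "v = (V, \<psi>)" by (cases p; cases u; cases v; blast)
  have H: "subgroup H G" and \<Phi>: "\<Phi> \<in> chars H" using p by (auto simp: uv char_pairs_iff)
  have "restrict \<phi> H \<in> dual H" "restrict \<psi> H \<in> dual H"
    using u v True H dual_restrict[of _ _ H] by (auto simp: uv pairs_def)
  note * = charsD(3)[OF \<Phi> this]
  have "restrict (restrict \<phi> (U \<inter> V) \<otimes>\<^bsub>dgroup (U \<inter> V)\<^esub> restrict \<psi> (U \<inter> V)) H =
      restrict \<phi> H \<otimes>\<^bsub>dgroup H\<^esub> restrict \<psi> H"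
    using True by (auto simp: uv fun_eq_iff)
  then show ?thesis using * True by (simp add: uv val_def prod_pair_def Let_def del: hom_group_simps)
qed (auto simp: val_def prod_pair_def Let_def)

text \<open>Converted to a sum over the group, the Mackey sum and the average over conjugates form a double
  sum over \<open>g\<close> and \<open>a\<close>. By multiplicativity of \<open>val\<close> its terms are products of a factor depending on \<open>a\<close> and one
  depending on \<open>g\<inverse>a\<close>, so it splits.\<close>

lemma mark_prod_pair_sum:
  fixes p :: "'g set \<times> (('g \<Rightarrow> 'a) \<Rightarrow> 'k::field_char_0)"
  assumes p: "p \<in> char_pairs A G" and u: "u \<in> pairs" and v: "v \<in> pairs"
  shows "(\<Sum>D\<in>double_cosets G (fst u) (fst v). mark p (prod_pair u (conj_pair G (rep D) v))) = mark p u * mark p v"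
proof -
  have sub: "subgroup (fst u) G" "subgroup (fst v) G" using pairs_subgroup[OF u] pairs_subgroup[OF v] by simp_all
  note cin = conj_char_pair_in_char_pairs[OF p]
  have inv: "mark p (prod_pair u (conj_pair G (a \<otimes> g \<otimes> b) v)) = mark p (prod_pair u (conj_pair G g v))"
    if a: "a \<in> fst u" and g: "g \<in> carrier G" and b: "b \<in> fst v" for a g b
  proof -
    have ab: "a \<in> carrier G" "b \<in> carrier G" using subgroup.mem_carrier[OF sub(1) a] subgroup.mem_carrier[OF sub(2) b] by auto
    have gv: "conj_pair G g v \<in> pairs" using v g by (rule conj_pair_in_pairs)
    have "conj_pair G (a \<otimes> g \<otimes> b) v = conj_pair G a (conj_pair G g (conj_pair G b v))"
      using ab g v by (simp add: conj_pair_mult conj_pair_in_pairs)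
    also have "conj_pair G b v = v" by (rule conj_pair_self[OF v b])
    finally have "prod_pair u (conj_pair G (a \<otimes> g \<otimes> b) v) = conj_pair G a (prod_pair u (conj_pair G g v))"
      using conj_prod_pair[OF u gv ab(1)] conj_pair_self[OF u a] by simp
    then show ?thesis using mark_conj[OF p prod_pair_in_pairs[OF u gv] ab(1)] by simp
  qed
  have summand: "mark p (prod_pair u (conj_pair G g v)) * of_nat (card (fst u \<inter> conj_set G g (fst v))) =
      (\<Sum>a\<in>carrier G. val (act a p) u * val (act (inv g \<otimes> a) p) v)"
    if g: "g \<in> carrier G" for g
  proof -
    have gv: "conj_pair G g v \<in> pairs" using v g by (rule conj_pair_in_pairs)
    have W: "fst (prod_pair u (conj_pair G g v)) = fst u \<inter> conj_set G g (fst v)"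
      by (cases v) (simp add: prod_pair_def Let_def)
    have "subgroup (fst u \<inter> conj_set G g (fst v)) G"
      using prod_pair_in_pairs[OF u gv] W by (auto simp: pairs_def)
    then have "card (fst u \<inter> conj_set G g (fst v)) > 0" by (rule subgroup_card_pos)
    then have "mark p (prod_pair u (conj_pair G g v)) * of_nat (card (fst u \<inter> conj_set G g (fst v))) =
        (\<Sum>a\<in>carrier G. val (act a p) (prod_pair u (conj_pair G g v)))"
      by (simp add: mark_def W)
    also have "\<dots> = (\<Sum>a\<in>carrier G. val (act a p) u * val (act (inv g \<otimes> a) p) v)"
      using g by (intro sum.cong refl)
        (simp add: val_prod_pair[OF cin u gv] val_conj_right[OF cin v] conj_char_pair_mult[OF p])
    finally show ?thesis .
  qed
  have "(\<Sum>g\<in>carrier G. \<Sum>a\<in>carrier G. val (act a p) u * val (act (inv g \<otimes> a) p) v) =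
      (\<Sum>a\<in>carrier G. val (act a p) u * (\<Sum>g\<in>carrier G. val (act (inv g \<otimes> a) p) v))"
    by (subst sum.swap) (simp add: sum_distrib_left)
  also have "\<dots> = (\<Sum>a\<in>carrier G. val (act a p) u * (\<Sum>b\<in>carrier G. val (act b p) v))"
  proof (rule sum.cong[OF refl])
    fix a assume a: "a \<in> carrier G"
    have "bij_betw (\<lambda>g. inv g \<otimes> a) (carrier G) (carrier G)"
      using bij_betw_trans[OF bij_inv bij_right[OF a]] by (simp add: comp_def)
    from sum.reindex_bij_betw[OF this, of "\<lambda>b. val (act b p) v"]
    show "val (act a p) u * (\<Sum>g\<in>carrier G. val (act (inv g \<otimes> a) p) v) =
       val (act a p) u * (\<Sum>b\<in>carrier G. val (act b p) v)" by simp
  qed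
  finally have "(\<Sum>g\<in>carrier G. mark p (prod_pair u (conj_pair G g v)) * of_nat (card (fst u \<inter> conj_set G g (fst v)))) =
      (\<Sum>a\<in>carrier G. val (act a p) u) * (\<Sum>b\<in>carrier G. val (act b p) v)"
    using summand by (simp add: sum_distrib_right)
  moreover have "(\<Sum>D\<in>double_cosets G (fst u) (fst v). mark p (prod_pair u (conj_pair G (rep D) v))) =
      (\<Sum>g\<in>carrier G. mark p (prod_pair u (conj_pair G g v)) * of_nat (card (fst u \<inter> conj_set G g (fst v)))) /
      (of_nat (card (fst u)) * of_nat (card (fst v)))"
    by (rule sum_double_cosets[OF sub]) (rule inv)
  ultimately show ?thesis by (simp add: mark_def)
qed

lemma fib_mult_basis_eq:
  "fib_mult_basis A G c d = (\<Sum>D\<in>double_cosets G (fst (rep c)) (fst (rep d)).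
     Poly_Mapping.single (pair_class G (prod_pair (rep c) (conj_pair G (rep D) (rep d)))) 1)"
  by (cases "rep c"; cases "rep d") (simp add: fib_mult_basis_def prod_pair_def Let_def)

lemma single_pair_class_in_fib_burnside:
  "u \<in> pairs \<Longrightarrow> Poly_Mapping.keys (Poly_Mapping.single (pair_class G u) a) \<subseteq> pair_classes A G"
  by (auto simp: pair_classes_eq)

lemma fib_mult_closed:
  assumes x: "x \<in> fib_burnside A G" and y: "y \<in> fib_burnside A G"
  shows "fib_mult A G x y \<in> fib_burnside A G"
  unfolding fib_burnside_def fib_mult_def mem_Collect_eq
proof (intro keys_lin_ext_subset)
  fix c d assume "c \<in> Poly_Mapping.keys x" "d \<in> Poly_Mapping.keys y"
  then have cd: "rep c \<in> pairs" "rep d \<in> pairs" using x y rep_in_pairs(1) by (auto simp: fib_burnside_def)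
  then have sub: "subgroup (fst (rep c)) G" "subgroup (fst (rep d)) G" by (simp_all add: pairs_subgroup)
  show "Poly_Mapping.keys (fib_mult_basis A G c d) \<subseteq> pair_classes A G"
    unfolding fib_mult_basis_eq
    by (intro keys_sum_subset single_pair_class_in_fib_burnside prod_pair_in_pairs conj_pair_in_pairs cd
          rep_dcos_carrier[OF sub])
qed

text \<open>Together with \<open>species_separate\<close> this reduces the idempotency of an element to its species being
  \<open>0\<close> or \<open>1\<close>.\<close>

lemma species_mult:
  fixes p :: "'g set \<times> (('g \<Rightarrow> 'a) \<Rightarrow> 'k::field_char_0)"
  assumes p: "p \<in> char_pairs A G" and x: "x \<in> fib_burnside A G" and y: "y \<in> fib_burnside A G"
  shows "species G p (fib_mult A G x y) = species G p x * species G p y"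
proof -
  define F where "F c = mark p (rep c)" for c
  have basis: "char_ext F (fib_mult_basis A G c d) = F c * F d"
    if "c \<in> Poly_Mapping.keys x" "d \<in> Poly_Mapping.keys y" for c d
  proof -
    have cd: "rep c \<in> pairs" "rep d \<in> pairs" using that x y rep_in_pairs(1) by (auto simp: fib_burnside_def)
    then have sub: "subgroup (fst (rep c)) G" "subgroup (fst (rep d)) G" by (simp_all add: pairs_subgroup)
    have "char_ext F (fib_mult_basis A G c d) =
       (\<Sum>D\<in>double_cosets G (fst (rep c)) (fst (rep d)). mark p (prod_pair (rep c) (conj_pair G (rep D) (rep d))))"
      unfolding fib_mult_basis_eq char_ext_sum
    proof (rule sum.cong[OF refl])
      fix D assume "D \<in> double_cosets G (fst (rep c)) (fst (rep d))"
      then have "prod_pair (rep c) (conj_pair G (rep D) (rep d)) \<in> pairs"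
        using rep_dcos_carrier[OF sub] cd by (intro prod_pair_in_pairs conj_pair_in_pairs)
      then show "char_ext F (Poly_Mapping.single (pair_class G (prod_pair (rep c) (conj_pair G (rep D) (rep d)))) 1) =
          mark p (prod_pair (rep c) (conj_pair G (rep D) (rep d)))"
        using mark_rep_pair_class[OF p] by (simp add: F_def)
    qed
    then show ?thesis using mark_prod_pair_sum[OF p cd] by (simp add: F_def)
  qed
  have "species G p (fib_mult A G x y) = char_ext F (fib_mult A G x y)"
    using species_eq[OF p fib_mult_closed[OF x y]] by (simp add: F_def[abs_def])
  also have "\<dots> = char_ext (\<lambda>c. char_ext (\<lambda>d. char_ext F (fib_mult_basis A G c d)) y) x"
    by (simp add: fib_mult_def char_ext_lin_ext)
  also have "\<dots> = char_ext (\<lambda>c. char_ext (\<lambda>d. F c * F d) y) x"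
    by (intro char_ext_cong) (use basis in auto)
  also have "\<dots> = char_ext F x * char_ext F y"
    unfolding char_ext_def sum_product by (simp add: sum_distrib_left mult_ac)
  finally show ?thesis using species_eq[OF p x] species_eq[OF p y] by (simp add: F_def[abs_def])
qed

end

section \<open>Moebius inversion\<close>

lemma moebius_self [simp]: "moebius Q x x = 1"
  by (simp add: moebius.simps)

lemma moebius_psubset:
  "x \<subset> y \<Longrightarrow> finite y \<Longrightarrow> moebius Q x y = - (\<Sum>z | z \<in> Q \<and> x \<subseteq> z \<and> z \<subset> y. moebius Q x z)"
  by (subst moebius.simps) auto

lemma moebius_sum_upper:
  assumes "finite Q" "\<And>z. z \<in> Q \<Longrightarrow> finite z" "x \<in> Q" "y \<in> Q" "x \<subseteq> y"
  shows "(\<Sum>z | z \<in> Q \<and> x \<subseteq> z \<and> z \<subseteq> y. moebius Q x z) = (if x = y then 1 else 0)"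
proof (cases "x = y")
  case True
  then have "{z. z \<in> Q \<and> x \<subseteq> z \<and> z \<subseteq> y} = {y}" using assms by auto
  then show ?thesis using True by simp
next
  case False
  have "{z. z \<in> Q \<and> x \<subseteq> z \<and> z \<subseteq> y} = insert y {z. z \<in> Q \<and> x \<subseteq> z \<and> z \<subset> y}" using assms by auto
  then show ?thesis using False assms moebius_psubset[of x y Q] by (simp add: psubset_eq)
qed

text \<open>The recursion that defines \<open>\<mu>\<close> gives the sum over the upper argument. To sum over the lower one,
  evaluate the sum of \<open>\<mu>(x,u) \<mu>(v,y)\<close> over \<open>x \<subseteq> u \<subseteq> v \<subseteq> y\<close> in two ways; by induction
  the sum over \<open>v\<close> vanishes for \<open>u\<close> strictly between \<open>x\<close> and \<open>y\<close>.\<close>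

lemma moebius_sum_lower:
  assumes Q: "finite Q" "\<And>z. z \<in> Q \<Longrightarrow> finite z" and y: "y \<in> Q" and "x \<in> Q" "x \<subseteq> y"
  shows "(\<Sum>z | z \<in> Q \<and> x \<subseteq> z \<and> z \<subseteq> y. moebius Q z y) = (if x = y then 1 else 0)"
  using assms(4,5)
proof (induction "card y - card x" arbitrary: x rule: less_induct)
  case less
  note x = less.prems
  define f where "f u = (\<Sum>v | v \<in> Q \<and> u \<subseteq> v \<and> v \<subseteq> y. moebius Q v y)" for u
  define I where "I = {z. z \<in> Q \<and> x \<subseteq> z \<and> z \<subseteq> y}"
  have fI: "finite I" using Q(1) by (simp add: I_def)
  have xI: "x \<in> I" using x by (simp add: I_def)
  have IH: "f u = (if u = y then 1 else 0)" if "u \<in> I" "u \<noteq> x" for u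
  proof -
    have u: "u \<in> Q" "x \<subset> u" "u \<subseteq> y" using that by (auto simp: I_def)
    then have "card x < card u" using psubset_card_mono[OF Q(2)] by blast
    moreover have "card u \<le> card y" using u card_mono[OF Q(2)[OF y]] by blast
    ultimately show ?thesis unfolding f_def using less.hyps[OF _ u(1,3)] by simp
  qed
  have "(\<Sum>u\<in>I. moebius Q x u * f u) = (\<Sum>u\<in>I. \<Sum>v\<in>I. if u \<subseteq> v then moebius Q x u * moebius Q v y else 0)"
  proof (rule sum.cong[OF refl])
    fix u assume u: "u \<in> I"
    then have "{v. v \<in> Q \<and> u \<subseteq> v \<and> v \<subseteq> y} = {v \<in> I. u \<subseteq> v}" by (auto simp: I_def)
    then show "moebius Q x u * f u = (\<Sum>v\<in>I. if u \<subseteq> v then moebius Q x u * moebius Q v y else 0)"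
      using fI by (simp add: f_def sum.inter_filter sum_distrib_left if_distrib[of "(*) _"] cong: if_cong)
  qed
  also have "\<dots> = (\<Sum>v\<in>I. \<Sum>u\<in>I. if u \<subseteq> v then moebius Q x u * moebius Q v y else 0)"
    by (rule sum.swap)
  also have "\<dots> = (\<Sum>v\<in>I. if x = v then moebius Q v y else 0)"
  proof (rule sum.cong[OF refl])
    fix v assume v: "v \<in> I"
    then have "{u \<in> I. u \<subseteq> v} = {u. u \<in> Q \<and> x \<subseteq> u \<and> u \<subseteq> v}" by (auto simp: I_def)
    then have "(\<Sum>u\<in>I. if u \<subseteq> v then moebius Q x u * moebius Q v y else 0) =
        (\<Sum>u | u \<in> Q \<and> x \<subseteq> u \<and> u \<subseteq> v. moebius Q x u) * moebius Q v y"
      using fI by (simp add: sum.inter_filter[symmetric] sum_distrib_right)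
    then show "(\<Sum>u\<in>I. if u \<subseteq> v then moebius Q x u * moebius Q v y else 0) = (if x = v then moebius Q v y else 0)"
      using moebius_sum_upper[OF Q x(1), of v] v by (simp add: I_def)
  qed
  also have "\<dots> = moebius Q x y" using fI xI by simp
  finally have eq: "(\<Sum>u\<in>I. moebius Q x u * f u) = moebius Q x y" .
  have "(\<Sum>u\<in>I. moebius Q x u * f u) = f x + (\<Sum>u\<in>I - {x}. moebius Q x u * f u)"
    using sum.remove[OF fI xI, of "\<lambda>u. moebius Q x u * f u"] by simp
  also have "(\<Sum>u\<in>I - {x}. moebius Q x u * f u) = (\<Sum>u\<in>I - {x}. if u = y then moebius Q x u else 0)"
    by (rule sum.cong[OF refl]) (simp add: IH)
  also have "\<dots> = (if x = y then 0 else moebius Q x y)"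
    using fI x y by (auto simp: I_def)
  finally have "f x = (if x = y then 1 else 0)" using eq by (auto split: if_splits)
  then show ?case by (simp add: f_def)
qed

text \<open>Weisner's theorem, with weights depending only on the intersection with \<open>Y\<close>. Let \<open>w c\<close> be the
  sum of \<open>\<mu>(z,y)\<close> over all \<open>z\<close> with \<open>z \<inter> Y = c\<close>. Since \<open>c \<subseteq> z \<inter> Y\<close> just means \<open>c \<subseteq> z\<close> for \<open>c \<subseteq> Y\<close>, the values of \<open>w\<close> on the
  interval from \<open>c\<close> to \<open>Y\<close> add up to the sum of \<open>\<mu>(z,y)\<close> over \<open>c \<subseteq> z \<subseteq> y\<close>, which is zero as \<open>c \<noteq> y\<close>. So \<open>w\<close> vanishes, by
  downward induction.\<close>

lemma weisner:
  fixes R :: "'b set \<Rightarrow> 'r::comm_ring_1"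
  assumes Q: "finite Q" "\<And>z. z \<in> Q \<Longrightarrow> finite z" "\<And>x y. x \<in> Q \<Longrightarrow> y \<in> Q \<Longrightarrow> x \<inter> y \<in> Q"
    and y: "y \<in> Q" and X: "Y \<in> Q" "Y \<subset> y"
    and R: "\<And>z. z \<in> Q \<Longrightarrow> z \<subseteq> y \<Longrightarrow> R z = R (z \<inter> Y)"
  shows "(\<Sum>z | z \<in> Q \<and> z \<subseteq> y. of_int (moebius Q z y) * R z) = 0"
proof -
  define w where "w c = (\<Sum>z | z \<in> Q \<and> z \<subseteq> y \<and> z \<inter> Y = c. moebius Q z y)" for c
  have w0: "w c = 0" if "c \<in> Q" "c \<subseteq> Y" for c
    using that
  proof (induction "card Y - card c" arbitrary: c rule: less_induct)
    case less
    have fin: "finite {d \<in> Q. c \<subseteq> d \<and> d \<subseteq> Y}" using Q(1) by simp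
    have "{z. z \<in> Q \<and> c \<subseteq> z \<and> z \<subseteq> y} \<inter> {z. z \<inter> Y = d} = {z. z \<in> Q \<and> z \<subseteq> y \<and> z \<inter> Y = d}"
      if "c \<subseteq> d" for d using that by auto
    then have "(\<Sum>d\<in>{d \<in> Q. c \<subseteq> d \<and> d \<subseteq> Y}. w d) =
        (\<Sum>d\<in>{d \<in> Q. c \<subseteq> d \<and> d \<subseteq> Y}. \<Sum>z\<in>{z\<in>{z. z \<in> Q \<and> c \<subseteq> z \<and> z \<subseteq> y}. z \<inter> Y = d}. moebius Q z y)"
      unfolding w_def by (intro sum.cong refl) auto
    also have "\<dots> = (\<Sum>z | z \<in> Q \<and> c \<subseteq> z \<and> z \<subseteq> y. moebius Q z y)"
      by (rule sum.group) (use Q X(1) less.prems in auto)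
    also have "\<dots> = 0"
      using moebius_sum_lower[OF Q(1,2) y less.prems(1)] less.prems(2) X by auto
    finally have "w c + (\<Sum>d\<in>{d \<in> Q. c \<subseteq> d \<and> d \<subseteq> Y} - {c}. w d) = 0"
      using sum.remove[OF fin, of c w] less.prems by simp
    moreover have "w d = 0" if "d \<in> {d \<in> Q. c \<subseteq> d \<and> d \<subseteq> Y} - {c}" for d
    proof -
      have d: "d \<in> Q" "c \<subset> d" "d \<subseteq> Y" using that by auto
      then have "card c < card d" using psubset_card_mono[OF Q(2)] by blast
      moreover have "card d \<le> card Y" using d card_mono[OF Q(2)[OF X(1)]] by blast
      ultimately show ?thesis using less.hyps[OF _ d(1,3)] by simp
    qed
    ultimately show ?case by simp
  qed
  have "(\<Sum>z | z \<in> Q \<and> z \<subseteq> y. of_int (moebius Q z y) * R z) =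
      (\<Sum>z | z \<in> Q \<and> z \<subseteq> y. of_int (moebius Q z y) * R (z \<inter> Y))"
    using R by (intro sum.cong refl) auto
  also have "\<dots> = (\<Sum>c\<in>{c \<in> Q. c \<subseteq> Y}. \<Sum>z\<in>{z\<in>{z. z \<in> Q \<and> z \<subseteq> y}. z \<inter> Y = c}. of_int (moebius Q z y) * R (z \<inter> Y))"
    by (rule sum.group[symmetric]) (use Q X in auto)
  also have "\<dots> = (\<Sum>c\<in>{c \<in> Q. c \<subseteq> Y}. of_int (w c) * R c)"
    by (intro sum.cong refl) (auto simp: w_def sum_distrib_right intro!: sum.cong)
  also have "\<dots> = 0" using w0 by simp
  finally show ?thesis .
qed

section \<open>Separation by species, and the idempotents\<close>

text \<open>What the hypotheses on subquotients provide for one group. The argument \<open>K\<close> is there to fix the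
  field, which would not be determined by \<open>A\<close> and \<open>G\<close>.\<close>

locale split_fibered_group = fibered_group A G
  for A :: "('a, 'n) monoid_scheme" and G :: "('g, 'm) monoid_scheme" (structure) +
  fixes K :: "'k::field_char_0 itself"
  assumes finite_dual: "subgroup H G \<Longrightarrow> finite (carrier (dgroup H))"
    and enough_K: "subgroup H G \<Longrightarrow> enough_chars K (dgroup H)"
begin

lemma enough: "subgroup H G \<Longrightarrow> enough_chars TYPE('k) (dgroup H)"
  using enough_K by (simp add: enough_chars_def)

abbreviation kchars :: "'g set \<Rightarrow> (('g \<Rightarrow> 'a) \<Rightarrow> 'k) set" where
  "kchars H \<equiv> chars H"

text \<open>Column orthogonality: the species \<open>(H,\<Phi>)\<close> with weights \<open>\<Phi>(\<xi>\<inverse>)\<close> combine to a multiple of the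
  indicator of the pairs that restrict to \<open>(H,\<xi>)\<close>.\<close>

lemma sum_chars_val:
  assumes H: "subgroup H G" and \<xi>: "\<xi> \<in> dual H" and u: "u \<in> pairs"
  shows "(\<Sum>\<Phi>\<in>kchars H. \<Phi> (inv\<^bsub>dgroup H\<^esub> \<xi>) * val (H, \<Phi>) u) =
    (if H \<subseteq> fst u \<and> restrict (snd u) H = \<xi> then of_nat (card (kchars H)) else 0)"
proof (cases "H \<subseteq> fst u")
  case True
  interpret M: comm_group "dgroup H" by (rule comm_group_dual[OF H])
  define \<psi> where "\<psi> = restrict (snd u) H"
  have \<psi>: "\<psi> \<in> dual H" unfolding \<psi>_def
    by (rule dual_restrict[OF _ H True]) (use u in \<open>auto simp: pairs_def\<close>)
  have "(\<Sum>\<Phi>\<in>kchars H. \<Phi> (inv\<^bsub>dgroup H\<^esub> \<xi>) * val (H, \<Phi>) u) =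
      (\<Sum>\<Phi>\<in>kchars H.
        \<Phi> (inv\<^bsub>dgroup H\<^esub> \<xi> \<otimes>\<^bsub>dgroup H\<^esub> \<psi>))"
    using True charsD(3)[where ?'k = 'k, OF _ M.inv_closed[OF \<xi>] \<psi>]
    by (intro sum.cong refl) (simp add: val_def \<psi>_def del: hom_group_simps)
  also have "\<dots> = (if inv\<^bsub>dgroup H\<^esub> \<xi> \<otimes>\<^bsub>dgroup H\<^esub> \<psi> =
      \<one>\<^bsub>dgroup H\<^esub> then of_nat (card (kchars H)) else 0)"
    using enough[OF H] by (intro char_column_orthogonality)
      (simp_all add: M.is_group \<xi> \<psi> del: hom_group_simps)
  also have "inv\<^bsub>dgroup H\<^esub> \<xi> \<otimes>\<^bsub>dgroup H\<^esub> \<psi> =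
      \<one>\<^bsub>dgroup H\<^esub> \<longleftrightarrow> \<psi> = \<xi>"
    using M.inv_solve_left'[OF M.one_closed \<xi> \<psi>] \<xi> by (simp add: M.r_one del: hom_group_simps)
  finally show ?thesis using True by (simp add: \<psi>_def)
qed (simp add: val_def)

lemma card_chars_pos: "subgroup H G \<Longrightarrow> card (kchars H) > 0"
proof -
  assume H: "subgroup H G"
  interpret M: comm_group "dgroup H" by (rule comm_group_dual[OF H])
  interpret N: comm_group "hom_group (mult_group :: 'k monoid) (dgroup H)"
    by (rule comm_group_hom_group[OF comm_group_mult_group M.is_group])
  show ?thesis
    using finite_chars[OF M.is_group finite_dual[OF H], where ?'k = 'k] N.one_closed
    by (auto simp: card_gt_0_iff simp del: hom_group_simps)
qed

text \<open>In the support of \<open>x \<noteq> 0\<close> choose a class \<open>[H,\<xi>]\<close> with \<open>H\<close> of largest order. The combination of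
  species in \<open>sum_chars_val\<close> picks out the classes having a conjugate that restricts to \<open>(H,\<xi>)\<close>; by maximality only
  \<open>[H,\<xi>]\<close> does, and its coefficient would be zero.\<close>

theorem species_separate:
  fixes x :: "('g set \<times> ('g \<Rightarrow> 'a)) set \<Rightarrow>\<^sub>0 'k"
  assumes x: "x \<in> fib_burnside A G"
    and 0: "\<And>p. p \<in> char_pairs A G \<Longrightarrow> species G p x = 0"
  shows "x = 0"
proof (rule ccontr)
  assume "x \<noteq> 0"
  then have ne: "Poly_Mapping.keys x \<noteq> {}" by simp
  have rp: "rep d \<in> pairs" "pair_class G (rep d) = d" if "d \<in> Poly_Mapping.keys x" for d
    using that x rep_in_pairs by (auto simp: fib_burnside_def)
  obtain c where c: "c \<in> Poly_Mapping.keys x"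
    and max: "\<And>d. d \<in> Poly_Mapping.keys x \<Longrightarrow> card (fst (rep d)) \<le> card (fst (rep c))"
    using Max_in[of "(\<lambda>d. card (fst (rep d))) ` Poly_Mapping.keys x"] ne
      Max_ge[of "(\<lambda>d. card (fst (rep d))) ` Poly_Mapping.keys x"] by fastforce
  obtain H \<xi> where H\<xi>: "rep c = (H, \<xi>)" by (cases "rep c")
  have H: "subgroup H G" and \<xi>: "\<xi> \<in> dual H" using rp(1)[OF c] by (auto simp: H\<xi> pairs_def)
  (* The weight of the species at (H,\<Phi>) will be \<Phi> \<mu>. *)
  define \<mu> where "\<mu> = inv\<^bsub>dgroup H\<^esub> \<xi>"
  define M where "M = (of_nat (card (kchars H)) :: 'k)"
  have M: "M \<noteq> 0" using card_chars_pos[OF H] by (simp add: M_def)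
  define I where "I d = {g \<in> carrier G. H \<subseteq> fst (conj_pair G g (rep d)) \<and> restrict (snd (conj_pair G g (rep d))) H = \<xi>}" for d
  have I: "d = c" if d: "d \<in> Poly_Mapping.keys x" and g: "g \<in> I d" for d g
  proof -
    have gc: "g \<in> carrier G" and sub: "H \<subseteq> fst (conj_pair G g (rep d))"
      and r: "restrict (snd (conj_pair G g (rep d))) H = \<xi>" using g by (auto simp: I_def)
    have gp: "conj_pair G g (rep d) \<in> pairs" using rp(1)[OF d] gc by (rule conj_pair_in_pairs)
    have "card (fst (conj_pair G g (rep d))) = card (fst (rep d))"
      using card_conj_set[OF subgroup.subset[OF pairs_subgroup[OF rp(1)[OF d]]] gc] by (cases "rep d") simp
    then have "fst (conj_pair G g (rep d)) = H"
      using card_seteq[OF subgroup_finite[OF pairs_subgroup[OF gp]] sub] max[OF d] by (simp add: H\<xi>)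
    moreover from this have "snd (conj_pair G g (rep d)) \<in> dual H" using gp by (auto simp: pairs_def)
    then have "snd (conj_pair G g (rep d)) = \<xi>"
      using r by (simp add: carrier_hom_group extensional_restrict)
    ultimately have "conj_pair G g (rep d) = rep c" by (simp add: H\<xi> prod_eq_iff)
    then show "d = c" using rp(2)[OF d] rp(2)[OF c] pair_class_conj[OF rp(1)[OF d] gc] by simp
  qed
  have mk: "(\<Sum>\<Phi>\<in>kchars H. \<Phi> \<mu> * mark (H, \<Phi>) (rep d)) = of_nat (card (I d)) * M / of_nat (card (fst (rep d)))"
    if d: "d \<in> Poly_Mapping.keys x" for d
  proof -
    have "mark (H, \<Phi>) (rep d) = (\<Sum>g\<in>carrier G. val (H, \<Phi>) (conj_pair G g (rep d))) / of_nat (card (fst (rep d)))"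
      if "\<Phi> \<in> kchars H" for \<Phi> :: "('g \<Rightarrow> 'a) \<Rightarrow> 'k"
    proof -
      have "(H, \<Phi>) \<in> char_pairs A G" using that H by (simp add: char_pairs_iff)
      then show ?thesis by (simp only: mark_def sum_val_conj[OF _ rp(1)[OF d]])
    qed
    then have "(\<Sum>\<Phi>\<in>kchars H. \<Phi> \<mu> * mark (H, \<Phi>) (rep d)) =
       (\<Sum>\<Phi>\<in>kchars H. \<Sum>g\<in>carrier G. \<Phi> \<mu> * val (H, \<Phi>) (conj_pair G g (rep d))) / of_nat (card (fst (rep d)))"
      by (simp add: sum_distrib_left sum_divide_distrib)
    also have "(\<Sum>\<Phi>\<in>kchars H. \<Sum>g\<in>carrier G. \<Phi> \<mu> * val (H, \<Phi>) (conj_pair G g (rep d))) =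
       (\<Sum>g\<in>carrier G. if g \<in> I d then M else 0)"
      unfolding sum.swap[of _ _ "kchars H"]
      by (intro sum.cong refl) (simp add: \<mu>_def M_def I_def sum_chars_val[OF H \<xi>] conj_pair_in_pairs[OF rp(1)[OF d]])
    also have "\<dots> = of_nat (card (I d)) * M"
      by (simp add: sum.inter_filter[symmetric] I_def)
    finally show ?thesis .
  qed
  have "0 = (\<Sum>\<Phi>\<in>kchars H. \<Phi> \<mu> * species G (H, \<Phi>) x)"
    using 0 H by (simp add: char_pairs_iff)
  also have "\<dots> = (\<Sum>\<Phi>\<in>kchars H. \<Sum>d\<in>Poly_Mapping.keys x. Poly_Mapping.lookup x d * (\<Phi> \<mu> * mark (H, \<Phi>) (rep d)))"
    using H by (intro sum.cong refl) (simp add: species_eq[OF _ x] char_pairs_iff char_ext_def sum_distrib_left mult_ac)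
  also have "\<dots> = (\<Sum>d\<in>Poly_Mapping.keys x. Poly_Mapping.lookup x d * (of_nat (card (I d)) * M / of_nat (card (fst (rep d)))))"
    by (subst sum.swap) (simp add: sum_distrib_left[symmetric] mk)
  also have "\<dots> = (\<Sum>d\<in>Poly_Mapping.keys x. if d = c then Poly_Mapping.lookup x c * (of_nat (card (I c)) * M / of_nat (card H)) else 0)"
  proof (rule sum.cong[OF refl])
    fix d assume d: "d \<in> Poly_Mapping.keys x"
    show "Poly_Mapping.lookup x d * (of_nat (card (I d)) * M / of_nat (card (fst (rep d)))) =
       (if d = c then Poly_Mapping.lookup x c * (of_nat (card (I c)) * M / of_nat (card H)) else 0)"
    proof (cases "d = c")
      case False
      then have "I d = {}" using I[OF d] by blast
      then show ?thesis using False by simp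
    qed (simp add: H\<xi>)
  qed
  also have "\<dots> = Poly_Mapping.lookup x c * (of_nat (card (I c)) * M / of_nat (card H))"
    using c by simp
  finally have "card (I c) = 0"
    using M subgroup_card_pos[OF H] c by (auto simp: in_keys_iff)
  moreover have "\<one> \<in> I c"
    using conj_pair_one[OF rp(1)[OF c]] \<xi> by (simp add: I_def H\<xi> carrier_hom_group extensional_restrict)
  moreover have "finite (I c)" by (simp add: I_def)
  ultimately show False by auto
qed

lemma scale_in_fib_burnside: "x \<in> fib_burnside A G \<Longrightarrow> scale a x \<in> fib_burnside A G"
  using keys_scale[of a x] by (auto simp: fib_burnside_def)

lemma species_scale:
  "p \<in> char_pairs A G \<Longrightarrow> x \<in> fib_burnside A G \<Longrightarrow> species G p (scale a x) = a * species G p x"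
  for p :: "'g set \<times> (('g \<Rightarrow> 'a) \<Rightarrow> 'k)"
  by (simp add: species_eq scale_in_fib_burnside)

definition idem_coeff :: "'g set \<times> (('g \<Rightarrow> 'a) \<Rightarrow> 'k) \<Rightarrow> 'g set \<Rightarrow> ('g \<Rightarrow> 'a) \<Rightarrow> 'k" where
  "idem_coeff p L \<phi> = of_nat (card L) * of_int (moebius {L. subgroup L G} L (fst p)) * inverse (snd p \<phi>) /
     (of_nat (card (dual (fst p))) * of_nat (card {g \<in> carrier G. act g p = p}))"

text \<open>The explicit form of the idempotent; see \<open>fib_idem_eq\<close>.\<close>

definition idem :: "'g set \<times> (('g \<Rightarrow> 'a) \<Rightarrow> 'k) \<Rightarrow> (('g set \<times> ('g \<Rightarrow> 'a)) set \<Rightarrow>\<^sub>0 'k)" where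
  "idem p = (\<Sum>L\<in>{L. subgroup L G \<and> L \<subseteq> fst p}. \<Sum>\<phi>\<in>dual (fst p).
     Poly_Mapping.single (pair_class G (L, restrict \<phi> L)) (idem_coeff p L \<phi>))"

lemma idem_pair: "subgroup L G \<Longrightarrow> L \<subseteq> H \<Longrightarrow> \<phi> \<in> dual H \<Longrightarrow> (L, restrict \<phi> L) \<in> pairs"
  by (simp add: pairs_def dual_restrict)

lemma idem_in_fib_burnside:
  "idem p \<in> fib_burnside A G"
  unfolding fib_burnside_def idem_def mem_Collect_eq
  by (intro keys_sum_subset single_pair_class_in_fib_burnside) (auto intro: idem_pair)

lemma finite_subgroups: "finite {L. subgroup L G}"
  by (rule finite_subset[of _ "Pow (carrier G)"]) (auto dest: subgroup.subset)

lemma stabilizer_pos: "p \<in> char_pairs A G \<Longrightarrow> card {g \<in> carrier G. act g p = p} > 0"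
  using conj_char_pair_one[of p] by (auto simp: card_gt_0_iff)

lemma card_dual_pos: "subgroup H G \<Longrightarrow> card (dual H) > 0"
proof -
  assume H: "subgroup H G"
  interpret M: comm_group "dgroup H" by (rule comm_group_dual[OF H])
  show ?thesis using finite_dual[OF H] M.one_closed by (auto simp: card_gt_0_iff simp del: hom_group_simps)
qed

lemma char_ext_idem:
  assumes f: "\<And>u. u \<in> pairs \<Longrightarrow> f (pair_class G u) = F u"
  shows "char_ext f (idem p) = (\<Sum>L\<in>{L. subgroup L G \<and> L \<subseteq> fst p}. \<Sum>\<phi>\<in>dual (fst p).
     idem_coeff p L \<phi> * F (L, restrict \<phi> L))"
  unfolding idem_def char_ext_sum by (intro sum.cong refl) (subst char_ext_single, subst f, rule idem_pair[where H = "fst p"], auto)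

text \<open>With \<open>p = (H,\<Phi>)\<close> and \<open>q = (E,\<Psi>)\<close>, the double sum factors: the sum over \<open>L\<close> forces \<open>E = H\<close> by Moebius inversion, and then the sum over
  \<open>\<phi>\<close> forces \<open>\<Psi> = \<Phi>\<close> by row orthogonality.\<close>

lemma sum_moebius_val:
  assumes p: "p \<in> char_pairs A G" and q: "q \<in> char_pairs A G"
  shows "(\<Sum>L\<in>{L. subgroup L G \<and> L \<subseteq> fst p}. \<Sum>\<phi>\<in>dual (fst p).
      of_int (moebius {L. subgroup L G} L (fst p)) * inverse (snd p \<phi>) * val q (L, restrict \<phi> L)) =
    (if q = p then of_nat (card (dual (fst p))) else (0 :: 'k))"
proof -
  obtain H \<Phi> E \<Psi> where pq: "p = (H, \<Phi>)" "q = (E, \<Psi>)" by (cases p; cases q; blast)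
  have H: "subgroup H G" "\<Phi> \<in> chars H" and E: "subgroup E G" "\<Psi> \<in> chars E"
    using p q by (auto simp: pq char_pairs_iff)
  let ?Q = "{L. subgroup L G}"
  have fQ: "finite z" if "z \<in> ?Q" for z using that subgroup_finite by simp
  define t where "t L \<phi> = (if E \<subseteq> L then of_int (moebius ?Q L H) else (0 :: 'k)) * (inverse (\<Phi> \<phi>) * \<Psi> (restrict \<phi> E))"
    for L \<phi>
  have "(\<Sum>L\<in>{L. subgroup L G \<and> L \<subseteq> H}. \<Sum>\<phi>\<in>dual H.
      of_int (moebius ?Q L H) * inverse (\<Phi> \<phi>) * val q (L, restrict \<phi> L)) =
    (\<Sum>L\<in>{L. subgroup L G \<and> L \<subseteq> H}. \<Sum>\<phi>\<in>dual H. t L \<phi>)"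
    by (intro sum.cong refl) (simp add: t_def val_def pq restrict_restrict Int_absorb1)
  also have "\<dots> = (\<Sum>L\<in>{L. subgroup L G \<and> L \<subseteq> H}. if E \<subseteq> L then of_int (moebius ?Q L H) else 0) *
      (\<Sum>\<phi>\<in>dual H. inverse (\<Phi> \<phi>) * \<Psi> (restrict \<phi> E))"
    by (simp add: t_def sum_product)
  also have "(\<Sum>L\<in>{L. subgroup L G \<and> L \<subseteq> H}. if E \<subseteq> L then of_int (moebius ?Q L H) else (0 :: 'k)) =
      of_int (\<Sum>L | L \<in> ?Q \<and> E \<subseteq> L \<and> L \<subseteq> H. moebius ?Q L H)"
  proof -
    have "{L \<in> {L. subgroup L G \<and> L \<subseteq> H}. E \<subseteq> L} = {L. L \<in> ?Q \<and> E \<subseteq> L \<and> L \<subseteq> H}" by auto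
    then show ?thesis using finite_subgroups by (simp add: sum.inter_filter[symmetric])
  qed
  also have "(\<Sum>L | L \<in> ?Q \<and> E \<subseteq> L \<and> L \<subseteq> H. moebius ?Q L H) = (if E = H then 1 else 0)"
  proof (cases "E \<subseteq> H")
    case True
    then show ?thesis using moebius_sum_lower[OF finite_subgroups fQ, where y = H and x = E] H E by simp
  next
    case False
    then have "{L. L \<in> ?Q \<and> E \<subseteq> L \<and> L \<subseteq> H} = {}" by auto
    moreover have "E \<noteq> H" using False by auto
    ultimately show ?thesis by (simp only: sum.empty if_False)
  qed
  finally have eq: "(\<Sum>L\<in>{L. subgroup L G \<and> L \<subseteq> H}. \<Sum>\<phi>\<in>dual H.
      of_int (moebius ?Q L H) * inverse (\<Phi> \<phi>) * val q (L, restrict \<phi> L)) =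
    (if E = H then (\<Sum>\<phi>\<in>dual H. inverse (\<Phi> \<phi>) * \<Psi> (restrict \<phi> E)) else 0)"
    by (cases "E = H") (simp_all only: simp_thms if_True if_False of_int_1 of_int_0 mult_1 mult_zero_left)
  have "(\<Sum>\<phi>\<in>dual H. inverse (\<Phi> \<phi>) * \<Psi> (restrict \<phi> E)) = (if \<Phi> = \<Psi> then of_nat (card (dual H)) else 0)" if "E = H"
  proof -
    have "(\<Sum>\<phi>\<in>dual H. inverse (\<Phi> \<phi>) * \<Psi> (restrict \<phi> E)) = (\<Sum>\<phi>\<in>dual H. inverse (\<Phi> \<phi>) * \<Psi> \<phi>)"
      using that by (intro sum.cong refl) (simp add: carrier_hom_group extensional_restrict)
    then show ?thesis
      using char_row_orthogonality[OF comm_group.axioms(2)[OF comm_group_dual[OF H(1)]] H(2), of \<Psi>] E that by simp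
  qed
  then show ?thesis using eq by (auto simp: pq)
qed

text \<open>The species averages \<open>sum_moebius_val\<close> over the conjugates of \<open>q\<close>. If \<open>q\<close> is conjugate to \<open>p\<close>, then
  as many group elements take \<open>q\<close> to \<open>p\<close> as fix \<open>p\<close>.\<close>

lemma species_idem:
  assumes p: "p \<in> char_pairs A G" and q: "q \<in> char_pairs A G"
  shows "species G q (idem p) = (if \<exists>g\<in>carrier G. q = act g p then 1 else 0)"
proof -
  define S where "S = {g \<in> carrier G. act g p = p}"
  define C where "C = (of_nat (card (dual (fst p))) * of_nat (card S) :: 'k)"
  have "card S > 0" unfolding S_def by (rule stabilizer_pos[OF p])
  then have C: "C \<noteq> 0"
    using card_dual_pos[OF char_pairs_subgroup[OF p]] unfolding C_def
    by (metis less_irrefl mult_eq_0_iff of_nat_eq_0_iff)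
  let ?m = "\<lambda>L. of_int (moebius {L. subgroup L G} L (fst p)) :: 'k"
  have "species G q (idem p) = (\<Sum>L\<in>{L. subgroup L G \<and> L \<subseteq> fst p}. \<Sum>\<phi>\<in>dual (fst p).
     idem_coeff p L \<phi> * mark q (L, restrict \<phi> L))"
    unfolding species_eq[OF q idem_in_fib_burnside]
    by (rule char_ext_idem) (rule mark_rep_pair_class[OF q])
  also have "\<dots> = (\<Sum>L\<in>{L. subgroup L G \<and> L \<subseteq> fst p}. \<Sum>\<phi>\<in>dual (fst p). \<Sum>g\<in>carrier G.
     ?m L * inverse (snd p \<phi>) * val (act g q) (L, restrict \<phi> L)) / C"
  proof -
    have "idem_coeff p L \<phi> * mark q (L, restrict \<phi> L) =
      (\<Sum>g\<in>carrier G. ?m L * inverse (snd p \<phi>) * val (act g q) (L, restrict \<phi> L)) / C"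
      if "subgroup L G" for L \<phi>
    proof -
      have "idem_coeff p L \<phi> * mark q (L, restrict \<phi> L) =
        ?m L * inverse (snd p \<phi>) * (\<Sum>g\<in>carrier G. val (act g q) (L, restrict \<phi> L)) / C"
        using subgroup_card_pos[OF that] by (simp add: idem_coeff_def mark_def C_def S_def)
      then show ?thesis by (simp only: sum_distrib_left)
    qed
    then show ?thesis by (simp add: sum_divide_distrib)
  qed
  also have "\<dots> = (\<Sum>g\<in>carrier G. \<Sum>L\<in>{L. subgroup L G \<and> L \<subseteq> fst p}. \<Sum>\<phi>\<in>dual (fst p).
     ?m L * inverse (snd p \<phi>) * val (act g q) (L, restrict \<phi> L)) / C"
    by (subst (2) sum.swap, subst (3) sum.swap) (rule refl)
  also have "\<dots> = (\<Sum>g\<in>carrier G. if act g q = p then of_nat (card (dual (fst p))) else 0) / C"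
    by (intro arg_cong2[where f = "(/)"] sum.cong refl sum_moebius_val[OF p] conj_char_pair_in_char_pairs[OF q])
  also have "\<dots> = of_nat (card {g \<in> carrier G. act g q = p}) * of_nat (card (dual (fst p))) / C"
    by (simp add: sum.inter_filter[symmetric])
  also have "card {g \<in> carrier G. act g q = p} =
      (if \<exists>g\<in>carrier G. q = act g p then card S else 0)"
  proof (cases "\<exists>g\<in>carrier G. q = act g p")
    case True
    then obtain g0 where g0: "g0 \<in> carrier G" "q = act g0 p" by blast
    have "bij_betw (\<lambda>g. g \<otimes> g0) {g \<in> carrier G. act g q = p} S"
      by (rule bij_betwI[of _ _ _ "\<lambda>g. g \<otimes> inv g0"])
         (use g0 p in \<open>auto simp: S_def conj_char_pair_mult conj_char_pair_in_char_pairs conj_char_pair_inv m_assoc\<close>)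
    then show ?thesis using True by (simp add: bij_betw_same_card)
  next
    case False
    have "\<not> (g \<in> carrier G \<and> act g q = p)" for g
      using False conj_char_pair_inv(1)[OF q] inv_closed by metis
    then show ?thesis using False by auto
  qed
  finally show ?thesis using C by (auto simp: C_def)
qed

lemma species_eqI:
  fixes y z :: "('g set \<times> ('g \<Rightarrow> 'a)) set \<Rightarrow>\<^sub>0 'k"
  assumes y: "y \<in> fib_burnside A G" and z: "z \<in> fib_burnside A G"
    and eq: "\<And>q. q \<in> char_pairs A G \<Longrightarrow> species G q y = species G q z"
  shows "y = z"
proof -
  have yz: "y - z \<in> fib_burnside A G"
    using y z keys_diff[of y z] by (auto simp: fib_burnside_def)
  have "species G q (y - z) = 0" if q: "q \<in> char_pairs A G" for q
    using eq[OF q] species_eq[OF q y] species_eq[OF q z] species_eq[OF q yz]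
    by (simp add: char_ext_diff)
  then have "y - z = 0" using species_separate[OF yz] by blast
  then show ?thesis by simp
qed

lemma fib_idem_eq:
  assumes p: "p \<in> char_pairs A G"
  shows "fib_idem A G p = idem p"
  unfolding fib_idem_def
proof (rule the_equality)
  show e: "idem p \<in> fib_burnside A G \<and> fib_mult A G (idem p) (idem p) = idem p \<and>
      (\<forall>q\<in>char_pairs A G. species G q (idem p) = (if \<exists>g\<in>carrier G. q = act g p then 1 else 0))"
  proof (intro conjI ballI)
    show "fib_mult A G (idem p) (idem p) = idem p"
      by (rule species_eqI[OF fib_mult_closed]) (auto simp: idem_in_fib_burnside species_mult species_idem[OF p])
  qed (auto simp: idem_in_fib_burnside species_idem[OF p])
  show "e = idem p" if "e \<in> fib_burnside A G \<and> fib_mult A G e e = e \<and>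
      (\<forall>q\<in>char_pairs A G. species G q e = (if \<exists>g\<in>carrier G. q = act g p then 1 else 0))" for e
    using that e by (intro species_eqI) auto
qed

end

section \<open>Quotients\<close>

lemma hom_group_carrier_self [simp]: "hom_group A (F\<lparr>carrier := carrier F\<rparr>) = hom_group A F"
  by (simp add: hom_group_def hom_def)

locale fibered_normal = fibered_group A G
  for A :: "('a, 'n) monoid_scheme" and G :: "('g, 'm) monoid_scheme" (structure) +
  fixes N :: "'g set"
  assumes normal: "N \<lhd> G"
begin

abbreviation proj :: "'g \<Rightarrow> 'g set" where
  "proj x \<equiv> N #> x"

lemma N_subgroup: "subgroup N G"
  using normal by (rule normal_imp_subgroup)

lemma N_subset: "N \<subseteq> carrier G"
  by (rule subgroup.subset[OF N_subgroup])

lemma mult_Mod [simp]: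
  "x \<in> carrier G \<Longrightarrow> y \<in> carrier G \<Longrightarrow> proj x <#> proj y = proj (x \<otimes> y)"
  by (rule normal.rcos_sum[OF normal])

lemma proj_eq_iff:
  assumes "x \<in> carrier G" "y \<in> carrier G"
  shows "proj x = proj y \<longleftrightarrow> x \<otimes> inv y \<in> N"
proof
  assume "proj x = proj y"
  then show "x \<otimes> inv y \<in> N"
    using coset_mult_inv2[OF _ assms N_subset] coset_join1[OF _ _ N_subgroup] assms by simp
next
  assume "x \<otimes> inv y \<in> N"
  then have "x \<in> proj y" using assms by (auto simp: r_coset_def m_assoc intro!: bexI[of _ "x \<otimes> inv y"])
  then show "proj x = proj y" using repr_independence[OF _ assms(2) N_subgroup] by simp
qed

lemma proj_one_iff: "x \<in> carrier G \<Longrightarrow> proj x = N \<longleftrightarrow> x \<in> N"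
  using proj_eq_iff[of x \<one>] N_subset by (simp add: coset_mult_one)

sublocale Q: fibered_group A "G Mod N"
proof -
  have "group (G Mod N)" using normal by (rule normal.factorgroup_is_group)
  then show "fibered_group A (G Mod N)"
    using A.comm_group_axioms by (simp add: fibered_group_def fibered_group_axioms_def carrier_FactGroup)
qed

lemma proj_closed [simp]: "x \<in> carrier G \<Longrightarrow> proj x \<in> carrier (G Mod N)"
  by (simp add: carrier_FactGroup)

lemma inv_Mod [simp]: "x \<in> carrier G \<Longrightarrow> inv\<^bsub>G Mod N\<^esub> proj x = proj (inv x)"
  by (rule Q.inv_equality) (use proj_one_iff[of \<one>] subgroup.one_closed[OF N_subgroup] in auto)

lemma cj_Mod [simp]: "g \<in> carrier G \<Longrightarrow> x \<in> carrier G \<Longrightarrow> Q.cj (proj g) (proj x) = proj (cj g x)"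
  by (simp add: Q.cj_def cj_def)

lemma proj_set_mult:
  assumes "subgroup U G" shows "proj ` (U <#> N) = proj ` U"
proof
  have U: "U \<subseteq> carrier G" using assms by (rule subgroup.subset)
  show "proj ` (U <#> N) \<subseteq> proj ` U"
  proof
    fix C assume "C \<in> proj ` (U <#> N)"
    then obtain u n where u: "u \<in> U" "n \<in> N" "C = proj (u \<otimes> n)" by (auto simp: set_mult_def)
    then have c: "u \<in> carrier G" "n \<in> carrier G" using U N_subset by auto
    have "u \<otimes> n \<otimes> inv u \<in> N" using normal.inv_op_closed2[OF normal c(1) u(2)] .
    then have "proj (u \<otimes> n) = proj u" using c by (simp add: proj_eq_iff)
    then show "C \<in> proj ` U" using u by blast
  qed
  show "proj ` U \<subseteq> proj ` (U <#> N)"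
  proof
    fix C assume "C \<in> proj ` U"
    then obtain u where u: "u \<in> U" "C = proj u" by blast
    have "u \<otimes> \<one> \<in> U <#> N" using u subgroup.one_closed[OF N_subgroup] by (auto simp: set_mult_def)
    moreover have "u \<otimes> \<one> = u" using u U by auto
    ultimately show "C \<in> proj ` (U <#> N)" using u by auto
  qed
qed

lemma quot_image_eq:
  assumes "subgroup U G" shows "quot_image G N U = proj ` U"
proof -
  have "quot_image G N U = proj ` (U <#> N)"
    by (auto simp: quot_image_def RCOSETS_def r_coset_def)
  then show ?thesis by (simp only: proj_set_mult[OF assms])
qed

lemma subgroup_proj_image:
  assumes "subgroup U G" shows "subgroup (proj ` U) (G Mod N)"
proof -
  have U: "U \<subseteq> carrier G" using assms by (rule subgroup.subset)
  show ?thesis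
  proof (rule Q.subgroupI)
    show "inv\<^bsub>G Mod N\<^esub> a \<in> proj ` U" if "a \<in> proj ` U" for a
      using that subgroup.mem_carrier[OF assms] subgroup.m_inv_closed[OF assms] by auto
    show "a \<otimes>\<^bsub>G Mod N\<^esub> b \<in> proj ` U" if "a \<in> proj ` U" "b \<in> proj ` U" for a b
      using that subgroup.mem_carrier[OF assms] subgroup.m_closed[OF assms] by auto
  qed (use U subgroup.one_closed[OF assms] in auto)
qed

lemma subgroup_preimage:
  assumes "subgroup E (G Mod N)"
  shows "subgroup {x \<in> carrier G. proj x \<in> E} G" "N \<subseteq> {x \<in> carrier G. proj x \<in> E}"
    "proj ` {x \<in> carrier G. proj x \<in> E} = E"
proof -
  show "subgroup {x \<in> carrier G. proj x \<in> E} G"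
  proof (rule subgroupI)
    have "proj \<one> \<in> E" using proj_one_iff[of \<one>] subgroup.one_closed[OF N_subgroup] subgroup.one_closed[OF assms] by simp
    then show "{x \<in> carrier G. proj x \<in> E} \<noteq> {}" by blast
    show "inv a \<in> {x \<in> carrier G. proj x \<in> E}" if "a \<in> {x \<in> carrier G. proj x \<in> E}" for a
      using that subgroup.m_inv_closed[OF assms, of "proj a"] by simp
    show "a \<otimes> b \<in> {x \<in> carrier G. proj x \<in> E}"
      if "a \<in> {x \<in> carrier G. proj x \<in> E}" "b \<in> {x \<in> carrier G. proj x \<in> E}" for a b
      using that subgroup.m_closed[OF assms, of "proj a" "proj b"] by simp
  qed auto
  show "N \<subseteq> {x \<in> carrier G. proj x \<in> E}"
  proof
    fix t assume t: "t \<in> N"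
    then have "proj t = N" using proj_one_iff N_subset by blast
    then show "t \<in> {x \<in> carrier G. proj x \<in> E}"
      using t N_subset subgroup.one_closed[OF assms] by auto
  qed
  show "proj ` {x \<in> carrier G. proj x \<in> E} = E"
    using subgroup.subset[OF assms] by (auto simp: carrier_FactGroup)
qed

text \<open>Subgroups of \<open>G/N\<close> are, as groups, subquotients of \<open>G\<close>; the equality of records lets hypotheses on
  subquotients apply to them directly.\<close>

lemma Mod_restrict_eq:
  assumes "subgroup U G"
  shows "G\<lparr>carrier := U\<rparr> Mod N = (G Mod N)\<lparr>carrier := proj ` U\<rparr>"
proof -
  have "(<#>\<^bsub>G\<lparr>carrier := U\<rparr>\<^esub>) = (<#>)" by (intro ext) (simp add: set_mult_def)
  then show ?thesis by (auto simp: FactGroup_def RCOSETS_def r_coset_def)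
qed

lemma card_proj_image:
  assumes "subgroup U G" shows "card (proj ` U) * card (U \<inter> N) = card U"
proof -
  have U: "U \<subseteq> carrier G" "finite U" using subgroup.subset[OF assms] subgroup_finite[OF assms] by simp_all
  have "card U = (\<Sum>x\<in>U. 1)" by simp
  also have "\<dots> = (\<Sum>C\<in>proj ` U. \<Sum>x\<in>{x \<in> U. proj x = C}. 1)"
    by (rule sum.group[symmetric]) (use U in auto)
  also have "\<dots> = (\<Sum>C\<in>proj ` U. card (U \<inter> N))"
  proof (rule sum.cong[OF refl])
    fix C assume "C \<in> proj ` U"
    then obtain u where u: "u \<in> U" "C = proj u" by blast
    have uc: "u \<in> carrier G" using u U by auto
    have "bij_betw (\<lambda>x. x \<otimes> inv u) {x \<in> U. proj x = C} (U \<inter> N)"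
    proof (rule bij_betwI[of _ _ _ "\<lambda>n. n \<otimes> u"])
      show "(\<lambda>x. x \<otimes> inv u) \<in> {x \<in> U. proj x = C} \<rightarrow> U \<inter> N"
        using u uc U by (auto simp: subset_iff proj_eq_iff subgroup.m_closed[OF assms] subgroup.m_inv_closed[OF assms])
      show "(\<lambda>n. n \<otimes> u) \<in> U \<inter> N \<rightarrow> {x \<in> U. proj x = C}"
        using u uc U N_subset by (auto simp: subset_iff proj_eq_iff m_assoc subgroup.m_closed[OF assms])
      show "x \<otimes> inv u \<otimes> u = x" if "x \<in> {x \<in> U. proj x = C}" for x
        using that uc U by (auto simp: subset_iff m_assoc)
      show "n \<otimes> u \<otimes> inv u = n" if "n \<in> U \<inter> N" for n
        using that uc U by (auto simp: subset_iff m_assoc)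
    qed
    then show "(\<Sum>x\<in>{x \<in> U. proj x = C}. 1) = card (U \<inter> N)" using bij_betw_same_card by fastforce
  qed
  finally show ?thesis by simp
qed

definition triv_on_N :: "'g set \<times> ('g \<Rightarrow> 'a) \<Rightarrow> bool" where
  "triv_on_N u \<longleftrightarrow> (\<forall>x\<in>fst u \<inter> N. snd u x = \<one>\<^bsub>A\<^esub>)"

text \<open>For \<open>\<phi>\<close> trivial on \<open>U \<inter> N\<close> this is the homomorphism \<open>\<phi>~\<close> on \<open>UN/N\<close>.\<close>

definition descend :: "'g set \<Rightarrow> ('g \<Rightarrow> 'a) \<Rightarrow> 'g set \<Rightarrow> 'a" where
  "descend U \<phi> = (\<lambda>C\<in>proj ` U. THE a. \<exists>u\<in>U. C = proj u \<and> a = \<phi> u)"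

text \<open>The composite \<open>\<nu>\<^sup>* \<circ> \<alpha>\<^sup>*\<close>: pullback along \<open>U \<rightarrow> UN/N\<close>.\<close>

definition inflate :: "'g set \<Rightarrow> ('g set \<Rightarrow> 'a) \<Rightarrow> 'g \<Rightarrow> 'a" where
  "inflate U \<psi> = (\<lambda>x\<in>U. \<psi> (proj x))"

lemma dual_div:
  assumes "subgroup U G" "\<phi> \<in> dual U" "x \<in> U" "y \<in> U"
  shows "\<phi> (x \<otimes> inv y) \<otimes>\<^bsub>A\<^esub> \<phi> y = \<phi> x"
proof -
  have "x \<in> carrier G" "y \<in> carrier G" using assms subgroup.mem_carrier[OF assms(1)] by auto
  moreover have "x \<otimes> inv y \<in> U" using assms by (simp add: subgroup.m_closed subgroup.m_inv_closed)
  ultimately show ?thesis using dualD(3)[OF assms(2), of "x \<otimes> inv y" y] assms by (simp add: m_assoc)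
qed

lemma descend_apply:
  assumes U: "subgroup U G" and \<phi>: "\<phi> \<in> dual U" and t: "triv_on_N (U, \<phi>)" and u: "u \<in> U"
  shows "descend U \<phi> (proj u) = \<phi> u"
proof -
  have eq: "\<phi> v = \<phi> u" if v: "v \<in> U" "proj u = proj v" for v
  proof -
    have "v \<otimes> inv u \<in> N"
      using proj_eq_iff[OF subgroup.mem_carrier[OF U v(1)] subgroup.mem_carrier[OF U u]] v(2) by simp
    moreover have "v \<otimes> inv u \<in> U"
      using subgroup.m_closed[OF U v(1) subgroup.m_inv_closed[OF U u]] .
    ultimately have "\<phi> (v \<otimes> inv u) = \<one>\<^bsub>A\<^esub>" using t by (simp add: triv_on_N_def)
    then show ?thesis using dual_div[OF U \<phi> v(1) u] dualD(1)[OF \<phi> u] by simp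
  qed
  have "(THE a. \<exists>v\<in>U. proj u = proj v \<and> a = \<phi> v) = \<phi> u"
  proof (rule the_equality)
    show "\<exists>v\<in>U. proj u = proj v \<and> \<phi> u = \<phi> v" using u by blast
    show "a = \<phi> u" if "\<exists>v\<in>U. proj u = proj v \<and> a = \<phi> v" for a using that eq by blast
  qed
  then show ?thesis using u by (simp add: descend_def)
qed

lemma descend_dual:
  assumes "subgroup U G" "\<phi> \<in> dual U" "triv_on_N (U, \<phi>)"
  shows "descend U \<phi> \<in> Q.dual (proj ` U)"
proof (rule Q.dualI)
  note a = descend_apply[OF assms] and D = dualD[OF assms(2)] and m = subgroup.mem_carrier[OF assms(1)]
  show "descend U \<phi> x \<in> carrier A" if "x \<in> proj ` U" for x using that a D(1) by auto
  show "descend U \<phi> x = undefined" if "x \<notin> proj ` U" for x using that by (simp add: descend_def)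
  show "descend U \<phi> (x \<otimes>\<^bsub>G Mod N\<^esub> y) = descend U \<phi> x \<otimes>\<^bsub>A\<^esub> descend U \<phi> y"
    if "x \<in> proj ` U" "y \<in> proj ` U" for x y
    using that a D(3) m subgroup.m_closed[OF assms(1)] by auto
qed

lemma descend_hom:
  assumes U: "subgroup U G" and triv: "\<And>\<phi>. \<phi> \<in> dual U \<Longrightarrow> triv_on_N (U, \<phi>)"
  shows "descend U \<in> hom (dgroup U) (Q.dgroup (proj ` U))"
    and "inj_on (descend U) (dual U)"
proof -
  show "inj_on (descend U) (dual U)"
  proof (rule inj_onI)
    fix \<phi> \<psi> assume *: "\<phi> \<in> dual U" "\<psi> \<in> dual U" "descend U \<phi> = descend U \<psi>"
    show "\<phi> = \<psi>"
      by (rule dual_eqI[OF *(1,2)])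
         (metis descend_apply[OF U *(1) triv[OF *(1)]] descend_apply[OF U *(2) triv[OF *(2)]] *(3))
  qed
  show "descend U \<in> hom (dgroup U) (Q.dgroup (proj ` U))"
  proof (rule homI)
    fix \<phi> \<psi> assume \<phi>: "\<phi> \<in> dual U" and \<psi>: "\<psi> \<in> dual U"
    note c = dual_mult_closed[OF U \<phi> \<psi>]
    show "descend U (\<phi> \<otimes>\<^bsub>dgroup U\<^esub> \<psi>) =
        descend U \<phi> \<otimes>\<^bsub>Q.dgroup (proj ` U)\<^esub> descend U \<psi>"
    proof (rule Q.dual_eqI[OF descend_dual[OF U c triv[OF c]] Q.dual_mult_closed[OF subgroup_proj_image[OF U]]])
      fix C assume "C \<in> proj ` U"
      then obtain x where x: "x \<in> U" "C = proj x" by blast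
      then show "descend U (\<phi> \<otimes>\<^bsub>dgroup U\<^esub> \<psi>) C =
          (descend U \<phi> \<otimes>\<^bsub>Q.dgroup (proj ` U)\<^esub> descend U \<psi>) C"
        using descend_apply[OF U c triv[OF c] x(1)] descend_apply[OF U \<phi> triv[OF \<phi>] x(1)]
          descend_apply[OF U \<psi> triv[OF \<psi>] x(1)] by simp
    qed (use descend_dual[OF U] triv \<phi> \<psi> in auto)
  qed (use descend_dual[OF U] triv in auto)
qed

lemma inflate_dual:
  assumes "subgroup U G" "\<psi> \<in> Q.dual (proj ` U)"
  shows "inflate U \<psi> \<in> dual U"
proof (rule dualI)
  note D = Q.dualD[OF assms(2)] and m = subgroup.mem_carrier[OF assms(1)]
  show "inflate U \<psi> x \<in> carrier A" if "x \<in> U" for x using that D(1) by (simp add: inflate_def)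
  show "inflate U \<psi> x = undefined" if "x \<notin> U" for x using that by (simp add: inflate_def)
  show "inflate U \<psi> (x \<otimes> y) = inflate U \<psi> x \<otimes>\<^bsub>A\<^esub> inflate U \<psi> y" if "x \<in> U" "y \<in> U" for x y
    using that D(3)[of "proj x" "proj y"] m subgroup.m_closed[OF assms(1)] by (simp add: inflate_def)
qed

lemma inflate_triv:
  assumes "subgroup U G" "\<psi> \<in> Q.dual (proj ` U)" "x \<in> U" "x \<in> N"
  shows "inflate U \<psi> x = \<one>\<^bsub>A\<^esub>"
proof -
  have px: "proj x = N" using proj_one_iff assms N_subset by auto
  have N: "N \<in> proj ` U" using subgroup.one_closed[OF subgroup_proj_image[OF assms(1)]] by simp
  have "N <#> N = N" using Q.l_one[OF Q.one_closed] by simp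
  then have "\<psi> N \<otimes>\<^bsub>A\<^esub> \<psi> N = \<psi> N"
    using Q.dualD(3)[OF assms(2) N N] by simp
  then have "\<psi> N = \<one>\<^bsub>A\<^esub>" using A.r_cancel_one' Q.dualD(1)[OF assms(2) N] by metis
  then show ?thesis using px assms(3) by (simp add: inflate_def)
qed

lemma inflate_mult:
  "inflate U (\<psi> \<otimes>\<^bsub>Q.dgroup (proj ` U)\<^esub> \<psi>') =
     inflate U \<psi> \<otimes>\<^bsub>dgroup U\<^esub> inflate U \<psi>'"
  by (auto simp: inflate_def fun_eq_iff)

text \<open>The canonical epimorphism followed by the canonical isomorphism is \<open>x \<mapsto> Nx\<close>.\<close>

lemma char_quot_eq:
  assumes H: "subgroup H G"
  shows "char_quot A G N H \<Phi> = (\<lambda>\<psi>\<in>Q.dual (proj ` H). \<Phi> (inflate H \<psi>))"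
proof -
  have "hom_pullback (G\<lparr>carrier := H\<rparr>) (\<lambda>h. (H \<inter> N) #> h)
          (hom_pullback ((G\<lparr>carrier := H\<rparr>) Mod (H \<inter> N)) (\<lambda>C. N <#> C) \<psi>) = inflate H \<psi>" for \<psi> :: "'g set \<Rightarrow> 'a"
  proof (rule ext)
    fix x
    show "hom_pullback (G\<lparr>carrier := H\<rparr>) (\<lambda>h. (H \<inter> N) #> h)
          (hom_pullback ((G\<lparr>carrier := H\<rparr>) Mod (H \<inter> N)) (\<lambda>C. N <#> C) \<psi>) x = inflate H \<psi> x"
    proof (cases "x \<in> H")
      case True
      then have xc: "x \<in> carrier G" using subgroup.mem_carrier[OF H] by auto
      have "(H \<inter> N) #> x \<in> carrier ((G\<lparr>carrier := H\<rparr>) Mod (H \<inter> N))"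
        using True by (auto simp: FactGroup_def RCOSETS_def r_coset_def)
      moreover have "N <#> ((H \<inter> N) #> x) = proj x"
      proof
        show "N <#> ((H \<inter> N) #> x) \<subseteq> proj x"
        proof
          fix y assume "y \<in> N <#> ((H \<inter> N) #> x)"
          then obtain n m where *: "n \<in> N" "m \<in> N" "y = n \<otimes> (m \<otimes> x)" by (auto simp: set_mult_def r_coset_def)
          then have "y = (n \<otimes> m) \<otimes> x" using N_subset xc by (auto simp: m_assoc subset_iff)
          then show "y \<in> proj x" using * subgroup.m_closed[OF N_subgroup] by (auto simp: r_coset_def)
        qed
        show "proj x \<subseteq> N <#> ((H \<inter> N) #> x)"
        proof
          fix y assume "y \<in> proj x"
          then obtain n where n: "n \<in> N" "y = n \<otimes> x" by (auto simp: r_coset_def)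
          have "\<one> \<otimes> x \<in> (H \<inter> N) #> x"
            using subgroup.one_closed[OF N_subgroup] subgroup.one_closed[OF H] by (auto simp: r_coset_def)
          then show "y \<in> N <#> ((H \<inter> N) #> x)" using n xc by (auto simp: set_mult_def)
        qed
      qed
      ultimately show ?thesis using True by (simp add: hom_pullback_def compose_def inflate_def)
    qed (simp add: hom_pullback_def compose_def inflate_def)
  qed
  then show ?thesis by (simp add: char_quot_def Let_def quot_image_eq[OF H])
qed

definition defl_pair :: "'g set \<times> ('g \<Rightarrow> 'a) \<Rightarrow> 'g set set \<times> ('g set \<Rightarrow> 'a)" where
  "defl_pair u = (proj ` fst u, descend (fst u) (snd u))"

lemma defl_pair_in_pairs: "u \<in> pairs \<Longrightarrow> triv_on_N u \<Longrightarrow> defl_pair u \<in> Q.pairs"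
  by (auto simp: pairs_def Q.pairs_def defl_pair_def subgroup_proj_image descend_dual)

lemma triv_on_N_conj:
  assumes u: "u \<in> pairs" and g: "g \<in> carrier G"
  shows "triv_on_N (conj_pair G g u) \<longleftrightarrow> triv_on_N u"
proof -
  have *: "triv_on_N (conj_pair G g u)" if u: "u \<in> pairs" and g: "g \<in> carrier G" and "triv_on_N u" for u g
  proof -
    obtain U \<phi> where U: "u = (U, \<phi>)" by (cases u)
    have "U \<subseteq> carrier G" using u by (auto simp: U pairs_def intro: subgroup.subset[THEN subsetD])
    moreover have "cj g x \<in> N" if "x \<in> N" for x
      using normal.inv_op_closed1[OF normal g that] by (simp add: cj_def)
    ultimately show ?thesis using that g by (auto simp: U triv_on_N_def mem_conj_set conj_hom_apply)
  qed
  show ?thesis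
    using *[OF u g] *[OF conj_pair_in_pairs[OF u g] inv_closed[OF g]] conj_pair_inv[OF u g] by auto
qed

lemma defl_pair_conj:
  assumes u: "u \<in> pairs" and g: "g \<in> carrier G" and t: "triv_on_N u"
  shows "defl_pair (conj_pair G g u) = conj_pair (G Mod N) (proj g) (defl_pair u)"
proof -
  obtain U \<phi> where U: "u = (U, \<phi>)" by (cases u)
  have sub: "subgroup U G" and Uc: "U \<subseteq> carrier G" and \<phi>: "\<phi> \<in> dual U"
    using u by (auto simp: U pairs_def dest: subgroup.subset)
  have pU: "proj ` U \<subseteq> carrier (G Mod N)" using Uc by auto
  have im: "proj ` conj_set G g U = conj_set (G Mod N) (proj g) (proj ` U)"
    using Uc g by (simp add: conj_set_image Q.conj_set_image[OF pU] image_image subset_iff)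
  have t': "triv_on_N (conj_set G g U, conj_hom G g U \<phi>)" using triv_on_N_conj[OF u g] t by (simp add: U)
  have sub': "subgroup (conj_set G g U) G" using sub g by (rule subgroup_conj_set)
  have d': "conj_hom G g U \<phi> \<in> dual (conj_set G g U)" using Uc g \<phi> by (rule conj_hom_dual)
  have "descend (conj_set G g U) (conj_hom G g U \<phi>) = conj_hom (G Mod N) (proj g) (proj ` U) (descend U \<phi>)"
  proof (rule Q.dual_eqI)
    show "descend (conj_set G g U) (conj_hom G g U \<phi>) \<in> Q.dual (proj ` conj_set G g U)"
      by (rule descend_dual[OF sub' d' t'])
    show "conj_hom (G Mod N) (proj g) (proj ` U) (descend U \<phi>) \<in> Q.dual (proj ` conj_set G g U)"
      unfolding im using t by (intro Q.conj_hom_dual pU descend_dual sub \<phi>) (simp_all add: U g)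
    fix C assume "C \<in> proj ` conj_set G g U"
    then obtain x where x: "x \<in> conj_set G g U" "C = proj x" by blast
    then have xc: "x \<in> carrier G" "cj g x \<in> U" using mem_conj_set[OF Uc g] by auto
    have "descend U \<phi> (proj (cj g x)) = \<phi> (cj g x)"
      using t xc by (intro descend_apply[OF sub \<phi>]) (simp_all add: U)
    then show "descend (conj_set G g U) (conj_hom G g U \<phi>) C =
        conj_hom (G Mod N) (proj g) (proj ` U) (descend U \<phi>) C"
      using x xc g by (simp add: descend_apply[OF sub' d' t'] conj_hom_apply[OF Uc g] Q.conj_hom_apply[OF pU])
  qed
  then show ?thesis by (simp add: U defl_pair_def im)
qed

lemma fib_defl_eq:
  fixes x :: "('g set \<times> ('g \<Rightarrow> 'a)) set \<Rightarrow>\<^sub>0 'k::field"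
  assumes x: "x \<in> fib_burnside A G"
  shows "fib_defl A G N x = lin_ext (\<lambda>c. if triv_on_N (rep c)
    then Poly_Mapping.single (pair_class (G Mod N) (defl_pair (rep c))) 1 else 0) x"
proof -
  have "(let (U, \<phi>) = rep c in
     if U \<inter> N \<subseteq> kernel (G\<lparr>carrier := U\<rparr>) A \<phi>
     then Poly_Mapping.single (pair_class (G Mod N)
              (quot_image G N U, \<lambda>C\<in>quot_image G N U. THE a. \<exists>u\<in>U. C = N #> u \<and> a = \<phi> u)) (1 :: 'k)
     else 0) = (if triv_on_N (rep c)
    then Poly_Mapping.single (pair_class (G Mod N) (defl_pair (rep c))) 1 else 0)"
    if "c \<in> Poly_Mapping.keys x" for c
  proof -
    obtain U \<phi> where U: "rep c = (U, \<phi>)" by (cases "rep c")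
    have "c \<in> pair_classes A G" using that x by (auto simp: fib_burnside_def)
    then have "subgroup U G" using rep_in_pairs(1)[of c] by (simp add: U pairs_def)
    moreover have "U \<inter> N \<subseteq> kernel (G\<lparr>carrier := U\<rparr>) A \<phi> \<longleftrightarrow> triv_on_N (U, \<phi>)"
      by (auto simp: kernel_def triv_on_N_def)
    ultimately show ?thesis by (simp add: U quot_image_eq descend_def defl_pair_def)
  qed
  then show ?thesis unfolding fib_defl_def lin_ext_def by (intro sum.cong refl arg_cong2[where f = scale])
qed

lemma fib_defl_closed:
  assumes x: "x \<in> fib_burnside A G"
  shows "fib_defl A G N x \<in> fib_burnside A (G Mod N)"
  unfolding fib_burnside_def mem_Collect_eq fib_defl_eq[OF x]
proof (rule keys_lin_ext_subset)
  fix c assume "c \<in> Poly_Mapping.keys x"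
  then have "rep c \<in> pairs" using x rep_in_pairs(1) by (auto simp: fib_burnside_def)
  then show "Poly_Mapping.keys (if triv_on_N (rep c)
    then Poly_Mapping.single (pair_class (G Mod N) (defl_pair (rep c))) 1 else 0) \<subseteq> pair_classes A (G Mod N)"
    by (auto simp: Q.pair_classes_eq defl_pair_in_pairs)
qed

text \<open>The species of \<open>G/N\<close> at \<open>q\<close> on the deflation of the class of \<open>u\<close>, see \<open>species_fib_defl\<close>.\<close>

definition defl_mark ::
    "'g set set \<times> (('g set \<Rightarrow> 'a) \<Rightarrow> 'k::field) \<Rightarrow> 'g set \<times> ('g \<Rightarrow> 'a) \<Rightarrow> 'k" where
  "defl_mark q u = (if triv_on_N u then Q.mark q (defl_pair u) else 0)"

lemma defl_mark_rep_pair_class: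
  assumes q: "q \<in> char_pairs A (G Mod N)" and u: "u \<in> pairs"
  shows "defl_mark q (rep (pair_class G u)) = defl_mark q u"
proof -
  obtain g where g: "g \<in> carrier G" "rep (pair_class G u) = conj_pair G g u" by (rule rep_pair_class[OF u])
  show ?thesis
    unfolding g(2) defl_mark_def
    using triv_on_N_conj[OF u g(1)] defl_pair_conj[OF u g(1)] defl_pair_in_pairs[OF u]
      Q.mark_conj[OF q _ proj_closed[OF g(1)]] by auto
qed

lemma species_fib_defl:
  fixes q :: "'g set set \<times> (('g set \<Rightarrow> 'a) \<Rightarrow> 'k::field_char_0)"
  assumes q: "q \<in> char_pairs A (G Mod N)" and x: "x \<in> fib_burnside A G"
  shows "species (G Mod N) q (fib_defl A G N x) = char_ext (\<lambda>c. defl_mark q (rep c)) x"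
proof -
  have "species (G Mod N) q (fib_defl A G N x) = char_ext (\<lambda>c. Q.mark q (rep c)) (fib_defl A G N x)"
    by (rule Q.species_eq[OF q fib_defl_closed[OF x]])
  also have "\<dots> = char_ext (\<lambda>c. defl_mark q (rep c)) x"
    unfolding fib_defl_eq[OF x] char_ext_lin_ext
  proof (rule char_ext_cong)
    fix c assume "c \<in> Poly_Mapping.keys x"
    then have "rep c \<in> pairs" using x rep_in_pairs(1) by (auto simp: fib_burnside_def)
    then show "char_ext (\<lambda>c. Q.mark q (rep c)) (if triv_on_N (rep c)
      then Poly_Mapping.single (pair_class (G Mod N) (defl_pair (rep c))) 1 else 0) = defl_mark q (rep c)"
      by (simp add: defl_mark_def Q.mark_rep_pair_class[OF q defl_pair_in_pairs])
  qed
  finally show ?thesis .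
qed

end

section \<open>Deflation of the idempotents\<close>

locale split_fibered_normal = split_fibered_group A G K + fibered_normal A G N
  for A :: "('a, 'n) monoid_scheme" and G :: "('g, 'm) monoid_scheme" (structure)
    and K :: "'k::field_char_0 itself" and N +
  assumes split_Mod: "split_fibered_group A (G Mod N) K"
begin

sublocale Q: split_fibered_group A "G Mod N" K
  by (rule split_Mod)

text \<open>The counterpart of \<open>val\<close> for the species of a deflation. The factor is \<open>|U \<inter> N| = |U| / |UN/N|\<close>: the
  coefficient \<open>|U|\<close> comes from the idempotent, the division by \<open>|UN/N|\<close> from the species.\<close>

definition defl_val :: "'g set set \<times> (('g set \<Rightarrow> 'a) \<Rightarrow> 'k) \<Rightarrow> 'g set \<times> ('g \<Rightarrow> 'a) \<Rightarrow> 'k" where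
  "defl_val q u = (if triv_on_N u then of_nat (card (fst u \<inter> N)) * Q.val q (defl_pair u) else 0)"

text \<open>The contribution of one conjugate of \<open>q\<close> to the species at \<open>q\<close> of the deflated idempotent, up
  to a constant.\<close>

definition defl_inner ::
    "'g set \<times> (('g \<Rightarrow> 'a) \<Rightarrow> 'k) \<Rightarrow> 'g set set \<times> (('g set \<Rightarrow> 'a) \<Rightarrow> 'k) \<Rightarrow> 'k" where
  "defl_inner p q = (\<Sum>L\<in>{L. subgroup L G \<and> L \<subseteq> fst p}. \<Sum>\<phi>\<in>dual (fst p).
     of_int (moebius {L. subgroup L G} L (fst p)) * inverse (snd p \<phi>) * defl_val q (L, restrict \<phi> L))"

lemma species_defl_idem:
  assumes p: "p \<in> char_pairs A G" and q: "q \<in> char_pairs A (G Mod N)"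
  shows "species (G Mod N) q (fib_defl A G N (idem p)) =
    (\<Sum>g\<in>carrier (G Mod N). defl_inner p (Q.act g q)) /
    (of_nat (card (dual (fst p))) * of_nat (card {g \<in> carrier G. act g p = p}))"
proof -
  define C where "C = (of_nat (card (dual (fst p))) * of_nat (card {g \<in> carrier G. act g p = p}) :: 'k)"
  let ?m = "\<lambda>L. of_int (moebius {L. subgroup L G} L (fst p)) :: 'k"
  let ?q = "\<lambda>g. Q.act g q"
  have "species (G Mod N) q (fib_defl A G N (idem p)) =
      (\<Sum>L\<in>{L. subgroup L G \<and> L \<subseteq> fst p}. \<Sum>\<phi>\<in>dual (fst p). idem_coeff p L \<phi> * defl_mark q (L, restrict \<phi> L))"
    unfolding species_fib_defl[OF q idem_in_fib_burnside]
    by (rule char_ext_idem) (rule defl_mark_rep_pair_class[OF q])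
  also have "\<dots> = (\<Sum>L\<in>{L. subgroup L G \<and> L \<subseteq> fst p}. \<Sum>\<phi>\<in>dual (fst p). \<Sum>g\<in>carrier (G Mod N).
     ?m L * inverse (snd p \<phi>) * defl_val (?q g) (L, restrict \<phi> L)) / C"
  proof -
    have "idem_coeff p L \<phi> * defl_mark q (L, restrict \<phi> L) =
      (\<Sum>g\<in>carrier (G Mod N). ?m L * inverse (snd p \<phi>) * defl_val (?q g) (L, restrict \<phi> L)) / C"
      if L: "subgroup L G" for L \<phi>
    proof (cases "triv_on_N (L, restrict \<phi> L)")
      case True
      define S where "S = (\<Sum>g\<in>carrier (G Mod N). Q.val (?q g) (defl_pair (L, restrict \<phi> L)))"
      (* Of the factor |L| in the coefficient, the division by |LN/N| in the species leaves |L \<inter> N|. *)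
      have c: "of_nat (card L) = (of_nat (card (proj ` L)) * of_nat (card (L \<inter> N)) :: 'k)"
        using card_proj_image[OF L] by (metis of_nat_mult)
      have "card (proj ` L) > 0" by (rule Q.subgroup_card_pos[OF subgroup_proj_image[OF L]])
      then have "idem_coeff p L \<phi> * defl_mark q (L, restrict \<phi> L) =
          ?m L * inverse (snd p \<phi>) * of_nat (card (L \<inter> N)) * S / C"
        unfolding idem_coeff_def c
        by (simp add: defl_mark_def Q.mark_def C_def True defl_pair_def S_def)
      also have "\<dots> = (\<Sum>g\<in>carrier (G Mod N). ?m L * inverse (snd p \<phi>) * of_nat (card (L \<inter> N)) *
          Q.val (?q g) (defl_pair (L, restrict \<phi> L))) / C"
        by (simp only: S_def sum_distrib_left)
      finally show ?thesis using True by (simp add: defl_val_def mult.assoc)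
    qed (simp add: defl_mark_def defl_val_def)
    then show ?thesis by (simp add: sum_divide_distrib)
  qed
  also have "\<dots> = (\<Sum>g\<in>carrier (G Mod N). defl_inner p (?q g)) / C"
    unfolding defl_inner_def by (subst (2) sum.swap, subst (3) sum.swap) (rule refl)
  finally show ?thesis by (simp add: C_def)
qed

lemma defl_inner_swap:
  "defl_inner p q = (\<Sum>\<phi>\<in>dual (fst p). inverse (snd p \<phi>) *
     (\<Sum>L\<in>{L. subgroup L G \<and> L \<subseteq> fst p}. of_int (moebius {L. subgroup L G} L (fst p)) * defl_val q (L, restrict \<phi> L)))"
  unfolding defl_inner_def by (subst sum.swap) (simp add: sum_distrib_left mult_ac)

text \<open>Everything is decided inside the preimage of \<open>E\<close>: it contains \<open>N\<close>, hence \<open>L \<inter> N\<close>; a coset in \<open>E\<close> that meets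
  \<open>L\<close> meets it in elements of the preimage; and \<open>\<Psi>\<close> sees the induced homomorphism on such cosets only.\<close>

lemma defl_val_Int:
  assumes q: "(E, \<Psi>) \<in> char_pairs A (G Mod N)" and H: "subgroup H G" and \<phi>: "\<phi> \<in> dual H"
    and L: "subgroup L G" "L \<subseteq> H"
  defines "Y \<equiv> H \<inter> {x \<in> carrier G. proj x \<in> E}"
  shows "defl_val (E, \<Psi>) (L, restrict \<phi> L) = defl_val (E, \<Psi>) (L \<inter> Y, restrict \<phi> (L \<inter> Y))"
proof -
  have E: "subgroup E (G Mod N)" using q by (simp add: Q.char_pairs_iff)
  note pre = subgroup_preimage[OF E]
  have Y: "subgroup Y G" unfolding Y_def by (rule subgroups_Inter_pair[OF H pre(1)])
  have LY: "subgroup (L \<inter> Y) G" by (rule subgroups_Inter_pair[OF L(1) Y])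
  have N: "L \<inter> Y \<inter> N = L \<inter> N" using pre(2) L by (auto simp: Y_def)
  have triv: "triv_on_N (L \<inter> Y, restrict \<phi> (L \<inter> Y)) \<longleftrightarrow> triv_on_N (L, restrict \<phi> L)"
    using N by (auto simp: triv_on_N_def)
  have sub: "E \<subseteq> proj ` (L \<inter> Y)" if EL: "E \<subseteq> proj ` L"
  proof
    fix C assume C: "C \<in> E"
    then obtain x where "x \<in> L" "C = proj x" using EL by blast
    then show "C \<in> proj ` (L \<inter> Y)" using C L subgroup.mem_carrier[OF L(1)] by (auto simp: Y_def)
  qed
  have val: "Q.val (E, \<Psi>) (defl_pair (L, restrict \<phi> L)) = Q.val (E, \<Psi>) (defl_pair (L \<inter> Y, restrict \<phi> (L \<inter> Y)))"
    if t: "triv_on_N (L, restrict \<phi> L)"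
  proof (cases "E \<subseteq> proj ` L")
    case True
    have "restrict (descend L (restrict \<phi> L)) E = restrict (descend (L \<inter> Y) (restrict \<phi> (L \<inter> Y))) E"
    proof (rule restrict_ext)
      fix C assume C: "C \<in> E"
      then obtain x where x: "x \<in> L \<inter> Y" "C = proj x" using sub[OF True] by blast
      have "descend L (restrict \<phi> L) C = \<phi> x"
        using descend_apply[OF L(1) dual_restrict[OF \<phi> L] t, of x] x by simp
      moreover have "descend (L \<inter> Y) (restrict \<phi> (L \<inter> Y)) C = \<phi> x"
        using descend_apply[OF LY dual_restrict[OF \<phi> LY], of x] t triv x L by auto
      ultimately show "descend L (restrict \<phi> L) C = descend (L \<inter> Y) (restrict \<phi> (L \<inter> Y)) C" by simp
    qed
    then show ?thesis using True sub by (simp add: Q.val_def defl_pair_def)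
  next
    case False
    then have "\<not> E \<subseteq> proj ` (L \<inter> Y)" by blast
    then show ?thesis using False by (simp add: Q.val_def defl_pair_def)
  qed
  show ?thesis by (simp add: defl_val_def triv N val)
qed

text \<open>If the preimage of \<open>E\<close> did not contain \<open>H\<close>, then \<open>defl_val_Int\<close> and Weisner's theorem would make the
  sum over \<open>L\<close> vanish for each \<open>\<phi>\<close>. So \<open>E\<close> contains \<open>HN/N\<close>; and \<open>E \<subseteq> LN/N\<close> for the \<open>L\<close> of a nonzero term.\<close>

lemma defl_inner_support:
  assumes p: "(H, \<Phi>) \<in> char_pairs A G" and q: "(E, \<Psi>) \<in> char_pairs A (G Mod N)"
    and nz: "defl_inner (H, \<Phi>) (E, \<Psi>) \<noteq> 0"
  shows "E = proj ` H"
proof -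
  have H: "subgroup H G" using p by (simp add: char_pairs_iff)
  have E: "subgroup E (G Mod N)" using q by (simp add: Q.char_pairs_iff)
  let ?Q = "{L. subgroup L G}"
  define Y where "Y = H \<inter> {x \<in> carrier G. proj x \<in> E}"
  have Y: "subgroup Y G" unfolding Y_def by (rule subgroups_Inter_pair[OF H subgroup_preimage(1)[OF E]])
  (* Otherwise Y is a proper subgroup of H, and the theorem of Weisner applies to it. *)
  have "Y = H"
  proof (rule ccontr)
    assume "Y \<noteq> H"
    then have YH: "Y \<subset> H" by (auto simp: Y_def)
    have "(\<Sum>L\<in>{L. subgroup L G \<and> L \<subseteq> H}. of_int (moebius ?Q L H) * defl_val (E, \<Psi>) (L, restrict \<phi> L)) = 0"
      if \<phi>: "\<phi> \<in> dual H" for \<phi>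
    proof -
      have "(\<Sum>L | L \<in> ?Q \<and> L \<subseteq> H. of_int (moebius ?Q L H) * defl_val (E, \<Psi>) (L, restrict \<phi> L)) = 0"
      proof (rule weisner[OF finite_subgroups _ _ _ _ YH])
        show "finite z" if "z \<in> ?Q" for z using that subgroup_finite by simp
        show "x \<inter> y \<in> ?Q" if "x \<in> ?Q" "y \<in> ?Q" for x y using that subgroups_Inter_pair by simp
        show "defl_val (E, \<Psi>) (z, restrict \<phi> z) = defl_val (E, \<Psi>) (z \<inter> Y, restrict \<phi> (z \<inter> Y))"
          if "z \<in> ?Q" "z \<subseteq> H" for z
          using defl_val_Int[OF q H \<phi>, of z] that by (simp add: Y_def)
      qed (use H Y in auto)
      then show ?thesis by simp
    qed
    then show False using nz by (simp add: defl_inner_swap)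
  qed
  then have "proj ` H \<subseteq> E" by (auto simp: Y_def)
  moreover have "E \<subseteq> proj ` H"
  proof (rule ccontr)
    assume "\<not> E \<subseteq> proj ` H"
    then have "\<not> E \<subseteq> proj ` L" if "L \<subseteq> H" for L using that by blast
    then have "defl_val (E, \<Psi>) (L, restrict \<phi> L) = 0" if "L \<subseteq> H" for L \<phi>
      using that by (simp add: defl_val_def Q.val_def defl_pair_def)
    then have "defl_inner (H, \<Phi>) (E, \<Psi>) = 0" unfolding defl_inner_def by (intro sum.neutral ballI) auto
    then show False using nz by simp
  qed
  ultimately show ?thesis by blast
qed

lemma defl_val_inflate:
  assumes H: "subgroup H G" and \<Psi>: "\<Psi> \<in> Q.kchars (proj ` H)" and \<phi>: "\<phi> \<in> dual H"
    and \<psi>: "\<psi> \<in> Q.dual (proj ` H)" and L: "subgroup L G" "L \<subseteq> H"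
  shows "defl_val (proj ` H, \<Psi>) (L, restrict (\<phi> \<otimes>\<^bsub>dgroup H\<^esub> inflate H \<psi>) L) =
    defl_val (proj ` H, \<Psi>) (L, restrict \<phi> L) * \<Psi> \<psi>"
proof -
  define \<theta> where "\<theta> = \<phi> \<otimes>\<^bsub>dgroup H\<^esub> inflate H \<psi>"
  have i: "inflate H \<psi> \<in> dual H" by (rule inflate_dual[OF H \<psi>])
  have \<theta>: "\<theta> \<in> dual H" unfolding \<theta>_def by (rule dual_mult_closed[OF H \<phi> i])
  have ap: "\<theta> x = \<phi> x \<otimes>\<^bsub>A\<^esub> \<psi> (proj x)" if "x \<in> H" for x using that by (simp add: \<theta>_def inflate_def)
  have eqN: "\<theta> x = \<phi> x" if "x \<in> H" "x \<in> N" for x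
    using ap[OF that(1)] inflate_triv[OF H \<psi> that] dualD(1)[OF \<phi> that(1)] that by (simp add: inflate_def)
  have triv: "triv_on_N (L, restrict \<theta> L) \<longleftrightarrow> triv_on_N (L, restrict \<phi> L)"
    unfolding triv_on_N_def fst_conv snd_conv by (intro ball_cong refl) (use eqN L in auto)
  have "Q.val (proj ` H, \<Psi>) (defl_pair (L, restrict \<theta> L)) = Q.val (proj ` H, \<Psi>) (defl_pair (L, restrict \<phi> L)) * \<Psi> \<psi>"
    if t: "triv_on_N (L, restrict \<phi> L)"
  proof (cases "proj ` H \<subseteq> proj ` L")
    case True
    then have im: "proj ` L = proj ` H" using L by blast
    have d: "descend L (restrict \<phi> L) \<in> Q.dual (proj ` H)"
      using descend_dual[OF L(1) dual_restrict[OF \<phi> L] t] im by simp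
    have d': "descend L (restrict \<theta> L) \<in> Q.dual (proj ` H)"
      using descend_dual[OF L(1) dual_restrict[OF \<theta> L]] t triv im by simp
    have "descend L (restrict \<theta> L) = descend L (restrict \<phi> L) \<otimes>\<^bsub>Q.dgroup (proj ` H)\<^esub> \<psi>"
    proof (rule Q.dual_eqI[OF d' Q.dual_mult_closed[OF subgroup_proj_image[OF H] d \<psi>]])
      fix C assume C: "C \<in> proj ` H"
      then obtain x where x: "x \<in> L" "C = proj x" using im by blast
      then show "descend L (restrict \<theta> L) C =
          (descend L (restrict \<phi> L) \<otimes>\<^bsub>Q.dgroup (proj ` H)\<^esub> \<psi>) C"
        using descend_apply[OF L(1) dual_restrict[OF \<phi> L] t x(1)]
          descend_apply[OF L(1) dual_restrict[OF \<theta> L] _ x(1)] t triv ap C L by (auto simp: subset_iff)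
    qed
    then have "\<Psi> (descend L (restrict \<theta> L)) = \<Psi> (descend L (restrict \<phi> L)) * \<Psi> \<psi>"
      using Q.charsD(3)[OF \<Psi> d \<psi>] by simp
    moreover have "restrict (descend L (restrict \<theta> L)) (proj ` H) = descend L (restrict \<theta> L)"
      "restrict (descend L (restrict \<phi> L)) (proj ` H) = descend L (restrict \<phi> L)"
      using d d' by (simp_all add: carrier_hom_group extensional_restrict)
    ultimately show ?thesis using im by (simp add: Q.val_def defl_pair_def)
  qed (simp add: Q.val_def defl_pair_def)
  then show ?thesis unfolding \<theta>_def[symmetric] by (simp add: defl_val_def triv)
qed

lemma char_quot_char_pair:
  assumes p: "(H, \<Phi> :: ('g \<Rightarrow> 'a) \<Rightarrow> 'k) \<in> char_pairs A G"
  shows "(quot_image G N H, char_quot A G N H \<Phi>) \<in> char_pairs A (G Mod N)"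
proof -
  have H: "subgroup H G" and \<Phi>: "\<Phi> \<in> chars H" using p by (auto simp: char_pairs_iff)
  note D = charsD[OF \<Phi>] and i = inflate_dual[OF H]
  show ?thesis
    unfolding quot_image_eq[OF H] char_quot_eq[OF H] Q.char_pairs_iff
  proof (intro conjI Q.charsI)
    fix \<psi> \<psi>' assume \<psi>: "\<psi> \<in> Q.dual (proj ` H)" and \<psi>': "\<psi>' \<in> Q.dual (proj ` H)"
    then show "(\<lambda>\<psi>\<in>Q.dual (proj ` H). \<Phi> (inflate H \<psi>)) (\<psi> \<otimes>\<^bsub>Q.dgroup (proj ` H)\<^esub> \<psi>') =
      (\<lambda>\<psi>\<in>Q.dual (proj ` H). \<Phi> (inflate H \<psi>)) \<psi> * (\<lambda>\<psi>\<in>Q.dual (proj ` H). \<Phi> (inflate H \<psi>)) \<psi>'"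
      using D(3)[OF i i, OF \<psi> \<psi>'] Q.dual_mult_closed[OF subgroup_proj_image[OF H] \<psi> \<psi>']
      by (simp add: inflate_mult del: hom_group_simps)
  qed (use H subgroup_proj_image D(2) i in auto)
qed

text \<open>Replacing \<open>\<phi>\<close> by its product with an inflation permutes the summands and multiplies each of them by the
  same factor, which must be \<open>1\<close>.\<close>

lemma defl_inner_nonzero:
  assumes p: "(H, \<Phi>) \<in> char_pairs A G" and q: "q \<in> char_pairs A (G Mod N)"
    and nz: "defl_inner (H, \<Phi>) q \<noteq> 0"
  shows "q = (quot_image G N H, char_quot A G N H \<Phi>)"
proof -
  obtain E \<Psi> where qE: "q = (E, \<Psi>)" by (cases q)
  have H: "subgroup H G" and \<Phi>: "\<Phi> \<in> chars H" using p by (auto simp: char_pairs_iff)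
  have E: "E = proj ` H" using defl_inner_support[OF p] q nz by (simp add: qE)
  have \<Psi>: "\<Psi> \<in> Q.kchars (proj ` H)" using q E by (simp add: qE Q.char_pairs_iff)
  interpret M: comm_group "dgroup H" by (rule comm_group_dual[OF H])
  define T where "T \<phi> = (\<Sum>L\<in>{L. subgroup L G \<and> L \<subseteq> H}. of_int (moebius {L. subgroup L G} L H) *
      defl_val (proj ` H, \<Psi>) (L, restrict \<phi> L))" for \<phi>
  have inner: "defl_inner (H, \<Phi>) q = (\<Sum>\<phi>\<in>dual H. inverse (\<Phi> \<phi>) * T \<phi>)"
    by (simp add: defl_inner_swap T_def qE E)
  have "\<Psi> \<psi> = \<Phi> (inflate H \<psi>)" if \<psi>: "\<psi> \<in> Q.dual (proj ` H)" for \<psi>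
  proof -
    have i: "inflate H \<psi> \<in> dual H" by (rule inflate_dual[OF H \<psi>])
    have T: "T (\<phi> \<otimes>\<^bsub>dgroup H\<^esub> inflate H \<psi>) = T \<phi> * \<Psi> \<psi>" if "\<phi> \<in> dual H" for \<phi>
      unfolding T_def sum_distrib_right
      by (intro sum.cong refl) (simp add: defl_val_inflate[OF H \<Psi> that \<psi>] del: hom_group_simps)
    have "defl_inner (H, \<Phi>) q = (\<Sum>\<phi>\<in>dual H. inverse (\<Phi> (\<phi> \<otimes>\<^bsub>dgroup H\<^esub> inflate H \<psi>)) *
        T (\<phi> \<otimes>\<^bsub>dgroup H\<^esub> inflate H \<psi>))"
      unfolding inner
      by (rule sum_group_translate[OF M.is_group i, of "\<lambda>\<phi>. inverse (\<Phi> \<phi>) * T \<phi>", symmetric])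
    also have "\<dots> = (\<Sum>\<phi>\<in>dual H. (inverse (\<Phi> (inflate H \<psi>)) * \<Psi> \<psi>) * (inverse (\<Phi> \<phi>) * T \<phi>))"
      by (intro sum.cong refl) (simp add: T charsD(3)[OF \<Phi> _ i] del: hom_group_simps)
    also have "\<dots> = (inverse (\<Phi> (inflate H \<psi>)) * \<Psi> \<psi>) * defl_inner (H, \<Phi>) q"
      by (simp only: inner sum_distrib_left)
    finally have "inverse (\<Phi> (inflate H \<psi>)) * \<Psi> \<psi> = 1" using nz by simp
    then show ?thesis using charsD(2)[OF \<Phi> i] by (simp add: field_simps)
  qed
  then have "\<Psi> = (\<lambda>\<psi>\<in>Q.dual (proj ` H). \<Phi> (inflate H \<psi>))"
    using Q.charsD(1)[OF \<Psi>] by (auto simp: fun_eq_iff)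
  then show ?thesis by (simp add: qE E quot_image_eq[OF H] char_quot_eq[OF H])
qed

text \<open>By \<open>defl_inner_nonzero\<close> the species of the deflated idempotent vanish except at the conjugates of
  one pair; so it is its species there, times the idempotent of that pair.\<close>

theorem fib_defl_idem:
  assumes p: "(H, \<Phi> :: ('g \<Rightarrow> 'a) \<Rightarrow> 'k) \<in> char_pairs A G"
  shows "\<exists>m. fib_defl A G N (fib_idem A G (H, \<Phi>)) =
    scale m (fib_idem A (G Mod N) (quot_image G N H, char_quot A G N H \<Phi>))"
proof -
  define q0 where "q0 = (quot_image G N H, char_quot A G N H \<Phi>)"
  have q0: "q0 \<in> char_pairs A (G Mod N)" unfolding q0_def by (rule char_quot_char_pair[OF p])
  define y where "y = fib_defl A G N (idem (H, \<Phi>))"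
  have y: "y \<in> fib_burnside A (G Mod N)" unfolding y_def by (rule fib_defl_closed[OF idem_in_fib_burnside])
  define m where "m = species (G Mod N) q0 y"
  note id = Q.idem_in_fib_burnside[of q0]
  have "y = scale m (Q.idem q0)"
  proof (rule Q.species_eqI[OF y Q.scale_in_fib_burnside[OF id]])
    fix q :: "'g set set \<times> (('g set \<Rightarrow> 'a) \<Rightarrow> 'k)"
    assume q: "q \<in> char_pairs A (G Mod N)"
    show "species (G Mod N) q y = species (G Mod N) q (scale m (Q.idem q0))"
    proof (cases "\<exists>g\<in>carrier (G Mod N). q = Q.act g q0")
      case True
      then show ?thesis
        using Q.species_conj_char_pair[OF q0 _ y]
        by (auto simp: Q.species_scale[OF q id] Q.species_idem[OF q0 q] m_def)
    next
      case False
      have "defl_inner (H, \<Phi>) (Q.act g q) = 0" if g: "g \<in> carrier (G Mod N)" for g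
      proof (rule ccontr)
        assume "defl_inner (H, \<Phi>) (Q.act g q) \<noteq> 0"
        then have "Q.act g q = q0"
          unfolding q0_def by (rule defl_inner_nonzero[OF p Q.conj_char_pair_in_char_pairs[OF q g]])
        then have "q = Q.act (inv\<^bsub>G Mod N\<^esub> g) q0"
          using Q.conj_char_pair_inv(1)[OF q g] by simp
        then show False using False Q.inv_closed[OF g] by blast
      qed
      then have "species (G Mod N) q y = 0" unfolding y_def species_defl_idem[OF p q] by simp
      then show ?thesis using False by (simp add: Q.species_scale[OF q id] Q.species_idem[OF q0 q])
    qed
  qed
  then show ?thesis by (auto simp: y_def fib_idem_eq[OF p] Q.fib_idem_eq[OF q0] q0_def[symmetric])
qed

lemma proj_image_full_iff:
  assumes L: "subgroup L G"
  shows "proj ` L = carrier (G Mod N) \<longleftrightarrow> L <#> N = carrier G"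
proof
  assume "L <#> N = carrier G"
  then show "proj ` L = carrier (G Mod N)" using proj_set_mult[OF L] by (simp add: carrier_FactGroup)
next
  assume full: "proj ` L = carrier (G Mod N)"
  show "L <#> N = carrier G"
  proof
    show "L <#> N \<subseteq> carrier G"
      using subgroup.mem_carrier[OF L] N_subset by (auto simp: set_mult_def)
    show "carrier G \<subseteq> L <#> N"
    proof
      fix x assume x: "x \<in> carrier G"
      then have "proj x \<in> proj ` L" using full by simp
      then obtain l where l: "l \<in> L" "proj x = proj l" by blast
      have lc: "l \<in> carrier G" using l subgroup.mem_carrier[OF L] by simp
      have "x \<otimes> inv l \<in> N" using l proj_eq_iff[OF x lc] by simp
      then have "inv l \<otimes> (x \<otimes> inv l) \<otimes> l \<in> N" by (rule normal.inv_op_closed1[OF normal lc])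
      moreover have "inv l \<otimes> (x \<otimes> inv l) \<otimes> l = inv l \<otimes> x" using x lc by (simp add: group_word_simps)
      moreover have "l \<otimes> (inv l \<otimes> x) = x" using x lc by (simp add: group_word_simps)
      ultimately show "x \<in> L <#> N" using l(1) unfolding set_mult_def by (metis UN_I singletonI)
    qed
  qed
qed

abbreviation dualG :: "('g \<Rightarrow> 'a) monoid" where
  "dualG \<equiv> hom_group A G"

abbreviation dualQ :: "('g set \<Rightarrow> 'a) monoid" where
  "dualQ \<equiv> hom_group A (G Mod N)"

abbreviation lift :: "('g \<Rightarrow> 'a) \<Rightarrow> ('g set \<Rightarrow> 'a) \<Rightarrow> 'g \<Rightarrow> 'a" where
  "lift \<kappa> \<psi> \<equiv> \<kappa> \<otimes>\<^bsub>dualG\<^esub> inflate (carrier G) \<psi>"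

lemma annihilator_subgroup: "subgroup (annihilator A G L) (dualG)"
  if L: "L \<subseteq> carrier G"
proof -
  interpret M: comm_group "dualG" by (rule comm_group_hom_group[OF A.comm_group_axioms is_group])
  show ?thesis
  proof (rule M.subgroupI)
    show "annihilator A G L \<noteq> {}" using M.one_closed L by (auto simp: annihilator_def intro!: exI[of _ "\<one>\<^bsub>dualG\<^esub>"])
    show "inv\<^bsub>dualG\<^esub> \<phi> \<in> annihilator A G L" if \<phi>: "\<phi> \<in> annihilator A G L" for \<phi>
    proof -
      have \<phi>c: "\<phi> \<in> carrier (dualG)" using \<phi> by (simp add: annihilator_def)
      have "(inv\<^bsub>dualG\<^esub> \<phi>) x = \<one>\<^bsub>A\<^esub>" if x: "x \<in> L" for x
      proof -
        have xc: "x \<in> carrier G" using x L by blast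
        have "(\<phi> \<otimes>\<^bsub>dualG\<^esub> inv\<^bsub>dualG\<^esub> \<phi>) x = \<one>\<^bsub>dualG\<^esub> x"
          using M.r_inv[OF \<phi>c] by (rule arg_cong)
        then have "\<phi> x \<otimes>\<^bsub>A\<^esub> (inv\<^bsub>dualG\<^esub> \<phi>) x = \<one>\<^bsub>A\<^esub>" using xc by simp
        moreover have "\<phi> x = \<one>\<^bsub>A\<^esub>" using \<phi> x by (simp add: annihilator_def)
        ultimately show ?thesis using hom_group_memD(1)[OF M.inv_closed[OF \<phi>c] xc] by simp
      qed
      then show ?thesis using M.inv_closed[OF \<phi>c] by (simp add: annihilator_def)
    qed
    show "\<phi> \<otimes>\<^bsub>dualG\<^esub> \<psi> \<in> annihilator A G L"
      if "\<phi> \<in> annihilator A G L" "\<psi> \<in> annihilator A G L" for \<phi> \<psi>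
      using that M.m_closed[of \<phi> \<psi>] L by (auto simp: annihilator_def)
  qed (auto simp: annihilator_def)
qed

text \<open>For \<open>\<phi>\<close> trivial on \<open>L \<inter> N\<close>, the homomorphism \<open>\<psi>\<close> that \<open>\<phi>|\<^sub>L\<close> induces on \<open>LN/N = G/N\<close> inflates to one that
  agrees with \<open>\<phi>\<close> on \<open>L\<close>; the quotient of the two is the component in the annihilator. The component \<open>\<psi>\<close> is
  recovered by \<open>descend\<close>, which is the second claim.\<close>

lemma triv_bij:
  assumes L: "subgroup L G" and full: "proj ` L = carrier (G Mod N)"
  shows "bij_betw (\<lambda>(\<kappa>, \<psi>). lift \<kappa> \<psi>)
      (annihilator A G L \<times> carrier (dualQ))
      {\<phi> \<in> carrier (dualG). triv_on_N (L, restrict \<phi> L)}"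
    and "\<And>\<kappa> \<psi>. \<kappa> \<in> annihilator A G L \<Longrightarrow> \<psi> \<in> carrier (dualQ) \<Longrightarrow>
      descend L (restrict (lift \<kappa> \<psi>) L) = \<psi>"
proof -
  interpret M: comm_group "dualG" by (rule comm_group_hom_group[OF A.comm_group_axioms is_group])
  have Lc: "x \<in> carrier G" if "x \<in> L" for x using that subgroup.mem_carrier[OF L] by simp
  have ann: "\<kappa> \<in> carrier (dualG)" "\<And>x. x \<in> L \<Longrightarrow> \<kappa> x = \<one>\<^bsub>A\<^esub>" if "\<kappa> \<in> annihilator A G L" for \<kappa>
    using that by (auto simp: annihilator_def)
  have full': "proj ` carrier G = carrier (G Mod N)" by (simp add: carrier_FactGroup)
  have infl: "inflate (carrier G) \<psi> \<in> carrier (dualG)" if "\<psi> \<in> carrier (dualQ)" for \<psi>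
    using inflate_dual[OF subgroup_self, of \<psi>] that by (simp add: full')
  have res: "restrict \<phi> L \<in> dual L" if "\<phi> \<in> carrier (dualG)" for \<phi>
    by (rule dual_restrict[of _ "carrier G"]) (use that L Lc in auto)
  have ap: "(lift \<kappa> \<psi>) x = \<psi> (proj x)"
    if \<kappa>: "\<kappa> \<in> annihilator A G L" and \<psi>: "\<psi> \<in> carrier (dualQ)" and x: "x \<in> L" for \<kappa> \<psi> x
    using ann(2)[OF \<kappa> x] Lc[OF x] hom_group_memD(1)[OF \<psi>, of "proj x"] by (simp add: inflate_def)
  have trv: "triv_on_N (L, restrict (lift \<kappa> \<psi>) L)"
    if \<kappa>: "\<kappa> \<in> annihilator A G L" and \<psi>: "\<psi> \<in> carrier (dualQ)" for \<kappa> \<psi>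
  proof -
    have "\<psi> (proj x) = \<one>\<^bsub>A\<^esub>" if "x \<in> L" "x \<in> N" for x
      using inflate_triv[OF subgroup_self, of \<psi> x] \<psi> Lc that by (simp add: full' inflate_def)
    then show ?thesis using ap[OF \<kappa> \<psi>] by (simp add: triv_on_N_def del: hom_group_simps)
  qed
  have closed: "lift \<kappa> \<psi> \<in> carrier (dualG)"
    if "\<kappa> \<in> annihilator A G L" "\<psi> \<in> carrier (dualQ)" for \<kappa> \<psi>
    using M.m_closed[OF ann(1) infl] that by blast
  show desc: "descend L (restrict (lift \<kappa> \<psi>) L) = \<psi>"
    if \<kappa>: "\<kappa> \<in> annihilator A G L" and \<psi>: "\<psi> \<in> carrier (dualQ)" for \<kappa> \<psi>
  proof (rule hom_group_eqI[OF _ \<psi>])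
    note r = res[OF closed[OF \<kappa> \<psi>]]
    show "descend L (restrict (lift \<kappa> \<psi>) L) \<in> carrier (dualQ)"
      using descend_dual[OF L r trv[OF \<kappa> \<psi>]] by (simp add: full del: hom_group_simps)
    fix C assume "C \<in> carrier (G Mod N)"
    then obtain x where x: "x \<in> L" "C = proj x" using full by blast
    then show "descend L (restrict (lift \<kappa> \<psi>) L) C = \<psi> C"
      using descend_apply[OF L r trv[OF \<kappa> \<psi>] x(1)] ap[OF \<kappa> \<psi> x(1)] by (simp del: hom_group_simps)
  qed
  define D where "D \<phi> = descend L (restrict \<phi> L)" for \<phi> :: "'g \<Rightarrow> 'a"
  have Dc: "D \<phi> \<in> carrier (dualQ)"
    if "\<phi> \<in> carrier (dualG)" "triv_on_N (L, restrict \<phi> L)" for \<phi>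
    using descend_dual[OF L res[OF that(1)] that(2)] by (simp add: full D_def)
  show "bij_betw (\<lambda>(\<kappa>, \<psi>). lift \<kappa> \<psi>)
      (annihilator A G L \<times> carrier (dualQ))
      {\<phi> \<in> carrier (dualG). triv_on_N (L, restrict \<phi> L)}"
  proof (rule bij_betwI[of _ _ _ "\<lambda>\<phi>. (\<phi> \<otimes>\<^bsub>dualG\<^esub> inv\<^bsub>dualG\<^esub> inflate (carrier G) (D \<phi>), D \<phi>)"])
    show "(\<lambda>(\<kappa>, \<psi>). lift \<kappa> \<psi>)
        \<in> annihilator A G L \<times> carrier (dualQ) \<rightarrow> {\<phi> \<in> carrier (dualG). triv_on_N (L, restrict \<phi> L)}"
      using closed trv by (auto simp del: hom_group_simps)
    show "(\<lambda>\<phi>. (\<phi> \<otimes>\<^bsub>dualG\<^esub> inv\<^bsub>dualG\<^esub> inflate (carrier G) (D \<phi>), D \<phi>))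
        \<in> {\<phi> \<in> carrier (dualG). triv_on_N (L, restrict \<phi> L)} \<rightarrow> annihilator A G L \<times> carrier (dualQ)"
    proof (rule funcsetI)
      fix \<phi> assume "\<phi> \<in> {\<phi> \<in> carrier (dualG). triv_on_N (L, restrict \<phi> L)}"
      then have \<phi>: "\<phi> \<in> carrier (dualG)" and t: "triv_on_N (L, restrict \<phi> L)" by auto
      define \<theta> where "\<theta> = inflate (carrier G) (D \<phi>)"
      have \<theta>: "\<theta> \<in> carrier (dualG)" unfolding \<theta>_def by (rule infl[OF Dc[OF \<phi> t]])
      have "(\<phi> \<otimes>\<^bsub>dualG\<^esub> inv\<^bsub>dualG\<^esub> \<theta>) x = \<one>\<^bsub>A\<^esub>" if x: "x \<in> L" for x
      proof -
        have "\<theta> x = \<phi> x"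
          using descend_apply[OF L res[OF \<phi>] t x] x Lc[OF x] by (simp add: \<theta>_def D_def inflate_def)
        moreover have "(\<theta> \<otimes>\<^bsub>dualG\<^esub> inv\<^bsub>dualG\<^esub> \<theta>) x = \<one>\<^bsub>dualG\<^esub> x"
          using M.r_inv[OF \<theta>] by (rule arg_cong)
        ultimately show ?thesis using Lc[OF x] by simp
      qed
      then have "\<phi> \<otimes>\<^bsub>dualG\<^esub> inv\<^bsub>dualG\<^esub> \<theta> \<in> annihilator A G L"
        using M.m_closed[OF \<phi> M.inv_closed[OF \<theta>]] by (simp add: annihilator_def del: hom_group_simps)
      then show "(\<phi> \<otimes>\<^bsub>dualG\<^esub> inv\<^bsub>dualG\<^esub> inflate (carrier G) (D \<phi>), D \<phi>)
          \<in> annihilator A G L \<times> carrier (dualQ)"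
        using Dc[OF \<phi> t] by (simp add: \<theta>_def del: hom_group_simps)
    qed
    show "(\<lambda>\<phi>. (\<phi> \<otimes>\<^bsub>dualG\<^esub> inv\<^bsub>dualG\<^esub> inflate (carrier G) (D \<phi>), D \<phi>))
        ((\<lambda>(\<kappa>, \<psi>). lift \<kappa> \<psi>) y) = y"
      if yc: "y \<in> annihilator A G L \<times> carrier (dualQ)" for y
    proof -
      obtain \<kappa> \<psi> where y: "y = (\<kappa>, \<psi>)" "\<kappa> \<in> annihilator A G L" "\<psi> \<in> carrier (dualQ)"
        using yc by blast
      have "D (lift \<kappa> \<psi>) = \<psi>" unfolding D_def by (rule desc[OF y(2,3)])
      moreover have "lift \<kappa> \<psi> \<otimes>\<^bsub>dualG\<^esub>
          inv\<^bsub>dualG\<^esub> inflate (carrier G) \<psi> = \<kappa>"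
        using M.m_assoc[OF ann(1)[OF y(2)] infl[OF y(3)] M.inv_closed[OF infl[OF y(3)]]]
          M.r_inv[OF infl[OF y(3)]] M.r_one[OF ann(1)[OF y(2)]] by (simp only:)
      ultimately show ?thesis by (simp add: y(1) del: hom_group_simps)
    qed
    show "(\<lambda>(\<kappa>, \<psi>). lift \<kappa> \<psi>)
        ((\<lambda>\<phi>. (\<phi> \<otimes>\<^bsub>dualG\<^esub> inv\<^bsub>dualG\<^esub> inflate (carrier G) (D \<phi>), D \<phi>)) \<phi>) = \<phi>"
      if "\<phi> \<in> {\<phi> \<in> carrier (dualG). triv_on_N (L, restrict \<phi> L)}" for \<phi>
    proof -
      have \<phi>: "\<phi> \<in> carrier (dualG)" and i: "inflate (carrier G) (D \<phi>) \<in> carrier (dualG)"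
        using that infl[OF Dc] by auto
      have "\<phi> \<otimes>\<^bsub>dualG\<^esub> inv\<^bsub>dualG\<^esub> inflate (carrier G) (D \<phi>) \<otimes>\<^bsub>dualG\<^esub>
          inflate (carrier G) (D \<phi>) = \<phi>"
        using M.m_assoc[OF \<phi> M.inv_closed[OF i] i] M.l_inv[OF i] M.r_one[OF \<phi>] by (simp only:)
      then show ?thesis by simp
    qed
  qed
qed

lemma sum_annihilator:
  assumes L: "subgroup L G" and \<Phi>: "\<Phi> \<in> (dual_chars A G :: (('g \<Rightarrow> 'a) \<Rightarrow> 'k) set)"
  shows "(\<Sum>\<kappa>\<in>annihilator A G L. inverse (\<Phi> \<kappa>)) =
    (if \<forall>\<kappa>\<in>annihilator A G L. \<Phi> \<kappa> = 1 then of_nat (card (annihilator A G L)) else 0)"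
proof (cases "\<forall>\<kappa>\<in>annihilator A G L. \<Phi> \<kappa> = 1")
  case False
  interpret M: comm_group "dualG" by (rule comm_group_hom_group[OF A.comm_group_axioms is_group])
  have sub: "subgroup (annihilator A G L) (dualG)"
    by (rule annihilator_subgroup[OF subgroup.subset[OF L]])
  obtain y where y: "y \<in> annihilator A G L" "\<Phi> y \<noteq> 1" using False by blast
  have D: "\<Phi> (\<phi> \<otimes>\<^bsub>dualG\<^esub> \<psi>) = \<Phi> \<phi> * \<Phi> \<psi>"
    if "\<phi> \<in> carrier (dualG)" "\<psi> \<in> carrier (dualG)" for \<phi> \<psi>
    using \<Phi> that unfolding char_iff by blast
  have "(\<Sum>\<kappa>\<in>carrier (dualG\<lparr>carrier := annihilator A G L\<rparr>). inverse (\<Phi> \<kappa>)) = 0"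
    by (rule sum_nontrivial_char_eq_0[OF M.subgroup_imp_group[OF sub], of _ y])
       (use y D subgroup.mem_carrier[OF sub] in \<open>auto simp del: hom_group_simps\<close>)
  then show ?thesis unfolding if_not_P[OF False] by simp
qed simp

text \<open>The coefficient is the species at \<open>(G/N, \<Phi>\<^sub>N)\<close>. This pair and \<open>(G, \<Phi>)\<close> are fixed by conjugation, so
  the sum over conjugates has \<open>|G/N|\<close> equal terms and the stabilizer is \<open>G\<close>; and \<open>|G/N| |L \<inter> N| = |L|\<close> when
  \<open>LN = G\<close>.\<close>

theorem defl_coefficient:
  assumes \<Phi>: "\<Phi> \<in> (dual_chars A G :: (('g \<Rightarrow> 'a) \<Rightarrow> 'k) set)"
    and m: "fib_defl A G N (fib_idem A G (carrier G, \<Phi>)) =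
      scale m (fib_idem A (G Mod N) (quot_image G N (carrier G), char_quot A G N (carrier G) \<Phi>))"
  shows "m = of_nat (card (carrier (dualQ))) /
      (of_nat (card (carrier G)) * of_nat (card (carrier (dualG)))) *
    (\<Sum>L \<in> {L. subgroup L G \<and> L <#> N = carrier G \<and> (\<forall>\<phi>\<in>annihilator A G L. \<Phi> \<phi> = 1)}.
       of_nat (card L) * of_nat (card (annihilator A G L)) * of_int (moebius {L. subgroup L G} L (carrier G)))"
proof -
  let ?Q = "{L. subgroup L G}"
  define q0 where "q0 = (quot_image G N (carrier G), char_quot A G N (carrier G) \<Phi>)"
  have p: "(carrier G, \<Phi>) \<in> char_pairs A G" using \<Phi> by (simp add: char_pairs_iff subgroup_self)
  have full': "proj ` carrier G = carrier (G Mod N)" by (simp add: carrier_FactGroup)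
  have q0: "q0 \<in> char_pairs A (G Mod N)" unfolding q0_def by (rule char_quot_char_pair[OF p])
  have q0': "q0 = (carrier (G Mod N), \<lambda>\<psi>\<in>carrier (dualQ). \<Phi> (inflate (carrier G) \<psi>))"
    by (simp add: q0_def quot_image_eq char_quot_eq subgroup_self full')
  have D: "\<Phi> (\<phi> \<otimes>\<^bsub>dualG\<^esub> \<psi>) = \<Phi> \<phi> * \<Phi> \<psi>" "\<Phi> \<phi> \<noteq> 0"
    if "\<phi> \<in> carrier (dualG)" "\<psi> \<in> carrier (dualG)" for \<phi> \<psi>
    using \<Phi> that unfolding char_iff by blast+
  have finG: "finite (carrier (dualG))" using finite_dual[OF subgroup_self] by simp
  have m_eq: "m = species (G Mod N) q0 (fib_defl A G N (idem (carrier G, \<Phi>)))"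
    using m Q.species_scale[OF q0 Q.idem_in_fib_burnside] Q.species_idem[OF q0 q0]
      Q.conj_char_pair_one[OF q0] Q.one_closed
    by (simp add: fib_idem_eq[OF p] Q.fib_idem_eq[OF q0] q0_def[symmetric]) (metis Q.conj_char_pair_one)
  have conj_q0: "Q.act g q0 = q0" if "g \<in> carrier (G Mod N)" for g
  proof -
    have "g \<in> fst q0" using that by (simp add: q0')
    then show ?thesis
      using Q.conj_char_pair_self[of "fst q0" "snd q0" g] q0 by (simp only: prod.collapse)
  qed
  have stab: "{g \<in> carrier G. act g (carrier G, \<Phi>) = (carrier G, \<Phi>)} = carrier G"
    using conj_char_pair_self[OF p] by (auto simp del: conj_char_pair.simps)
  have m1: "m = of_nat (card (carrier (G Mod N))) * defl_inner (carrier G, \<Phi>) q0 /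
      (of_nat (card (carrier (dualG))) * of_nat (card (carrier G)))"
    unfolding m_eq species_defl_idem[OF p q0] stab by (simp add: conj_q0)
  have inner_sum: "(\<Sum>\<phi>\<in>carrier (dualG). inverse (\<Phi> \<phi>) * defl_val q0 (L, restrict \<phi> L)) =
      (if L <#> N = carrier G \<and> (\<forall>\<phi>\<in>annihilator A G L. \<Phi> \<phi> = 1) then
         of_nat (card (L \<inter> N)) * of_nat (card (carrier (dualQ))) * of_nat (card (annihilator A G L))
       else 0)" if L: "subgroup L G" for L
  proof (cases "L <#> N = carrier G")
    case True
    then have full: "proj ` L = carrier (G Mod N)" using proj_image_full_iff[OF L] by simp
    let ?f = "\<lambda>(\<kappa>, \<psi>). lift \<kappa> \<psi>"
    have infl: "inflate (carrier G) \<psi> \<in> carrier (dualG)" if "\<psi> \<in> carrier (dualQ)" for \<psi>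
      using inflate_dual[OF subgroup_self, of \<psi>] that by (simp add: full')
    have "(\<Sum>\<phi>\<in>carrier (dualG). inverse (\<Phi> \<phi>) * defl_val q0 (L, restrict \<phi> L)) =
        (\<Sum>\<phi>\<in>{\<phi> \<in> carrier (dualG). triv_on_N (L, restrict \<phi> L)}. inverse (\<Phi> \<phi>) * defl_val q0 (L, restrict \<phi> L))"
      by (rule sum.mono_neutral_right) (use finG in \<open>auto simp: defl_val_def\<close>)
    also have "\<dots> = (\<Sum>y\<in>annihilator A G L \<times> carrier (dualQ).
        inverse (\<Phi> (?f y)) * defl_val q0 (L, restrict (?f y) L))"
      by (rule sum.reindex_bij_betw[OF triv_bij(1)[OF L full], symmetric])
    also have "\<dots> = (\<Sum>(\<kappa>, \<psi>)\<in>annihilator A G L \<times> carrier (dualQ).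
        of_nat (card (L \<inter> N)) * inverse (\<Phi> \<kappa>))"
    proof (rule sum.cong[OF refl])
      fix y assume y: "y \<in> annihilator A G L \<times> carrier (dualQ)"
      then obtain \<kappa> \<psi> where y': "y = (\<kappa>, \<psi>)" "\<kappa> \<in> annihilator A G L" "\<psi> \<in> carrier (dualQ)" by blast
      have \<kappa>: "\<kappa> \<in> carrier (dualG)" using y'(2) by (simp add: annihilator_def)
      have "?f y \<in> {\<phi> \<in> carrier (dualG). triv_on_N (L, restrict \<phi> L)}"
        by (rule bij_betwE[OF triv_bij(1)[OF L full], rule_format, OF y])
      then have t: "triv_on_N (L, restrict (lift \<kappa> \<psi>) L)" by (simp add: y'(1))
      have "restrict \<psi> (carrier (G Mod N)) = \<psi>" using y'(3) by (simp add: carrier_hom_group extensional_restrict)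
      then have "Q.val q0 (defl_pair (L, restrict (lift \<kappa> \<psi>) L)) = \<Phi> (inflate (carrier G) \<psi>)"
        using triv_bij(2)[OF L full y'(2,3)] y'(3)
        by (simp add: Q.val_def defl_pair_def q0' full del: hom_group_simps)
      then show "inverse (\<Phi> (?f y)) * defl_val q0 (L, restrict (?f y) L) =
          (case y of (\<kappa>, \<psi>) \<Rightarrow> of_nat (card (L \<inter> N)) * inverse (\<Phi> \<kappa>))"
        using t D(1)[OF \<kappa> infl[OF y'(3)]] D(2)[OF infl[OF y'(3)] \<kappa>]
        by (simp add: y'(1) defl_val_def del: hom_group_simps)
    qed
    also have "\<dots> = of_nat (card (L \<inter> N)) * of_nat (card (carrier (dualQ))) *
        (\<Sum>\<kappa>\<in>annihilator A G L. inverse (\<Phi> \<kappa>))"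
      by (simp add: sum.cartesian_product[symmetric] sum_distrib_left mult_ac)
    finally show ?thesis using True by (simp add: sum_annihilator[OF L \<Phi>])
  next
    case False
    then have "\<not> carrier (G Mod N) \<subseteq> proj ` L"
      using proj_image_full_iff[OF L] subgroup.subset[OF subgroup_proj_image[OF L]] by blast
    then have "defl_val q0 (L, restrict \<phi> L) = 0" for \<phi>
      by (simp add: defl_val_def Q.val_def q0' defl_pair_def)
    then show ?thesis using False by simp
  qed
  have sub: "{L. subgroup L G \<and> L \<subseteq> carrier G} = ?Q" using subgroup.subset by blast
  let ?S = "{L. subgroup L G \<and> L <#> N = carrier G \<and> (\<forall>\<phi>\<in>annihilator A G L. \<Phi> \<phi> = 1)}"
  have "of_nat (card (carrier (G Mod N))) * defl_inner (carrier G, \<Phi>) q0 =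
     (\<Sum>L\<in>?Q. of_nat (card (carrier (G Mod N))) * (of_int (moebius ?Q L (carrier G)) *
        (\<Sum>\<phi>\<in>carrier (dualG). inverse (\<Phi> \<phi>) * defl_val q0 (L, restrict \<phi> L))))"
    by (simp add: defl_inner_def sub sum_distrib_left mult.assoc)
  also have "\<dots> = (\<Sum>L\<in>?Q. if L \<in> ?S then of_nat (card (carrier (dualQ))) *
     (of_nat (card L) * of_nat (card (annihilator A G L)) * of_int (moebius ?Q L (carrier G))) else 0)"
  proof (rule sum.cong[OF refl])
    fix L assume "L \<in> ?Q"
    then have L: "subgroup L G" by simp
    show "of_nat (card (carrier (G Mod N))) * (of_int (moebius ?Q L (carrier G)) *
        (\<Sum>\<phi>\<in>carrier (dualG). inverse (\<Phi> \<phi>) * defl_val q0 (L, restrict \<phi> L))) =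
      (if L \<in> ?S then of_nat (card (carrier (dualQ))) *
     (of_nat (card L) * of_nat (card (annihilator A G L)) * of_int (moebius ?Q L (carrier G))) else 0)"
    proof (cases "L \<in> ?S")
      case True
      then have "proj ` L = carrier (G Mod N)" using proj_image_full_iff[OF L] by simp
      then have c: "of_nat (card L) = (of_nat (card (carrier (G Mod N))) * of_nat (card (L \<inter> N)) :: 'k)"
        using card_proj_image[OF L] by (metis of_nat_mult)
      have cond: "L <#> N = carrier G \<and> (\<forall>\<phi>\<in>annihilator A G L. \<Phi> \<phi> = 1)" using True by simp
      show ?thesis unfolding inner_sum[OF L] if_P[OF cond] if_P[OF True] c by (simp add: mult_ac)
    next
      case False
      then have ncond: "\<not> (L <#> N = carrier G \<and> (\<forall>\<phi>\<in>annihilator A G L. \<Phi> \<phi> = 1))" using L by simp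
      show ?thesis unfolding inner_sum[OF L] if_not_P[OF ncond] if_not_P[OF False] by simp
    qed
  qed
  also have "\<dots> = (\<Sum>L\<in>?S. of_nat (card (carrier (dualQ))) *
     (of_nat (card L) * of_nat (card (annihilator A G L)) * of_int (moebius ?Q L (carrier G))))"
    by (subst sum.inter_filter[symmetric, OF finite_subgroups]) (intro sum.cong, auto)
  also have "\<dots> = of_nat (card (carrier (dualQ))) *
     (\<Sum>L\<in>?S. of_nat (card L) * of_nat (card (annihilator A G L)) * of_int (moebius ?Q L (carrier G)))"
    by (simp only: sum_distrib_left)
  finally show ?thesis unfolding m1 by (simp only:) (simp add: mult_ac)
qed

end

section \<open>The splitting hypothesis on subquotients\<close>

context fibered_group
begin

text \<open>A subgroup \<open>H\<close> is treated as the subquotient \<open>H/1\<close>; the two are isomorphic but not equal, and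
  \<open>descend\<close> for the trivial normal subgroup compares their dual groups.\<close>

lemma split_fibered_group_of_subquotients:
  assumes fin: "\<And>H. subgroup H G \<Longrightarrow> finite (carrier (hom_group A (G\<lparr>carrier := H\<rparr> Mod {\<one>})))"
    and split: "\<And>H. subgroup H G \<Longrightarrow>
      splitting_field TYPE('k::field_char_0) (hom_group A (G\<lparr>carrier := H\<rparr> Mod {\<one>}))"
  shows "split_fibered_group A G TYPE('k)"
proof -
  interpret T: fibered_normal A G "{\<one>}"
    by (intro fibered_normal.intro fibered_normal_axioms.intro fibered_group_axioms one_is_normal)
  have main: "finite (dual H) \<and> enough_chars TYPE('k) (dgroup H)" if H: "subgroup H G" for H
  proof -
    let ?F = "hom_group A ((G Mod {\<one>})\<lparr>carrier := (#>) {\<one>} ` H\<rparr>)"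
    have F: "?F = hom_group A (G\<lparr>carrier := H\<rparr> Mod {\<one>})" by (simp only: T.Mod_restrict_eq[OF H])
    have cF: "comm_group ?F" by (rule T.Q.comm_group_dual[OF T.subgroup_proj_image[OF H]])
    have fF: "finite (carrier ?F)" unfolding F by (rule fin[OF H])
    have "T.triv_on_N (H, \<phi>)" if "\<phi> \<in> dual H" for \<phi>
      using dual_one[OF H that] by (auto simp: T.triv_on_N_def)
    note d = T.descend_hom[OF H this]
    have "finite (dual H)"
      by (rule inj_on_finite[OF d(2) _ fF]) (use d(1) in \<open>auto simp: hom_def\<close>)
    moreover have "enough_chars TYPE('k) ?F"
      by (rule splitting_field_enough_chars[OF cF fF]) (unfold F, rule split[OF H])
    then have "enough_chars TYPE('k) (dgroup H)"
      by (rule enough_chars_inj[OF _ d comm_group.axioms(2)[OF comm_group_dual[OF H]] comm_group.axioms(2)[OF cF]])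
    ultimately show ?thesis ..
  qed
  then show ?thesis by unfold_locales auto
qed

end

lemma (in fibered_normal) split_fibered_group_Mod:
  assumes fin: "\<And>H. subgroup H G \<Longrightarrow> N \<lhd> G\<lparr>carrier := H\<rparr> \<Longrightarrow>
      finite (carrier (hom_group A (G\<lparr>carrier := H\<rparr> Mod N)))"
    and split: "\<And>H. subgroup H G \<Longrightarrow> N \<lhd> G\<lparr>carrier := H\<rparr> \<Longrightarrow>
      splitting_field TYPE('k::field_char_0) (hom_group A (G\<lparr>carrier := H\<rparr> Mod N))"
  shows "split_fibered_group A (G Mod N) TYPE('k)"
proof -
  have main: "finite (Q.dual E) \<and> enough_chars TYPE('k) (Q.dgroup E)"
    if E: "subgroup E (G Mod N)" for E
  proof -
    let ?P = "{x \<in> carrier G. proj x \<in> E}"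
    note P = subgroup_preimage[OF E]
    have n: "N \<lhd> G\<lparr>carrier := ?P\<rparr>" by (rule normal_restrict_supergroup[OF P(1) normal P(2)])
    have F: "Q.dgroup E = hom_group A (G\<lparr>carrier := ?P\<rparr> Mod N)"
      by (simp only: Mod_restrict_eq[OF P(1)] P(3))
    have fF: "finite (Q.dual E)" unfolding F by (rule fin[OF P(1) n])
    moreover have "enough_chars TYPE('k) (Q.dgroup E)"
      by (rule splitting_field_enough_chars[OF Q.comm_group_dual[OF E] fF]) (unfold F, rule split[OF P(1) n])
    ultimately show ?thesis ..
  qed
  then show ?thesis by unfold_locales auto
qed

theorem proposition4p3:
  fixes A :: "('a, 'n) monoid_scheme"
    and G :: "('g, 'm) monoid_scheme"
    and N :: "'g set"
  assumes "comm_group A"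
    and "group G" and "finite (carrier G)"
    and "\<And>H L. subgroup H G \<Longrightarrow> L \<lhd> G\<lparr>carrier := H\<rparr> \<Longrightarrow>
           finite (carrier (hom_group A (G\<lparr>carrier := H\<rparr> Mod L)))"
    and "\<And>H L. subgroup H G \<Longrightarrow> L \<lhd> G\<lparr>carrier := H\<rparr> \<Longrightarrow>
           splitting_field TYPE('k::field_char_0) (hom_group A (G\<lparr>carrier := H\<rparr> Mod L))"
    and "N \<lhd> G"
  shows
    "(\<forall>(H, \<Phi> :: ('g \<Rightarrow> 'a) \<Rightarrow> 'k) \<in> char_pairs A G.
        \<exists>m. fib_defl A G N (fib_idem A G (H, \<Phi>)) =
            scale m (fib_idem A (G Mod N) (quot_image G N H, char_quot A G N H \<Phi>)))
     \<and>
     (\<forall>\<Phi> \<in> (dual_chars A G :: (('g \<Rightarrow> 'a) \<Rightarrow> 'k) set). \<forall>m.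
        fib_defl A G N (fib_idem A G (carrier G, \<Phi>)) =
          scale m (fib_idem A (G Mod N)
            (quot_image G N (carrier G), char_quot A G N (carrier G) \<Phi>))
        \<longrightarrow>
        m = of_nat (card (carrier (hom_group A (G Mod N)))) /
              (of_nat (card (carrier G)) * of_nat (card (carrier (hom_group A G)))) *
            (\<Sum>K \<in> {K. subgroup K G \<and> K <#>\<^bsub>G\<^esub> N = carrier G \<and> (\<forall>\<phi>\<in>annihilator A G K. \<Phi> \<phi> = 1)}.
               of_nat (card K) * of_nat (card (annihilator A G K)) *
               of_int (moebius {L. subgroup L G} K (carrier G)))
        \<and> m \<in> \<rat>)"
proof -
  interpret A: comm_group A by fact
  interpret G: group G by fact
  interpret fibered_group A G by unfold_locales fact
  interpret fibered_normal A G N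
    by (intro fibered_normal.intro fibered_normal_axioms.intro fibered_group_axioms assms(6))
  have triv: "{\<one>\<^bsub>G\<^esub>} \<lhd> G\<lparr>carrier := H\<rparr>" if "subgroup H G" for H
    using group.one_is_normal[OF group_sub[OF that]] by simp
  interpret split_fibered_group A G "TYPE('k)"
  proof (rule split_fibered_group_of_subquotients)
    fix H assume H: "subgroup H G"
    show "finite (carrier (hom_group A (G\<lparr>carrier := H\<rparr> Mod {\<one>\<^bsub>G\<^esub>})))"
      by (rule assms(4)[OF H triv[OF H]])
    show "splitting_field TYPE('k) (hom_group A (G\<lparr>carrier := H\<rparr> Mod {\<one>\<^bsub>G\<^esub>}))"
      by (rule assms(5)[OF H triv[OF H]])
  qed
  have "split_fibered_group A (G Mod N) TYPE('k)"
    by (rule split_fibered_group_Mod[OF assms(4,5)])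
  then interpret split_fibered_normal A G "TYPE('k)" N
    by (intro split_fibered_normal.intro split_fibered_normal_axioms.intro
        split_fibered_group_axioms fibered_normal_axioms)
  show ?thesis
  proof (intro conjI ballI allI impI)
    fix p :: "'g set \<times> (('g \<Rightarrow> 'a) \<Rightarrow> 'k)" assume "p \<in> char_pairs A G"
    then show "case p of (H, \<Phi>) \<Rightarrow> \<exists>m. fib_defl A G N (fib_idem A G (H, \<Phi>)) =
        scale m (fib_idem A (G Mod N) (quot_image G N H, char_quot A G N H \<Phi>))"
      using fib_defl_idem by (cases p) simp
  next
    fix \<Phi> :: "('g \<Rightarrow> 'a) \<Rightarrow> 'k" and m
    assume "\<Phi> \<in> dual_chars A G"
      and "fib_defl A G N (fib_idem A G (carrier G, \<Phi>)) =
        scale m (fib_idem A (G Mod N) (quot_image G N (carrier G), char_quot A G N (carrier G) \<Phi>))"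
    note * = defl_coefficient[OF this]
    show "m = of_nat (card (carrier (hom_group A (G Mod N)))) /
              (of_nat (card (carrier G)) * of_nat (card (carrier (hom_group A G)))) *
            (\<Sum>K \<in> {K. subgroup K G \<and> K <#>\<^bsub>G\<^esub> N = carrier G \<and> (\<forall>\<phi>\<in>annihilator A G K. \<Phi> \<phi> = 1)}.
               of_nat (card K) * of_nat (card (annihilator A G K)) *
               of_int (moebius {L. subgroup L G} K (carrier G)))" by (rule *)
    show "m \<in> \<rat>" unfolding *
      by (intro Rats_mult Rats_divide Rats_sum Rats_of_nat Rats_of_int)
  qed
qed

end
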